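(* Let $\mathcal A$ be a nodal real line arrangement in $\mathbb A^2(\mathbb R)$. Then there exists a coherent collection $\{\gamma_C\}$ of orientations, indexed by the bounded chambers $C$ of $\mathcal A$; that is, one can choose for every bounded chamber $C$ an orientation $\gamma_C$ of $\phi^{-1}(\beta^\sharp C)$ such that $\gamma_C$ and $\gamma_{C'}$ are coherent whenever $C$ and $C'$ are bounded chambers such that $C\cap C'$ consists of a single point.
   Context: Setting. An arrangement $\mathcal A=\{\ell_1(\mathbb R),\dots,\ell_N(\mathbb R)\}$ of $N$ distinct real lines in $\mathbb A^2(\mathbb R)$ is nodal if no three of its lines are concurrent. Let $\ell_i(\mathbb C)\subset\mathbb A^2(\mathbb C)$ be the complexification of $\ell_i(\mathbb R)$, $B(\mathbb R)=\bigcup_i\ell_i(\mathbb R)$, $B(\mathbb C)=\bigcup_i\ell_i(\mathbb C)$, and $\mathcal P=\operatorname{Sing}B(\mathbb C)\subset\mathbb A^2(\mathbb R)$. Let $f$ be a product of real affine linear functions $\lambda_i$ with $\ell_i(\mathbb R)=\lambda_i^{-1}(0)$, one for each $i$. Let $\pi\colon W\to\mathbb A^2(\mathbb C)$ be the double covering $W=\{(\omega,Q)\in\mathbb C\times\mathbb A^2(\mathbb C): \omega^2=f(Q)\}$, and $\rho\colon X\to W$ the minimal resolution of singularities. Let $\beta\colon Y(\mathbb C)\to\mathbb A^2(\mathbb C)$ be the blow-up at the points of $\mathcal P$. For $S\subset\mathbb A^2(\mathbb C)$, the strict transform $\beta^\sharp S$ is the closure of $\beta^{-1}(S\setminus(S\cap\mathcal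 P))$ in $Y(\mathbb C)$. There is a double covering $\phi\colon X\to Y(\mathbb C)$ with branch locus $\beta^\sharp B(\mathbb C)$ such that $\beta\circ\phi=\pi\circ\rho$. For $P\in\mathcal P$, let $E_P$ be the exceptional curve over $P$ and $D_P=\phi^{-1}(E_P)$, a smooth rational curve. A chamber is the closure in $\mathbb A^2(\mathbb R)$ of a connected component of $\mathbb A^2(\mathbb R)\setminus B(\mathbb R)$. For a bounded chamber $C$ put $\operatorname{Vert}(C)=C\cap\mathcal P$. For $P\in\operatorname{Vert}(C)$, $S_{C,P}=\phi^{-1}(\beta^\sharp C)\cap D_P$ is a circle on the Riemann sphere $D_P$, dividing it into two closed hemispheres; $\phi^{-1}(\beta^\sharp C)$ is homeomorphic to a $2$-sphere minus disjoint open discs, with boundary $\bigsqcup_{P\in\operatorname{Vert}(C)}S_{C,P}$. For an orientation $\gamma_C$ of $\phi^{-1}(\beta^\sharp C)$, the capping hemisphere $H_{C,\gamma_C,P}$ is the closed hemisphere of $D_P$ with boundary $S_{C,P}$ such that the orientation on $S_{C,P}$ induced by the complex structure of $H_{C,\gamma_C,P}$ is opposite to the boundary orientation induced by $\gamma_C$. Coherence. If $C$ and $C'$ are bounded chambers such that $C\cap C'$ consists of a single point $P\in\mathcal P$, then $S_{C,P}=S_{C',P}$; orientations $\gamma_C$ and $\gamma_{C'}$ are called coherent if the capping hemispheres $H_{C,\gamma_C,P}$ and $H_{C',\gamma_{C'},P}$ are distinct. *)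

theory Defs
  imports "HOL-Analysis.Analysis"
begin

section \<open>Complex projective space\<close>

text \<open>The points of \<open>'n cproj\<close> are the nonzero vectors of \<open>complex ^ 'n\<close> up to nonzero
  scalars, so \<open>2 cproj\<close> is the projective line and \<open>3 cproj\<close> the projective plane.
  The value of \<open>cpoint\<close> at the zero vector is meaningless.\<close>

definition proj_rel :: "complex ^ 'n \<Rightarrow> complex ^ 'n \<Rightarrow> bool" where
  "proj_rel u v \<longleftrightarrow> u \<noteq> 0 \<and> v \<noteq> 0 \<and> (\<exists>c. c \<noteq> 0 \<and> u = c *s v)"

lemma part_equivp_proj_rel: "part_equivp (proj_rel :: complex ^ 'n \<Rightarrow> _)"
proof (rule part_equivpI)
  have "proj_rel (axis undefined 1) (axis undefined 1 :: complex ^ 'n)"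
    unfolding proj_rel_def by (auto simp: axis_eq_0_iff intro!: exI[of _ 1])
  then show "\<exists>x. proj_rel x (x :: complex ^ 'n)" ..
  show "symp (proj_rel :: complex ^ 'n \<Rightarrow> _)"
  proof (rule sympI)
    fix u v :: "complex ^ 'n"
    assume "proj_rel u v"
    then obtain c where "u \<noteq> 0" "v \<noteq> 0" "c \<noteq> 0" "u = c *s v"
      unfolding proj_rel_def by blast
    moreover from this have "v = inverse c *s u"
      by (simp add: vector_smult_assoc)
    ultimately show "proj_rel v u"
      unfolding proj_rel_def by (metis inverse_nonzero_iff_nonzero)
  qed
  show "transp (proj_rel :: complex ^ 'n \<Rightarrow> _)"
    unfolding proj_rel_def by (rule transpI) (metis mult_eq_0_iff vector_smult_assoc)
qed

quotient_type 'n cproj = "complex ^ 'n" / partial: proj_rel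
  morphisms crep cpoint
  by (rule part_equivp_proj_rel)

instantiation cproj :: (finite) topological_space
begin

definition open_cproj :: "'a cproj set \<Rightarrow> bool" where
  "open_cproj U \<longleftrightarrow> open {v. v \<noteq> 0 \<and> cpoint v \<in> U}"

instance
proof
  show "open (UNIV :: 'a cproj set)"
    unfolding open_cproj_def by (simp add: open_Collect_neq)
  fix S T :: "'a cproj set"
  assume "open S" "open T"
  then have "open ({v. v \<noteq> 0 \<and> cpoint v \<in> S} \<inter> {v. v \<noteq> 0 \<and> cpoint v \<in> T})"
    unfolding open_cproj_def by (rule open_Int)
  also have "{v. v \<noteq> 0 \<and> cpoint v \<in> S} \<inter> {v. v \<noteq> 0 \<and> cpoint v \<in> T}
      = {v. v \<noteq> 0 \<and> cpoint v \<in> S \<inter> T}"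
    by blast
  finally show "open (S \<inter> T)"
    unfolding open_cproj_def .
next
  fix K :: "'a cproj set set"
  assume "\<forall>S\<in>K. open S"
  then have "open (\<Union>S\<in>K. {v. v \<noteq> 0 \<and> cpoint v \<in> S})"
    unfolding open_cproj_def by (intro open_UN)
  also have "(\<Union>S\<in>K. {v. v \<noteq> 0 \<and> cpoint v \<in> S}) = {v. v \<noteq> 0 \<and> cpoint v \<in> \<Union>K}"
    by blast
  finally show "open (\<Union>K)"
    unfolding open_cproj_def .
qed

end


section \<open>Line arrangements\<close>

definition nodal_arrangement :: "(real ^ 2) set set \<Rightarrow> bool" where
  "nodal_arrangement \<A> \<longleftrightarrow>
     finite \<A> \<and>
     (\<forall>l\<in>\<A>. affine l \<and> aff_dim l = 1) \<and>
     (\<forall>l\<in>\<A>. \<forall>m\<in>\<A>. \<forall>n\<in>\<A>. l \<noteq> m \<and> m \<noteq> n \<and> l \<noteq> n \<longrightarrow> l \<inter> m \<inter> n = {})"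

definition bounded_chambers :: "(real ^ 2) set set \<Rightarrow> (real ^ 2) set set" where
  "bounded_chambers \<A> = {C \<in> closure ` components (- \<Union>\<A>). bounded C}"

text \<open>A pair \<open>(a, b)\<close> stands for the real affine linear function \<open>x \<mapsto> a \<bullet> x + b\<close>.\<close>

type_synonym affine_fun = "(real ^ 2) \<times> real"

definition real_value :: "affine_fun \<Rightarrow> real ^ 2 \<Rightarrow> real" where
  "real_value p x = fst p \<bullet> x + snd p"

definition complex_value :: "affine_fun \<Rightarrow> complex ^ 2 \<Rightarrow> complex" where
  "complex_value p Q = (\<Sum>i\<in>UNIV. of_real (fst p $ i) * Q $ i) + of_real (snd p)"

definition defines_lines :: "(real ^ 2) set set \<Rightarrow> ((real ^ 2) set \<Rightarrow> affine_fun) \<Rightarrow> bool" where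
  "defines_lines \<A> lam \<longleftrightarrow> (\<forall>l\<in>\<A>. l = {x. real_value (lam l) x = 0})"

definition complexify :: "real ^ 2 \<Rightarrow> complex ^ 2" where
  "complexify x = (\<chi> i. of_real (x $ i))"

text \<open>In the remaining definitions \<open>lam\<close> is assumed to satisfy \<^term>\<open>defines_lines \<A> lam\<close>.\<close>

definition arr_poly :: "(real ^ 2) set set \<Rightarrow> ((real ^ 2) set \<Rightarrow> affine_fun) \<Rightarrow> complex ^ 2 \<Rightarrow> complex"
  where "arr_poly \<A> lam Q = (\<Prod>l\<in>\<A>. complex_value (lam l) Q)"

definition complex_curve :: "(real ^ 2) set set \<Rightarrow> ((real ^ 2) set \<Rightarrow> affine_fun) \<Rightarrow> (complex ^ 2) set"
  where "complex_curve \<A> lam = (\<Union>l\<in>\<A>. {Q. complex_value (lam l) Q = 0})"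

text \<open>The singular locus, by the Jacobian criterion; \<^const>\<open>arr_poly\<close> is a reduced equation of
  \<^const>\<open>complex_curve\<close> because the lines are distinct.\<close>

definition nodes :: "(real ^ 2) set set \<Rightarrow> ((real ^ 2) set \<Rightarrow> affine_fun) \<Rightarrow> (complex ^ 2) set" where
  "nodes \<A> lam = {Q \<in> complex_curve \<A> lam. (arr_poly \<A> lam has_derivative (\<lambda>_. 0)) (at Q)}"


section \<open>The blow-up, the double plane and its resolution\<close>

text \<open>A point of the blow-up \<open>Y\<close> consists of a point of the plane and one point of the projective
  line for every node; at arguments that are not nodes the second component is \<^term>\<open>undefined\<close>.
  \<open>Y\<close> is the closure of the graph of the maps \<open>Q \<mapsto> [Q - P]\<close> away from the nodes.\<close>

type_synonym ypoint = "(complex ^ 2) \<times> (complex ^ 2 \<Rightarrow> 2 cproj)"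

definition blowup :: "(real ^ 2) set set \<Rightarrow> ((real ^ 2) set \<Rightarrow> affine_fun) \<Rightarrow> ypoint set" where
  "blowup \<A> lam =
     closure {(Q, \<lambda>P\<in>nodes \<A> lam. cpoint (Q - P)) | Q. Q \<notin> nodes \<A> lam}"

definition blowdown :: "ypoint \<Rightarrow> complex ^ 2" where
  "blowdown y = fst y"

definition strict_transform ::
    "(real ^ 2) set set \<Rightarrow> ((real ^ 2) set \<Rightarrow> affine_fun) \<Rightarrow> (complex ^ 2) set \<Rightarrow> ypoint set" where
  "strict_transform \<A> lam S =
     blowup \<A> lam \<inter> closure {y \<in> blowup \<A> lam. blowdown y \<in> S - S \<inter> nodes \<A> lam}"

definition exceptional_curve ::
    "(real ^ 2) set set \<Rightarrow> ((real ^ 2) set \<Rightarrow> affine_fun) \<Rightarrow> complex ^ 2 \<Rightarrow> ypoint set" where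
  "exceptional_curve \<A> lam P = {y \<in> blowup \<A> lam. blowdown y = P}"

definition double_plane ::
    "(real ^ 2) set set \<Rightarrow> ((real ^ 2) set \<Rightarrow> affine_fun) \<Rightarrow> (complex \<times> (complex ^ 2)) set" where
  "double_plane \<A> lam = {(\<omega>, Q). \<omega>\<^sup>2 = arr_poly \<A> lam Q}"

definition join :: "complex \<Rightarrow> complex ^ 2 \<Rightarrow> complex ^ 3" where
  "join w v = vector [w, v $ 1, v $ 2]"

definition plane_part :: "complex ^ 3 \<Rightarrow> complex ^ 2" where
  "plane_part u = vector [u $ 2, u $ 3]"

text \<open>The singularities of the double plane \<open>W\<close> are the points \<open>(0, P)\<close> over the nodes \<open>P\<close>. Each of
  them is an ordinary double point, locally \<open>\<omega>\<^sup>2 = u v\<close>, so blowing it up once resolves it with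
  exceptional curve the smooth conic \<open>w\<^sup>2 = u v\<close>, of self-intersection \<open>-2\<close>. The minimal resolution
  \<open>X\<close> is therefore the blow-up of \<open>W\<close> at these points: the closure of the graph of the maps
  \<open>(\<omega>, Q) \<mapsto> [\<omega> : Q - P]\<close>. The resolution map is \<^const>\<open>fst\<close>.\<close>

type_synonym xpoint = "(complex \<times> (complex ^ 2)) \<times> (complex ^ 2 \<Rightarrow> 3 cproj)"

definition resolution :: "(real ^ 2) set set \<Rightarrow> ((real ^ 2) set \<Rightarrow> affine_fun) \<Rightarrow> xpoint set" where
  "resolution \<A> lam =
     closure {((\<omega>, Q), \<lambda>P\<in>nodes \<A> lam. cpoint (join \<omega> (Q - P))) | \<omega> Q.
       (\<omega>, Q) \<in> double_plane \<A> lam \<and> Q \<notin> nodes \<A> lam}"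

text \<open>The double covering \<open>\<phi> : X \<rightarrow> Y\<close> sends \<open>[w : v]\<close> to \<open>[v]\<close> in every projective coordinate; on
  \<open>X\<close> one always has \<open>v \<noteq> 0\<close>. Since it does not change \<open>Q\<close>, one has
  \<open>blowdown \<circ> \<phi> = snd \<circ> fst\<close>.\<close>

definition double_cover ::
    "(real ^ 2) set set \<Rightarrow> ((real ^ 2) set \<Rightarrow> affine_fun) \<Rightarrow> xpoint \<Rightarrow> ypoint" where
  "double_cover \<A> lam x =
     (snd (fst x), \<lambda>P\<in>nodes \<A> lam. cpoint (plane_part (crep (snd x P))))"

definition exceptional_sphere ::
    "(real ^ 2) set set \<Rightarrow> ((real ^ 2) set \<Rightarrow> affine_fun) \<Rightarrow> complex ^ 2 \<Rightarrow> xpoint set" where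
  "exceptional_sphere \<A> lam P =
     {x \<in> resolution \<A> lam. double_cover \<A> lam x \<in> exceptional_curve \<A> lam P}"

definition lifted_chamber ::
    "(real ^ 2) set set \<Rightarrow> ((real ^ 2) set \<Rightarrow> affine_fun) \<Rightarrow> (real ^ 2) set \<Rightarrow> xpoint set" where
  "lifted_chamber \<A> lam C =
     {x \<in> resolution \<A> lam. double_cover \<A> lam x \<in> strict_transform \<A> lam (complexify ` C)}"

definition boundary_circle ::
    "(real ^ 2) set set \<Rightarrow> ((real ^ 2) set \<Rightarrow> affine_fun) \<Rightarrow> (real ^ 2) set \<Rightarrow> complex ^ 2 \<Rightarrow> xpoint set"
  where "boundary_circle \<A> lam C P = lifted_chamber \<A> lam C \<inter> exceptional_sphere \<A> lam P"


section \<open>Smooth parametrizations\<close>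

text \<open>In this and the next section \<open>N\<close> is the set of nodes. A map into a projective space is
  smooth (holomorphic) if it locally lifts to a smooth (holomorphic) map into nonzero vectors, and
  the kernel of its differential consists of the vectors \<open>\<xi>\<close> for which the differential of the lift
  at \<open>\<xi>\<close> is a multiple of the lift. A map into \<open>X\<close> is treated componentwise.\<close>

definition lifts_to ::
    "(complex ^ 2) set \<Rightarrow> 'a set \<Rightarrow> ('a \<Rightarrow> xpoint) \<Rightarrow> (complex ^ 2 \<Rightarrow> 'a \<Rightarrow> complex ^ 3) \<Rightarrow> bool" where
  "lifts_to N V g h \<longleftrightarrow> (\<forall>t\<in>V. \<forall>P\<in>N. h P t \<noteq> 0 \<and> snd (g t) P = cpoint (h P t))"

definition C1_derivative ::
    "'a::real_normed_vector set \<Rightarrow> ('a \<Rightarrow> 'b::real_normed_vector) \<Rightarrow> ('a \<Rightarrow> 'a \<Rightarrow>\<^sub>L 'b) \<Rightarrow> bool" where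
  "C1_derivative V f f' \<longleftrightarrow>
     (\<forall>t\<in>V. (f has_derivative blinfun_apply (f' t)) (at t within V)) \<and> continuous_on V f'"

definition C1_immersion ::
    "(complex ^ 2) set \<Rightarrow> 'a::real_normed_vector set \<Rightarrow> ('a \<Rightarrow> xpoint) \<Rightarrow> bool" where
  "C1_immersion N U g \<longleftrightarrow>
     (\<forall>z\<in>U. \<exists>V h q' h'. openin (top_of_set U) V \<and> z \<in> V \<and> lifts_to N V g h \<and>
        C1_derivative V (\<lambda>t. fst (g t)) q' \<and> (\<forall>P\<in>N. C1_derivative V (h P) (h' P)) \<and>
        (\<forall>\<xi>. blinfun_apply (q' z) \<xi> = 0 \<and> (\<forall>P\<in>N. \<exists>c. blinfun_apply (h' P z) \<xi> = c *s h P z) \<longrightarrow> \<xi> = 0))"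

text \<open>Local \<open>C\<^sup>1\<close> parametrizations, with domain \<open>U\<close>, of relatively open pieces of \<open>M\<close>.\<close>

definition local_param ::
    "(complex ^ 2) set \<Rightarrow> xpoint set \<Rightarrow> 'a::real_normed_vector set \<Rightarrow> ('a \<Rightarrow> xpoint) \<Rightarrow> bool" where
  "local_param N M U g \<longleftrightarrow>
     openin (top_of_set M) (g ` U) \<and> (\<exists>g'. homeomorphism U (g ` U) g g') \<and> C1_immersion N U g"

text \<open>Surfaces with boundary are parametrized by relatively open subsets of the closed upper half
  plane, curves by open subsets of the real line.\<close>

type_synonym surface_chart = "complex set \<times> (complex \<Rightarrow> xpoint)"
type_synonym curve_chart = "real set \<times> (real \<Rightarrow> xpoint)"

definition surface_charts :: "(complex ^ 2) set \<Rightarrow> xpoint set \<Rightarrow> surface_chart set" where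
  "surface_charts N M = {(U, g). openin (top_of_set {z. 0 \<le> Im z}) U \<and> local_param N M U g}"

definition curve_charts :: "(complex ^ 2) set \<Rightarrow> xpoint set \<Rightarrow> curve_chart set" where
  "curve_charts N S = {(I, c). open I \<and> local_param N S I c}"

definition holomorphic_charts :: "(complex ^ 2) set \<Rightarrow> xpoint set \<Rightarrow> surface_chart set" where
  "holomorphic_charts N D = {(U, g). open U \<and> local_param N D U g \<and>
     (\<forall>z\<in>U. \<exists>V h. open V \<and> z \<in> V \<and> V \<subseteq> U \<and> lifts_to N V g h \<and>
        (\<lambda>t. fst (fst (g t))) holomorphic_on V \<and>
        (\<forall>i. (\<lambda>t. snd (fst (g t)) $ i) holomorphic_on V) \<and>
        (\<forall>P\<in>N. \<forall>i. (\<lambda>t. h P t $ i) holomorphic_on V))}"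


section \<open>Orientations\<close>

text \<open>The expression \<open>Im (cnj (A 1) * A \<i>)\<close> is the determinant of the real linear map \<open>A\<close>, so the
  following says that the transition map from \<open>(U, g)\<close> to \<open>(V, h)\<close> has positive Jacobian.\<close>

definition orientation_compatible :: "surface_chart \<Rightarrow> surface_chart \<Rightarrow> bool" where
  "orientation_compatible = (\<lambda>(U, g) (V, h). \<forall>z\<in>U. g z \<in> h ` V \<longrightarrow>
     (\<exists>A. ((\<lambda>t. inv_into V h (g t)) has_derivative A) (at z within U \<inter> g -` (h ` V)) \<and>
          0 < Im (cnj (A 1) * A \<i>)))"

text \<open>An orientation is a maximal oriented atlas.\<close>

definition is_orientation :: "(complex ^ 2) set \<Rightarrow> xpoint set \<Rightarrow> surface_chart set \<Rightarrow> bool" where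
  "is_orientation N M \<gamma> \<longleftrightarrow>
     \<gamma> \<subseteq> surface_charts N M \<and>
     (\<Union>(U, g)\<in>\<gamma>. g ` U) = M \<and>
     (\<forall>p\<in>\<gamma>. \<forall>q\<in>\<gamma>. orientation_compatible p q) \<and>
     (\<forall>p\<in>surface_charts N M.
        (\<forall>q\<in>\<gamma>. orientation_compatible p q \<and> orientation_compatible q p) \<longrightarrow> p \<in> \<gamma>)"

text \<open>The orientation of a closed region \<open>H\<close> of a complex curve \<open>D\<close> given by the complex structure.\<close>

definition complex_orientation ::
    "(complex ^ 2) set \<Rightarrow> xpoint set \<Rightarrow> xpoint set \<Rightarrow> surface_chart set" where
  "complex_orientation N D H =
     {p \<in> surface_charts N H. \<forall>q\<in>holomorphic_charts N D. orientation_compatible p q}"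

text \<open>The orientation of a union \<open>S\<close> of boundary components induced by an oriented surface, given by
  all positively oriented local parametrizations of \<open>S\<close>. By the outward-normal-first rule the
  boundary of the upper half plane is oriented in the positive direction of the real line.\<close>

definition boundary_orientation ::
    "(complex ^ 2) set \<Rightarrow> surface_chart set \<Rightarrow> xpoint set \<Rightarrow> curve_chart set" where
  "boundary_orientation N \<gamma> S =
     {(I, c) \<in> curve_charts N S. \<forall>(U, g)\<in>\<gamma>. \<forall>s\<in>I. c s \<in> g ` U \<longrightarrow>
        (\<exists>d>0. ((\<lambda>t. inv_into U g (c t)) has_vector_derivative complex_of_real d)
                  (at s within I \<inter> c -` (g ` U)))}"

definition opposite_orientation :: "curve_chart set \<Rightarrow> curve_chart set" where
  "opposite_orientation \<sigma> = (\<lambda>(I, c). (uminus ` I, \<lambda>t. c (- t))) ` \<sigma>"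

definition hemispheres :: "xpoint set \<Rightarrow> xpoint set \<Rightarrow> xpoint set set" where
  "hemispheres D S = (\<lambda>K. D \<inter> closure K) ` components (D - S)"

definition capping_hemisphere ::
    "(real ^ 2) set set \<Rightarrow> ((real ^ 2) set \<Rightarrow> affine_fun) \<Rightarrow> (real ^ 2) set \<Rightarrow> surface_chart set
      \<Rightarrow> complex ^ 2 \<Rightarrow> xpoint set" where
  "capping_hemisphere \<A> lam C \<gamma> P =
     (let N = nodes \<A> lam; D = exceptional_sphere \<A> lam P; S = boundary_circle \<A> lam C P in
      THE H. H \<in> hemispheres D S \<and>
        boundary_orientation N (complex_orientation N D H) S
          = opposite_orientation (boundary_orientation N \<gamma> S))"

text \<open>Meaningful for bounded chambers \<open>C\<close>, \<open>C'\<close> whose intersection is the single point \<open>P\<close>.\<close>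

definition coherent ::
    "(real ^ 2) set set \<Rightarrow> ((real ^ 2) set \<Rightarrow> affine_fun) \<Rightarrow> real ^ 2
      \<Rightarrow> (real ^ 2) set \<Rightarrow> surface_chart set \<Rightarrow> (real ^ 2) set \<Rightarrow> surface_chart set \<Rightarrow> bool" where
  "coherent \<A> lam P C \<gamma> C' \<gamma>' \<longleftrightarrow>
     capping_hemisphere \<A> lam C \<gamma> (complexify P) \<noteq> capping_hemisphere \<A> lam C' \<gamma>' (complexify P)"

end

theory Submission
  imports Defs "HOL-Complex_Analysis.Conformal_Mappings"
begin

text \<open>The idea. Let \<open>f\<close> be the product of the affine functions. On a chamber \<open>f\<close> has a constant sign, so
  the points of the double plane over the chamber have \<open>\<omega> = \<kappa>0 y\<close> with \<open>y\<close> real, \<open>y\<^sup>2 = \<bar>f\<bar>\<close> and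
  \<open>\<kappa>0 \<in> {1, \<i>}\<close>. All lifted chambers are oriented by one and the same area form
  \<open>dx\<^sub>1 \<and> dx\<^sub>2 / y\<close>, which is, up to a constant, the restriction of the nowhere vanishing holomorphic
  two-form \<open>dx\<^sub>1 \<and> dx\<^sub>2 / \<omega>\<close> on the resolution: on the sheet \<open>y > 0\<close> the projection to the plane
  preserves the orientation, on the sheet \<open>y < 0\<close> it reverses it.

  Why this choice is coherent. Near a node let \<open>u\<close> and \<open>v\<close> be the two affine functions vanishing
  there, so that \<open>\<bar>f\<bar> = u v h\<close> with \<open>h > 0\<close> on the chambers \<open>u, v \<ge> 0\<close> and \<open>u, v \<le> 0\<close>. In the
  coordinates \<open>u = \<rho> \<zeta>\<^sup>2\<close>, \<open>v = \<rho>\<close>, \<open>y = \<rho> \<zeta> \<surd>h\<close> the lifts of these two opposite chambers are the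
  parts \<open>\<rho> \<ge> 0\<close> and \<open>\<rho> \<le> 0\<close> of a smooth annulus, separated by the circle \<open>\<rho> = 0\<close> over the node, and
  \<open>du \<and> dv / y = 2 d\<zeta> \<and> d\<rho> / \<surd>h\<close> has no zero. Two halves of an oriented surface induce opposite
  orientations on the curve that separates them, so the capping hemispheres are different.

  How this is carried out. The exceptional sphere over a node is the conic \<open>w\<^sup>2 = \<kappa>\<^sup>2 U V\<close>, where \<open>U\<close>
  and \<open>V\<close> are the linear parts of \<open>u\<close> and \<open>v\<close>. It is parametrized by \<open>(s : t) \<mapsto> [\<kappa> s t : s\<^sup>2 : t\<^sup>2]\<close>,
  and the points with \<open>s / t\<close> real or infinite are the circle (\<open>exceptional_sphere_eq\<close>,
  \<open>E_in_lifted_chamber_iff\<close>). The coordinates \<open>\<zeta> + \<i> \<rho>\<close> at all corners of a chamber are charts of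
  its lift which cover it (\<open>corner_chart\<close>, \<open>corner_atlas_covers\<close>) and have transition maps of
  positive determinant (\<open>charts_compatible\<close>), so they generate an orientation
  (\<open>is_orientation_generated\<close>). A boundary orientation can be tested on any atlas of the
  orientation (\<open>boundary_orientation_atlas\<close>). On the circle the corner charts and the holomorphic
  coordinate \<open>s / t\<close> of the sphere agree up to the sign \<open>\<sigma>\<close> of the determinant of \<open>(u, v)\<close>, which
  identifies the capping hemisphere as \<open>\<sigma> Im (s / t) \<le> 0\<close> (\<open>capping_hemisphere_eq\<close>). The opposite
  chamber has the same \<open>\<sigma>\<close>, but since \<open>u\<close> and \<open>v\<close> change sign, its parameter \<open>s / t\<close> is the negative
  of the first one (\<open>opposite_E\<close>), so its capping hemisphere is the other one.\<close>

section \<open>The topology of projective space\<close>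

lemma cpoint_eq_iff:
  fixes u v :: "complex ^ 'n"
  assumes "u \<noteq> 0" "v \<noteq> 0"
  shows "cpoint u = cpoint v \<longleftrightarrow> (\<exists>c. c \<noteq> 0 \<and> u = c *s v)"
proof -
  have "proj_rel u u" "proj_rel v v"
    using assms unfolding proj_rel_def by (auto intro!: exI[of _ 1])
  then have "cpoint u = cpoint v \<longleftrightarrow> proj_rel u v"
    using Quotient_rel[OF Quotient_cproj] by blast
  then show ?thesis
    using assms unfolding proj_rel_def by blast
qed

lemma crep_nonzero: "crep (p :: 'n::finite cproj) \<noteq> 0"
  and cpoint_crep: "cpoint (crep p) = (p :: 'n cproj)"
  using Quotient_rep_reflp[OF Quotient_cproj, of p] Quotient_abs_rep[OF Quotient_cproj, of p]
  by (auto simp: proj_rel_def)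

lemma crep_cpoint:
  fixes v :: "complex ^ 'n"
  assumes "v \<noteq> 0"
  obtains c where "c \<noteq> 0" "crep (cpoint v) = c *s v"
  using cpoint_eq_iff[OF crep_nonzero[of "cpoint v"] assms] cpoint_crep by metis

lemma cpoint_scale:
  fixes v :: "complex ^ 'n"
  assumes "v \<noteq> 0" "c \<noteq> 0"
  shows "cpoint (c *s v) = cpoint v"
  using assms by (subst cpoint_eq_iff) auto

lemma continuous_on_cpoint:
  fixes h :: "'a::topological_space \<Rightarrow> complex ^ 'n"
  assumes h: "continuous_on S h" and nz: "\<And>x. x \<in> S \<Longrightarrow> h x \<noteq> 0"
  shows "continuous_on S (\<lambda>x. cpoint (h x))"
proof -
  have "\<exists>A. open A \<and> A \<inter> S = (\<lambda>x. cpoint (h x)) -` B \<inter> S" if "open B" for B :: "'n::finite cproj set"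
  proof -
    have "open {v. v \<noteq> 0 \<and> cpoint v \<in> B}"
      using that unfolding open_cproj_def .
    then obtain A where "open A" "A \<inter> S = h -` {v. v \<noteq> 0 \<and> cpoint v \<in> B} \<inter> S"
      using h unfolding continuous_on_open_invariant by blast
    then show ?thesis using nz by (intro exI[of _ A]) auto
  qed
  then show ?thesis unfolding continuous_on_open_invariant by blast
qed

text \<open>The projection to projective space is open because scaling by a nonzero constant is a
  homeomorphism.\<close>

lemma open_image_cpoint:
  fixes B :: "(complex ^ 'n) set"
  assumes "open B"
  shows "open (cpoint ` (B - {0}))"
proof -
  have eq: "{v. v \<noteq> 0 \<and> cpoint v \<in> cpoint ` (B - {0})}
      = (\<Union>c\<in>-{0}. (\<lambda>v. c *s v) -` (B - {0}))" (is "?L = ?R")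
  proof
    show "?L \<subseteq> ?R"
    proof
      fix v assume "v \<in> ?L"
      then obtain b where b: "b \<in> B" "b \<noteq> 0" "v \<noteq> 0" "cpoint b = cpoint v"
        by force
      then obtain c where "c \<noteq> 0" "b = c *s v"
        using cpoint_eq_iff[of b v] by blast
      then show "v \<in> ?R" using b by auto
    qed
    show "?R \<subseteq> ?L"
    proof
      fix v assume "v \<in> ?R"
      then obtain c where c: "c \<noteq> 0" "c *s v \<in> B" "c *s v \<noteq> 0" by auto
      then have "v \<noteq> 0" by auto
      then show "v \<in> ?L" using c cpoint_scale[of v c]
        by (auto intro!: image_eqI[where x = "c *s v"])
    qed
  qed
  have "open ((\<lambda>v. c *s v) -` (B - {0}))" for c
  proof -
    have "continuous_on UNIV (\<lambda>v :: complex ^ 'n. c *s v)"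
      unfolding vector_scalar_mult_def by (intro continuous_intros)
    moreover have "open (B - {0})" using assms by (simp add: open_Diff)
    ultimately show ?thesis
      by (rule open_vimage[rotated])
  qed
  then show ?thesis
    unfolding open_cproj_def eq by (intro open_UN ballI)
qed

text \<open>By openness of the projection, a condition on points of projective space (with parameters)
  is open or closed as soon as the condition on representatives is.\<close>

lemma open_Collect_cproj:
  fixes R :: "'a::topological_space \<Rightarrow> 'n::finite cproj \<Rightarrow> bool"
  assumes "open {(a, v). v \<noteq> 0 \<and> R a (cpoint v)}"
  shows "open {(a, p). R a p}"
proof (subst open_subopen, intro ballI)
  fix ap assume "ap \<in> {(a, p). R a p}"
  then obtain a p where ap: "ap = (a, p)" "R a p" by auto
  have rep: "(a, crep p) \<in> {(a, v). v \<noteq> 0 \<and> R a (cpoint v)}"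
    using ap by (simp add: crep_nonzero cpoint_crep)
  obtain A B where AB: "open A" "open B"
    "(a, crep p) \<in> A \<times> B" "A \<times> B \<subseteq> {(a, v). v \<noteq> 0 \<and> R a (cpoint v)}"
    by (rule open_prod_elim[OF assms rep])
  have "open (A \<times> cpoint ` (B - {0}))"
    using AB open_image_cpoint by (intro open_Times) auto
  moreover have "ap \<in> A \<times> cpoint ` (B - {0})"
  proof -
    have "p \<in> cpoint ` (B - {0})"
      using AB(3) crep_nonzero[of p]
      by (intro image_eqI[where x = "crep p"]) (simp_all add: cpoint_crep)
    then show ?thesis using AB(3) ap by simp
  qed
  moreover have "A \<times> cpoint ` (B - {0}) \<subseteq> {(a, p). R a p}"
    using AB(4) by auto
  ultimately show "\<exists>T. open T \<and> ap \<in> T \<and> T \<subseteq> {(a, p). R a p}" by blast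
qed

text \<open>The function \<open>F\<close> is evaluated at an arbitrary representative, so its vanishing, or below its
  positivity, must not depend on the representative.\<close>

lemma open_Collect_crep_neq:
  fixes F :: "'a::topological_space \<Rightarrow> complex ^ 'n \<Rightarrow> 'b::{t1_space,zero}"
  assumes cont: "continuous_on UNIV (\<lambda>(a, v). F a v)"
    and hom: "\<And>a v c. c \<noteq> 0 \<Longrightarrow> F a (c *s v) = 0 \<longleftrightarrow> F a v = 0"
  shows "open {(a, p). F a (crep p) \<noteq> 0}"
proof (rule open_Collect_cproj)
  have "F a (crep (cpoint v)) = 0 \<longleftrightarrow> F a v = 0" if "v \<noteq> 0" for a v
    using crep_cpoint[OF that] hom by metis
  then have "{(a, v). v \<noteq> 0 \<and> F a (crep (cpoint v)) \<noteq> 0}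
     = (UNIV \<times> - {0}) \<inter> (\<lambda>(a, v). F a v) -` (- {0})"
    by auto
  moreover have "open \<dots>"
    by (rule open_Int[OF open_Times[OF open_UNIV] open_vimage[OF _ cont]]) auto
  ultimately show "open {(a, v). v \<noteq> 0 \<and> F a (crep (cpoint v)) \<noteq> 0}" by simp
qed

lemma closed_Collect_crep_eq:
  fixes F :: "'a::topological_space \<Rightarrow> complex ^ 'n \<Rightarrow> 'b::{t1_space,zero}"
  assumes "continuous_on UNIV (\<lambda>(a, v). F a v)"
    and "\<And>a v c. c \<noteq> 0 \<Longrightarrow> F a (c *s v) = 0 \<longleftrightarrow> F a v = 0"
  shows "closed {(a, p). F a (crep p) = 0}"
proof -
  have "- {(a, p). F a (crep p) = 0} = {(a, p). F a (crep p) \<noteq> 0}" by auto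
  then show ?thesis using open_Collect_crep_neq[OF assms] unfolding closed_def by simp
qed

lemma open_Collect_crep_pos:
  fixes F :: "complex ^ 'n \<Rightarrow> real"
  assumes cont: "continuous_on UNIV F"
    and hom: "\<And>v c. c \<noteq> 0 \<Longrightarrow> 0 < F (c *s v) \<longleftrightarrow> 0 < F v"
  shows "open {p. 0 < F (crep p)}"
proof -
  have "0 < F (crep (cpoint v)) \<longleftrightarrow> 0 < F v" if "v \<noteq> 0" for v
    using crep_cpoint[OF that] hom by metis
  then have "{v. v \<noteq> 0 \<and> 0 < F (crep (cpoint v))} = (- {0}) \<inter> F -` {0<..}"
    by auto
  moreover have "open \<dots>"
    by (rule open_Int[OF _ open_vimage[OF _ cont]]) auto
  ultimately show ?thesis unfolding open_cproj_def by simp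
qed

lemma open_Collect_crep_linear_neq:
  fixes b :: "complex ^ 'n \<Rightarrow> complex"
  assumes "continuous_on UNIV b" "\<And>c v. b (c *s v) = c * b v"
  shows "open {p. b (crep p) \<noteq> 0}"
proof -
  have "open {p. 0 < norm (b (crep p))}"
    using assms by (intro open_Collect_crep_pos continuous_intros) auto
  then show ?thesis by simp
qed

lemma continuous_on_crep_ratio:
  fixes a b :: "complex ^ 'n \<Rightarrow> complex"
  assumes cont: "continuous_on UNIV a" "continuous_on UNIV b"
    and lin: "\<And>c v. a (c *s v) = c * a v" "\<And>c v. b (c *s v) = c * b v"
  shows "continuous_on {p. b (crep p) \<noteq> 0} (\<lambda>p. a (crep p) / b (crep p))"
proof -
  let ?S = "{p. b (crep p) \<noteq> 0}"
  have S: "open ?S" using assms by (intro open_Collect_crep_linear_neq) auto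
  have "open ((\<lambda>p. a (crep p) / b (crep p)) -` T \<inter> ?S)" if "open T" for T
  proof -
    have r: "a (crep (cpoint v)) / b (crep (cpoint v)) = a v / b v \<and>
        (b (crep (cpoint v)) = 0 \<longleftrightarrow> b v = 0)" if nz: "v \<noteq> 0" for v
    proof -
      obtain c where "c \<noteq> 0" "crep (cpoint v) = c *s v" using crep_cpoint[OF nz] by blast
      then show ?thesis using lin by simp
    qed
    let ?W = "{v. b v \<noteq> 0}"
    have W: "open ?W" using cont by (intro open_Collect_neq continuous_on_const)
    have "continuous_on ?W (\<lambda>v. a v / b v)"
      using cont by (intro continuous_on_divide) (auto intro: continuous_on_subset)
    then have "open (?W \<inter> (\<lambda>v. a v / b v) -` T)"
      using W that by (rule continuous_open_preimage)
    then have "open (- {0} \<inter> (?W \<inter> (\<lambda>v. a v / b v) -` T))"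
      by (rule open_Int[rotated]) (simp add: open_Compl)
    also have "- {0} \<inter> (?W \<inter> (\<lambda>v. a v / b v) -` T)
       = {v. v \<noteq> 0 \<and> cpoint v \<in> (\<lambda>p. a (crep p) / b (crep p)) -` T \<inter> ?S}"
      using r by auto
    finally show ?thesis unfolding open_cproj_def .
  qed
  then show ?thesis
    by (simp add: continuous_on_open_vimage[OF S])
qed

text \<open>Equality with a given point is the vanishing of all \<open>2 \<times> 2\<close> minors, a closed condition that can be
  passed to limits.\<close>

lemma cpoint_eqI_minors:
  fixes p :: "'n::finite cproj"
  assumes "u \<noteq> 0" and minors: "\<And>i j. crep p $ i * u $ j = crep p $ j * u $ i"
  shows "p = cpoint u"
proof -
  obtain j where j: "u $ j \<noteq> 0" using assms(1) by (auto simp: vec_eq_iff)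
  define c where "c = crep p $ j / u $ j"
  have eq: "crep p = c *s u"
    unfolding vec_eq_iff using minors[of _ j] j by (simp add: c_def field_simps)
  then have "c \<noteq> 0" using crep_nonzero[of p] by auto
  then have "cpoint (crep p) = cpoint u"
    unfolding eq using cpoint_scale assms(1) by blast
  then show ?thesis by (simp add: cpoint_crep)
qed

lemma minors_cpoint:
  fixes u :: "complex ^ 'n"
  assumes "u \<noteq> 0"
  shows "crep (cpoint u) $ i * u $ j = crep (cpoint u) $ j * u $ i"
proof -
  obtain c where "crep (cpoint u) = c *s u" using crep_cpoint[OF assms] by blast
  then show ?thesis by simp
qed

lemma closed_cproj_eq_coord:
  fixes q :: "'n::finite cproj"
  shows "closed {p :: 'a \<Rightarrow> 'n::finite cproj. p i = q}"
proof -
  have *: "closed {p. \<forall>i\<in>UNIV. \<forall>j\<in>UNIV. crep p $ i * crep q $ j - crep p $ j * crep q $ i = 0}"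
  proof (simp only: Collect_ball_eq, intro closed_INT ballI)
    fix i j
    have "closed {(a::real, p). crep p $ i * crep q $ j - crep p $ j * crep q $ i = 0}"
    proof (rule closed_Collect_crep_eq)
      show "continuous_on UNIV (\<lambda>(a::real, v). v $ i * crep q $ j - v $ j * crep q $ i)"
        by (auto simp: case_prod_unfold intro!: continuous_intros)
    next
      fix v :: "complex ^ 'n" and c :: complex assume "c \<noteq> 0"
      have "(c *s v) $ i * crep q $ j - (c *s v) $ j * crep q $ i
          = c * (v $ i * crep q $ j - v $ j * crep q $ i)" by (simp add: algebra_simps)
      then show "(c *s v) $ i * crep q $ j - (c *s v) $ j * crep q $ i = 0
          \<longleftrightarrow> v $ i * crep q $ j - v $ j * crep q $ i = 0"
        using \<open>c \<noteq> 0\<close> by simp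
    qed
    then have "closed ((\<lambda>p. (0::real, p)) -` {(a::real, p). crep p $ i * crep q $ j - crep p $ j * crep q $ i = 0})"
      by (rule closed_vimage) (intro continuous_intros)
    then show "closed {p. crep p $ i * crep q $ j - crep p $ j * crep q $ i = 0}"
      by (simp add: vimage_def)
  qed
  have eq: "{p. \<forall>i\<in>UNIV. \<forall>j\<in>UNIV. crep p $ i * crep q $ j - crep p $ j * crep q $ i = 0} = {q}"
  proof (intro equalityI subsetI; clarsimp)
    fix p :: "'n::finite cproj" assume "\<forall>i j. crep p $ i * crep q $ j = crep p $ j * crep q $ i"
    then have "p = cpoint (crep q)"
      by (intro cpoint_eqI_minors) (auto simp: crep_nonzero)
    then show "p = q" by (simp add: cpoint_crep)
  qed
  have "closed ((\<lambda>p :: 'a \<Rightarrow> 'n cproj. p i) -` {q})"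
    using * unfolding eq by (rule closed_vimage) (intro continuous_on_product_coordinates)
  then show ?thesis by (simp add: vimage_def)
qed

section \<open>Continuously differentiable maps on subsets\<close>

definition C1_on :: "'a::euclidean_space set \<Rightarrow> ('a \<Rightarrow> 'b::real_normed_vector) \<Rightarrow> bool" where
  "C1_on V f \<longleftrightarrow> (\<exists>f'. C1_derivative V f f')"

text \<open>On a finite-dimensional domain the derivative is continuous in the operator norm as soon as it is
  continuous in every direction.\<close>

lemma C1_onI:
  assumes D: "\<And>t. t \<in> V \<Longrightarrow> (f has_derivative D t) (at t within V)"
    and cont: "\<And>\<xi>. continuous_on V (\<lambda>t. D t \<xi>)"
  shows "C1_on V f"
proof -
  have app: "blinfun_apply (Blinfun (D t)) = D t" if "t \<in> V" for t
    using D[OF that] has_derivative_bounded_linear bounded_linear_Blinfun_apply by blast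
  have "continuous_on V (\<lambda>t. Blinfun (D t))"
  proof (rule continuous_on_blinfun_componentwise)
    fix i :: 'a
    show "continuous_on V (\<lambda>t. blinfun_apply (Blinfun (D t)) i)"
      using cont[of i] by (rule continuous_on_eq) (simp add: app)
  qed
  then have "C1_derivative V f (\<lambda>t. Blinfun (D t))"
    unfolding C1_derivative_def using D app by simp
  then show ?thesis unfolding C1_on_def by blast
qed

lemma C1_onE:
  assumes "C1_on V f"
  obtains D where "\<And>t. t \<in> V \<Longrightarrow> (f has_derivative D t) (at t within V)"
    "\<And>\<xi>. continuous_on V (\<lambda>t. D t \<xi>)"
proof -
  from assms obtain f' where f': "C1_derivative V f f'" unfolding C1_on_def by blast
  show ?thesis
  proof (rule that[of "\<lambda>t. blinfun_apply (f' t)"])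
    show "continuous_on V (\<lambda>t. blinfun_apply (f' t) \<xi>)" for \<xi>
      using f' unfolding C1_derivative_def by (intro continuous_intros) auto
  qed (use f' in \<open>auto simp: C1_derivative_def\<close>)
qed

lemma C1_on_continuous_on: "C1_on V f \<Longrightarrow> continuous_on V f"
  by (erule C1_onE) (meson has_derivative_continuous continuous_on_eq_continuous_within)

lemma C1_on_differentiable: "C1_on V f \<Longrightarrow> t \<in> V \<Longrightarrow> f differentiable (at t within V)"
  by (erule C1_onE) (auto simp: differentiable_def)

lemma C1_on_const: "C1_on V (\<lambda>_. c)"
  by (rule C1_onI[where D = "\<lambda>_ _. 0"]) auto

lemma C1_on_bounded_linear:
  assumes L: "bounded_linear L" and f: "C1_on V f"
  shows "C1_on V (\<lambda>t. L (f t))"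
proof -
  obtain D where D: "\<And>t. t \<in> V \<Longrightarrow> (f has_derivative D t) (at t within V)"
    "\<And>\<xi>. continuous_on V (\<lambda>t. D t \<xi>)" using f by (rule C1_onE) blast
  show ?thesis
    by (rule C1_onI[where D = "\<lambda>t \<xi>. L (D t \<xi>)"])
      (auto intro: bounded_linear.has_derivative[OF L] bounded_linear.continuous_on[OF L] D)
qed

lemma C1_on_id: "C1_on V (\<lambda>t. t)"
  by (rule C1_onI[where D = "\<lambda>_ \<xi>. \<xi>"]) auto

lemma C1_on_linear: "bounded_linear L \<Longrightarrow> C1_on V L"
  using C1_on_bounded_linear[OF _ C1_on_id] .

lemma C1_on_Re: "C1_on W Re" and C1_on_Im: "C1_on W Im"
  by (auto intro: C1_on_linear bounded_linear_Re bounded_linear_Im)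

lemma C1_on_bilinear:
  assumes b: "bounded_bilinear b" and f: "C1_on V f" and g: "C1_on V g"
  shows "C1_on V (\<lambda>t. b (f t) (g t))"
proof -
  obtain D where D: "\<And>t. t \<in> V \<Longrightarrow> (f has_derivative D t) (at t within V)"
    "\<And>\<xi>. continuous_on V (\<lambda>t. D t \<xi>)" using f by (rule C1_onE) blast
  obtain E where E: "\<And>t. t \<in> V \<Longrightarrow> (g has_derivative E t) (at t within V)"
    "\<And>\<xi>. continuous_on V (\<lambda>t. E t \<xi>)" using g by (rule C1_onE) blast
  show ?thesis
  proof (rule C1_onI)
    show "((\<lambda>t. b (f t) (g t)) has_derivative (\<lambda>\<xi>. b (f t) (E t \<xi>) + b (D t \<xi>) (g t)))
        (at t within V)" if "t \<in> V" for t
      using bounded_bilinear.FDERIV[OF b D(1)[OF that] E(1)[OF that]] .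
    show "continuous_on V (\<lambda>t. b (f t) (E t \<xi>) + b (D t \<xi>) (g t))" for \<xi>
      by (intro continuous_on_add bounded_bilinear.continuous_on[OF b] D E
          C1_on_continuous_on[OF f] C1_on_continuous_on[OF g])
  qed
qed

lemma C1_on_add:
  assumes "C1_on V f" "C1_on V g"
  shows "C1_on V (\<lambda>t. f t + g t)"
proof -
  obtain D where D: "\<And>t. t \<in> V \<Longrightarrow> (f has_derivative D t) (at t within V)"
    "\<And>\<xi>. continuous_on V (\<lambda>t. D t \<xi>)" using assms(1) by (rule C1_onE) blast
  obtain E where E: "\<And>t. t \<in> V \<Longrightarrow> (g has_derivative E t) (at t within V)"
    "\<And>\<xi>. continuous_on V (\<lambda>t. E t \<xi>)" using assms(2) by (rule C1_onE) blast
  show ?thesis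
    by (rule C1_onI[where D = "\<lambda>t \<xi>. D t \<xi> + E t \<xi>"])
      (auto intro!: has_derivative_add continuous_on_add D E)
qed

lemma C1_on_Pair:
  assumes "C1_on V f" "C1_on V g"
  shows "C1_on V (\<lambda>t. (f t, g t))"
proof -
  have "C1_on V (\<lambda>t. (f t, 0) + (0, g t))"
    by (intro C1_on_add C1_on_bounded_linear[OF _ assms(1)] C1_on_bounded_linear[OF _ assms(2)]
        bounded_linear_Pair bounded_linear_ident bounded_linear_zero)
  then show ?thesis by simp
qed

lemma C1_on_mult:
  fixes f g :: "_ \<Rightarrow> 'a::real_normed_algebra"
  shows "C1_on V f \<Longrightarrow> C1_on V g \<Longrightarrow> C1_on V (\<lambda>t. f t * g t)"
  by (rule C1_on_bilinear[OF bounded_bilinear_mult])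

lemma C1_on_scaleR: "C1_on V f \<Longrightarrow> C1_on V g \<Longrightarrow> C1_on V (\<lambda>t. f t *\<^sub>R g t)"
  by (rule C1_on_bilinear[OF bounded_bilinear_scaleR])

lemma C1_on_power2:
  fixes f :: "_ \<Rightarrow> 'a::real_normed_algebra_1"
  shows "C1_on V f \<Longrightarrow> C1_on V (\<lambda>t. (f t)\<^sup>2)"
  unfolding power2_eq_square by (rule C1_on_mult)

lemma C1_on_prod:
  fixes f :: "'i \<Rightarrow> 'a::euclidean_space \<Rightarrow> real"
  assumes "\<And>i. i \<in> I \<Longrightarrow> C1_on V (f i)"
  shows "C1_on V (\<lambda>t. \<Prod>i\<in>I. f i t)"
  using assms
proof (induction I rule: infinite_finite_induct)
  case (insert i I)
  then show ?case using C1_on_mult[of V "f i" "\<lambda>t. \<Prod>i\<in>I. f i t"] by simp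
qed (auto intro: C1_on_const)

lemma C1_on_DERIV:
  fixes f :: "_ \<Rightarrow> real"
  assumes f: "C1_on V f" and d: "\<And>t. t \<in> V \<Longrightarrow> (\<phi> has_field_derivative \<psi> (f t)) (at (f t))"
    and c: "continuous_on (f ` V) \<psi>"
  shows "C1_on V (\<lambda>t. \<phi> (f t))"
proof -
  obtain D where D: "\<And>t. t \<in> V \<Longrightarrow> (f has_derivative D t) (at t within V)"
    "\<And>\<xi>. continuous_on V (\<lambda>t. D t \<xi>)" using f by (rule C1_onE) blast
  show ?thesis
  proof (rule C1_onI)
    show "((\<lambda>t. \<phi> (f t)) has_derivative (\<lambda>\<xi>. D t \<xi> * \<psi> (f t))) (at t within V)" if "t \<in> V" for t
      using DERIV_compose_FDERIV[OF d[OF that] D(1)[OF that]] .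
    show "continuous_on V (\<lambda>t. D t \<xi> * \<psi> (f t))" for \<xi>
      by (intro continuous_on_mult D continuous_on_compose2[OF c] C1_on_continuous_on[OF f]) auto
  qed
qed

lemma C1_on_sqrt:
  fixes f :: "_ \<Rightarrow> real"
  assumes f: "C1_on V f" and pos: "\<And>t. t \<in> V \<Longrightarrow> 0 < f t"
  shows "C1_on V (\<lambda>t. sqrt (f t))"
proof (rule C1_on_DERIV[OF f])
  show "(sqrt has_field_derivative inverse (sqrt (f t)) / 2) (at (f t))" if "t \<in> V" for t
    using DERIV_real_sqrt[OF pos[OF that]] .
  show "continuous_on (f ` V) (\<lambda>x. inverse (sqrt x) / 2)"
    using pos by (intro continuous_intros) force+
qed

lemma C1_on_inverse:
  fixes f :: "_ \<Rightarrow> real"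
  assumes f: "C1_on V f" and nz: "\<And>t. t \<in> V \<Longrightarrow> f t \<noteq> 0"
  shows "C1_on V (\<lambda>t. inverse (f t))"
proof (rule C1_on_DERIV[OF f])
  show "(inverse has_field_derivative - (inverse (f t) ^ 2)) (at (f t))" if "t \<in> V" for t
    using DERIV_inverse[OF nz[OF that]] by (simp add: numeral_2_eq_2)
  show "continuous_on (f ` V) (\<lambda>x. - (inverse x ^ 2))"
    using nz by (intro continuous_intros) auto
qed

text \<open>One lift on the whole domain suffices for all points. The kernel condition is stated for an
  arbitrary derivative, so that it can be checked on coordinate functions whose derivatives are
  known by uniqueness.\<close>

lemma C1_immersionI:
  fixes U :: "'a::euclidean_space set"
  assumes lift: "lifts_to N U g h" and fst: "C1_on U (\<lambda>t. fst (g t))"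
    and h: "\<And>P. P \<in> N \<Longrightarrow> C1_on U (h P)"
    and inj: "\<And>z q' h' \<xi>. z \<in> U \<Longrightarrow> ((\<lambda>t. fst (g t)) has_derivative q') (at z within U) \<Longrightarrow>
      (\<And>P. P \<in> N \<Longrightarrow> (h P has_derivative h' P) (at z within U)) \<Longrightarrow> q' \<xi> = 0 \<Longrightarrow>
      (\<And>P. P \<in> N \<Longrightarrow> \<exists>c. h' P \<xi> = c *s h P z) \<Longrightarrow> \<xi> = 0"
  shows "C1_immersion N U g"
  unfolding C1_immersion_def
proof
  fix z assume z: "z \<in> U"
  obtain q' where q': "C1_derivative U (\<lambda>t. fst (g t)) q'" using fst unfolding C1_on_def by blast
  have "\<forall>P\<in>N. \<exists>h'. C1_derivative U (h P) h'" using h unfolding C1_on_def by blast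
  then obtain h' where h': "\<forall>P\<in>N. C1_derivative U (h P) (h' P)" by (rule bchoice[THEN exE])
  have "\<xi> = 0" if "blinfun_apply (q' z) \<xi> = 0"
    "\<forall>P\<in>N. \<exists>c. blinfun_apply (h' P z) \<xi> = c *s h P z" for \<xi>
    using inj[OF z, of "blinfun_apply (q' z)" "\<lambda>P. blinfun_apply (h' P z)"] q' h' that z
    unfolding C1_derivative_def by blast
  then show "\<exists>V h q' h'. openin (top_of_set U) V \<and> z \<in> V \<and> lifts_to N V g h \<and>
      C1_derivative V (\<lambda>t. fst (g t)) q' \<and> (\<forall>P\<in>N. C1_derivative V (h P) (h' P)) \<and>
      (\<forall>\<xi>. blinfun_apply (q' z) \<xi> = 0 \<and> (\<forall>P\<in>N. \<exists>c. blinfun_apply (h' P z) \<xi> = c *s h P z)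
         \<longrightarrow> \<xi> = 0)"
    using z lift q' h' by (intro exI[of _ U] exI[of _ h] exI[of _ q'] exI[of _ h']) simp
qed

section \<open>Derivatives at boundary points\<close>

text \<open>Enough room in \<open>V\<close> around \<open>z\<close> to make the derivative at \<open>z\<close> within \<open>V\<close> unique. Relatively open
  subsets of the half plane have it also at their boundary points.\<close>

definition reachable_along_axes :: "'a::euclidean_space set \<Rightarrow> 'a \<Rightarrow> bool" where
  "reachable_along_axes V z \<longleftrightarrow> (\<forall>i\<in>Basis. \<forall>e>0. \<exists>d. 0 < \<bar>d\<bar> \<and> \<bar>d\<bar> < e \<and> z + d *\<^sub>R i \<in> V)"

lemma derivative_unique_reachable:
  fixes f :: "'a::euclidean_space \<Rightarrow> 'b::real_normed_vector"
  assumes "reachable_along_axes V z"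
    and "(f has_derivative A) (at z within V)" "(f has_derivative B) (at z within V)"
  shows "A = B"
  using assms by (intro frechet_derivative_unique_within[of f A z V B])
    (auto simp: reachable_along_axes_def)

lemma reachable_open: "open V \<Longrightarrow> z \<in> V \<Longrightarrow> reachable_along_axes V z"
  unfolding reachable_along_axes_def
proof (intro ballI allI impI)
  fix i :: 'a and e :: real assume *: "open V" "z \<in> V" "i \<in> Basis" "0 < e"
  then obtain r where r: "0 < r" "ball z r \<subseteq> V" using open_contains_ball by blast
  let ?d = "min (e / 2) (r / 2)"
  have "z + ?d *\<^sub>R i \<in> ball z r" using * r by (auto simp: dist_norm)
  then show "\<exists>d. 0 < \<bar>d\<bar> \<and> \<bar>d\<bar> < e \<and> z + d *\<^sub>R i \<in> V"
    using * r by (intro exI[of _ ?d]) auto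
qed

lemma reachable_half_plane:
  assumes "openin (top_of_set {z. 0 \<le> Im z}) V" "z \<in> V"
  shows "reachable_along_axes V z"
  unfolding reachable_along_axes_def
proof (intro ballI allI impI)
  fix i :: complex and e :: real assume *: "i \<in> Basis" "0 < e"
  obtain T where T: "open T" "V = {z. 0 \<le> Im z} \<inter> T" using assms(1) by (auto simp: openin_open)
  then obtain r where r: "0 < r" "ball z r \<subseteq> T" using assms(2) open_contains_ball by blast
  let ?d = "min (e / 2) (r / 2)"
  have "z + ?d *\<^sub>R i \<in> ball z r" using * r by (auto simp: dist_norm)
  moreover have "0 \<le> Im (z + ?d *\<^sub>R i)"
    using * r T assms(2) by (auto simp: Basis_complex_def)
  ultimately show "\<exists>d. 0 < \<bar>d\<bar> \<and> \<bar>d\<bar> < e \<and> z + d *\<^sub>R i \<in> V"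
    using * r T by (intro exI[of _ ?d]) auto
qed

text \<open>The determinant of a real linear endomorphism of the plane.\<close>

definition cdet :: "(complex \<Rightarrow> complex) \<Rightarrow> real" where
  "cdet A = Im (cnj (A 1) * A \<i>)"

lemma real_linear_complex:
  assumes "linear A"
  shows "A \<xi> = Re \<xi> *\<^sub>R A 1 + Im \<xi> *\<^sub>R (A \<i> :: 'a::real_vector)"
proof -
  have "\<xi> = Re \<xi> *\<^sub>R 1 + Im \<xi> *\<^sub>R \<i>" by (simp add: complex_eq_iff)
  then show ?thesis
    using assms by (metis linear_add linear_scale)
qed

lemma cdet_compose:
  assumes "linear B"
  shows "cdet (\<lambda>\<xi>. B (A \<xi>)) = cdet B * cdet A"
  unfolding cdet_def
  by (subst (1 2) real_linear_complex[OF assms]) (simp add: algebra_simps)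

text \<open>By Cramer's rule the coordinates of \<open>\<xi>\<close> are determinants with \<open>A \<xi>\<close> in one column, divided by the
  determinant of \<open>A\<close>, so \<open>A\<close> is injective.\<close>

lemma inverse_of_cdet_pos:
  assumes A: "linear A" and pos: "0 < cdet A"
  obtains B where "linear B" "\<And>\<xi>. B (A \<xi>) = \<xi>" "\<And>\<xi>. A (B \<xi>) = \<xi>" "0 < cdet B"
proof -
  have "inj A"
  proof (rule linear_injective_0[OF A, THEN iffD2], intro allI impI)
    fix \<xi> assume "A \<xi> = 0"
    then have 0: "Re \<xi> *\<^sub>R A 1 + Im \<xi> *\<^sub>R A \<i> = 0"
      using real_linear_complex[OF A] by metis
    have "Im (cnj (A 1) * (Re \<xi> *\<^sub>R A 1 + Im \<xi> *\<^sub>R A \<i>)) = Im \<xi> * cdet A"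
      "Im (cnj (Re \<xi> *\<^sub>R A 1 + Im \<xi> *\<^sub>R A \<i>) * A \<i>) = Re \<xi> * cdet A"
      by (simp_all add: cdet_def algebra_simps)
    then show "\<xi> = 0" unfolding 0 using pos by (simp add: complex_eq_iff)
  qed
  then obtain B where B: "linear B" "\<And>\<xi>. B (A \<xi>) = \<xi>" "\<And>\<xi>. A (B \<xi>) = \<xi>"
    using linear_injective_isomorphism[OF A] by blast
  have "cdet B * cdet A = 1"
    using cdet_compose[OF B(1), of A] B(2) by (simp add: cdet_def)
  then have "0 < cdet B" using pos by (metis zero_less_mult_pos2 zero_less_one)
  then show ?thesis using that B by blast
qed

text \<open>The domain need not be open, so this applies at boundary points of charts. Since the derivative is
  bounded below, \<open>norm (w - z)\<close> is at most a multiple of \<open>norm (T w - T z)\<close> near \<open>z\<close>, and the error of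
  the linear approximation of \<open>T\<close> turns into one for \<open>S\<close>.\<close>

lemma has_derivative_inverse_within:
  fixes T :: "'a::euclidean_space \<Rightarrow> 'b::euclidean_space"
  assumes T: "(T has_derivative A) (at z within W)" and z: "z \<in> W"
    and B: "linear B" "\<And>\<xi>. B (A \<xi>) = \<xi>"
    and S: "\<And>w. w \<in> W \<Longrightarrow> S (T w) = w" "continuous (at (T z) within T ` W) S"
  shows "(S has_derivative B) (at (T z) within T ` W)"
  unfolding has_derivative_within_alt
proof (intro conjI allI impI)
  have bB: "bounded_linear B" using B(1) by (rule linear_conv_bounded_linear[THEN iffD1])
  then show "bounded_linear B" .
  obtain K where K: "0 < K" "\<And>x. norm (B x) \<le> norm x * K"
    using bounded_linear.pos_bounded[OF bB] by blast
  fix e :: real assume e: "0 < e"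
  \<comment> \<open>The first bound makes \<open>norm (w - z) \<le> 2 * K * norm (T w - T z)\<close>, the second one the error at most
    \<open>e\<close> after this substitution.\<close>
  define \<epsilon> where "\<epsilon> = min (1 / (2 * K)) (e / (2 * K * K))"
  have \<epsilon>: "0 < \<epsilon>" "\<epsilon> * K \<le> 1 / 2" "\<epsilon> * (2 * K * K) \<le> e"
  proof -
    show "0 < \<epsilon>" using K e by (simp add: \<epsilon>_def)
    have "\<epsilon> \<le> 1 / (2 * K)" "\<epsilon> \<le> e / (2 * K * K)" by (simp_all add: \<epsilon>_def)
    then show "\<epsilon> * K \<le> 1 / 2" "\<epsilon> * (2 * K * K) \<le> e"
      using K by (simp_all add: field_simps)
  qed
  obtain d where d: "0 < d"
    "\<And>w. w \<in> W \<Longrightarrow> norm (w - z) < d \<Longrightarrow> norm (T w - T z - A (w - z)) \<le> \<epsilon> * norm (w - z)"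
    using T \<epsilon>(1) unfolding has_derivative_within_alt by blast
  obtain d' where d': "0 < d'" "\<And>y. y \<in> T ` W \<Longrightarrow> dist y (T z) < d' \<Longrightarrow> dist (S y) (S (T z)) < d"
    using S(2) d(1) unfolding continuous_within_eps_delta by metis
  show "\<exists>d>0. \<forall>y\<in>T ` W. norm (y - T z) < d \<longrightarrow>
      norm (S y - S (T z) - B (y - T z)) \<le> e * norm (y - T z)"
  proof (intro exI[of _ d'] conjI ballI impI d'(1))
    fix y assume y: "y \<in> T ` W" "norm (y - T z) < d'"
    then obtain w where w: "w \<in> W" "y = T w" by blast
    have "norm (w - z) < d" using d'(2)[OF y(1)] y w z by (simp add: dist_norm S(1))
    then have est: "norm (T w - T z - A (w - z)) \<le> \<epsilon> * norm (w - z)" using d w by blast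
    have lin: "B (T w - T z - A (w - z)) = B (T w - T z) - (w - z)"
      using B by (metis linear_diff)
    then have est2: "norm (B (T w - T z) - (w - z)) \<le> \<epsilon> * norm (w - z) * K"
      using K(2)[of "T w - T z - A (w - z)"] est K(1)
      by (smt (verit) mult_right_mono)
    have "norm (w - z) \<le> norm (B (T w - T z)) + norm (B (T w - T z) - (w - z))"
      by (metis norm_triangle_sub norm_minus_commute)
    also have "\<dots> \<le> norm (T w - T z) * K + \<epsilon> * norm (w - z) * K"
      using K est2 by (intro add_mono) auto
    also have "\<epsilon> * norm (w - z) * K \<le> 1 / 2 * norm (w - z)"
      using mult_right_mono[OF \<epsilon>(2), of "norm (w - z)"] by (simp add: mult_ac)
    finally have "norm (w - z) \<le> 2 * K * norm (T w - T z)" by (simp add: mult_ac)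
    then have "\<epsilon> * norm (w - z) * K \<le> \<epsilon> * (2 * K * norm (T w - T z)) * K"
      using \<epsilon>(1) K(1) by (intro mult_right_mono mult_left_mono) auto
    also have "\<dots> \<le> e * norm (T w - T z)"
      using mult_right_mono[OF \<epsilon>(3), of "norm (T w - T z)"] by (simp add: mult_ac)
    finally show "norm (S y - S (T z) - B (y - T z)) \<le> e * norm (y - T z)"
      using est2 S(1) w z by (simp add: norm_minus_commute)
  qed
qed

section \<open>Atlases and orientations\<close>

lemma orientation_compatible_iff:
  "orientation_compatible (U, g) (V, h) \<longleftrightarrow> (\<forall>z\<in>U. g z \<in> h ` V \<longrightarrow>
     (\<exists>A. ((\<lambda>t. inv_into V h (g t)) has_derivative A) (at z within U \<inter> g -` (h ` V)) \<and> 0 < cdet A))"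
  by (simp add: orientation_compatible_def cdet_def)

lemma local_paramD:
  assumes "local_param N M U g"
  shows "openin (top_of_set M) (g ` U)" "continuous_on U g" "inj_on g U"
    "continuous_on (g ` U) (inv_into U g)"
proof -
  obtain g' where g': "homeomorphism U (g ` U) g g'"
    and op: "openin (top_of_set M) (g ` U)" using assms unfolding local_param_def by blast
  show "openin (top_of_set M) (g ` U)" by (rule op)
  show "continuous_on U g" using g' by (simp add: homeomorphism_def)
  show inj: "inj_on g U" using g' by (metis homeomorphism_apply1 inj_onI)
  have "continuous_on (g ` U) g'" using g' by (simp add: homeomorphism_def)
  moreover have "g' x = inv_into U g x" if "x \<in> g ` U" for x
    using that g' inj by (auto simp: homeomorphism_apply1)
  ultimately show "continuous_on (g ` U) (inv_into U g)" by (rule continuous_on_eq)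
qed

lemma surface_chartD:
  assumes "(U, g) \<in> surface_charts N M"
  shows "openin (top_of_set {z. 0 \<le> Im z}) U" "openin (top_of_set M) (g ` U)"
    "continuous_on U g" "inj_on g U" "continuous_on (g ` U) (inv_into U g)"
    "z \<in> U \<Longrightarrow> 0 \<le> Im z" "g ` U \<subseteq> M"
  using assms local_paramD[of N M U g] unfolding surface_charts_def
  by (auto dest: openin_imp_subset)

lemma at_within_Int_openin:
  assumes "openin (top_of_set S) T" "z \<in> T"
  shows "at z within T = at z within S"
proof -
  obtain O1 where "open O1" "T = S \<inter> O1" using assms(1) by (auto simp: openin_open)
  then show ?thesis using assms(2) by (intro at_within_nhd[of z O1]) auto
qed

lemma openin_chart_domain:
  assumes p: "(U, g) \<in> surface_charts N M" and q: "(V, h) \<in> surface_charts N M"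
  shows "openin (top_of_set U) (U \<inter> g -` (h ` V))"
  by (rule continuous_openin_preimage[OF surface_chartD(3)[OF p] _ surface_chartD(2)[OF q]])
    (use surface_chartD(7)[OF p] in auto)

text \<open>The inverse transition map is continuous because both charts are homeomorphisms, and the derivative
  of the transition map is invertible because its determinant is positive.\<close>

lemma orientation_compatible_sym:
  assumes p: "(U, g) \<in> surface_charts N M" and q: "(V, h) \<in> surface_charts N M"
    and comp: "orientation_compatible (U, g) (V, h)"
  shows "orientation_compatible (V, h) (U, g)"
  unfolding orientation_compatible_iff
proof (intro ballI impI)
  fix w assume w: "w \<in> V" "h w \<in> g ` U"
  define z where "z = inv_into U g (h w)"
  define T where "T = (\<lambda>t. inv_into V h (g t))"
  define S where "S = (\<lambda>t. inv_into U g (h t))"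
  let ?W = "U \<inter> g -` (h ` V)"
  have z: "z \<in> U" "g z = h w"
    using w unfolding z_def by (auto intro: inv_into_into f_inv_into_f)
  have ihV: "inv_into V h (h v) = v" if "v \<in> V" for v
    using that surface_chartD(4)[OF q] by simp
  have igU: "inv_into U g (g v) = v" if "v \<in> U" for v
    using that surface_chartD(4)[OF p] by simp
  obtain A where A: "(T has_derivative A) (at z within ?W)" "0 < cdet A"
    using comp z w unfolding orientation_compatible_iff T_def by force
  have linA: "linear A" using A(1) has_derivative_linear by blast
  obtain B where B: "linear B" "\<And>\<xi>. B (A \<xi>) = \<xi>" "\<And>\<xi>. A (B \<xi>) = \<xi>" "0 < cdet B"
    using inverse_of_cdet_pos[OF linA A(2)] by blast
  have Tz: "T z = w" unfolding T_def z(2) using ihV w by simp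
  have TW: "T ` ?W = V \<inter> h -` (g ` U)"
  proof
    show "T ` ?W \<subseteq> V \<inter> h -` (g ` U)"
    proof
      fix y assume "y \<in> T ` ?W"
      then obtain t where t: "t \<in> U" "g t \<in> h ` V" "y = inv_into V h (g t)" by (auto simp: T_def)
      then have "y \<in> V" "h y = g t" by (auto intro: inv_into_into f_inv_into_f)
      then show "y \<in> V \<inter> h -` (g ` U)" using t by auto
    qed
    show "V \<inter> h -` (g ` U) \<subseteq> T ` ?W"
    proof
      fix v assume v: "v \<in> V \<inter> h -` (g ` U)"
      then obtain u where "u \<in> U" "h v = g u" by auto
      then show "v \<in> T ` ?W" using v ihV
        by (intro image_eqI[of _ _ u]) (auto simp: T_def dest: sym)
    qed
  qed
  have "continuous_on (V \<inter> h -` (g ` U)) S"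
    unfolding S_def
    by (rule continuous_on_compose2[OF surface_chartD(5)[OF p]
          continuous_on_subset[OF surface_chartD(3)[OF q]]]) auto
  then have "continuous (at (T z) within T ` ?W) S"
    unfolding TW using w Tz by (simp add: continuous_on_eq_continuous_within)
  moreover have "S (T t) = t" if "t \<in> ?W" for t
  proof -
    have "h (T t) = g t" using that unfolding T_def by (auto intro: f_inv_into_f)
    then show ?thesis using that igU unfolding S_def by simp
  qed
  ultimately have "(S has_derivative B) (at (T z) within T ` ?W)"
    using z w A(1) B by (intro has_derivative_inverse_within[of T A]) auto
  then show "\<exists>A. ((\<lambda>t. inv_into U g (h t)) has_derivative A) (at w within V \<inter> h -` (g ` U)) \<and> 0 < cdet A"
    unfolding TW Tz S_def using B(4) by blast
qed

text \<open>Near \<open>z\<close> the transition map factors through the middle chart, and determinants multiply.\<close>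

lemma orientation_compatible_trans_at:
  assumes p: "(U, g) \<in> surface_charts N M" and r: "(R, k) \<in> surface_charts N M"
    and q: "(V, h) \<in> surface_charts N M"
    and pr: "orientation_compatible (U, g) (R, k)" and rq: "orientation_compatible (R, k) (V, h)"
    and z: "z \<in> U" "g z \<in> h ` V" "g z \<in> k ` R"
  shows "\<exists>A. ((\<lambda>t. inv_into V h (g t)) has_derivative A) (at z within U \<inter> g -` (h ` V)) \<and> 0 < cdet A"
proof -
  let ?S0 = "U \<inter> g -` (h ` V)"
  let ?S1 = "?S0 \<inter> (U \<inter> g -` (k ` R))"
  let ?i = "\<lambda>t. inv_into R k (g t)"
  have "openin (top_of_set U) (U \<inter> g -` (k ` R))" by (rule openin_chart_domain[OF p r])
  then have "openin (top_of_set ?S0) ?S1"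
    by (auto simp: openin_open)
  then have at: "at z within ?S1 = at z within ?S0"
    using z by (intro at_within_Int_openin) auto
  obtain A where A: "(?i has_derivative A) (at z within U \<inter> g -` (k ` R))" "0 < cdet A"
    using pr z unfolding orientation_compatible_iff by blast
  have kk: "k (?i t) = g t" "?i t \<in> R" if "t \<in> ?S1" for t
    using that by (auto intro: f_inv_into_f inv_into_into)
  have zS: "z \<in> ?S1" using z by auto
  have "?i z \<in> R" "k (?i z) \<in> h ` V" using kk[OF zS] z(2) by simp_all
  then obtain B where B: "((\<lambda>t. inv_into V h (k t)) has_derivative B) (at (?i z) within R \<inter> k -` (h ` V))"
    "0 < cdet B"
    using rq unfolding orientation_compatible_iff by blast
  have sub: "?i ` ?S1 \<subseteq> R \<inter> k -` (h ` V)"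
  proof (rule image_subsetI)
    fix t assume "t \<in> ?S1"
    then show "?i t \<in> R \<inter> k -` (h ` V)" using kk[of t] by simp
  qed
  have "((\<lambda>t. inv_into V h (k (?i t))) has_derivative (\<lambda>\<xi>. B (A \<xi>))) (at z within ?S1)"
    by (rule has_derivative_in_compose[OF has_derivative_subset[OF A(1)]
          has_derivative_subset[OF B(1) sub]]) auto
  then have "((\<lambda>t. inv_into V h (g t)) has_derivative (\<lambda>\<xi>. B (A \<xi>))) (at z within ?S1)"
    by (rule has_derivative_transform[OF zS, rotated]) (simp add: kk)
  moreover have "0 < cdet (\<lambda>\<xi>. B (A \<xi>))"
    using A(2) B(2) unfolding cdet_compose[OF has_derivative_linear[OF B(1)], of A] by simp
  ultimately show ?thesis unfolding at by blast
qed

text \<open>An atlas of pairwise compatible charts lies in a unique maximal one: two charts compatible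
  with the atlas are compatible with each other, as seen through a chart of the atlas.\<close>

definition generated_orientation ::
    "(complex ^ 2) set \<Rightarrow> xpoint set \<Rightarrow> surface_chart set \<Rightarrow> surface_chart set" where
  "generated_orientation N M \<Gamma> =
     {p \<in> surface_charts N M. \<forall>q\<in>\<Gamma>. orientation_compatible p q}"

lemma is_orientation_generated:
  assumes sub: "\<Gamma> \<subseteq> surface_charts N M" and cov: "M \<subseteq> (\<Union>(U, g)\<in>\<Gamma>. g ` U)"
    and comp: "\<And>p q. p \<in> \<Gamma> \<Longrightarrow> q \<in> \<Gamma> \<Longrightarrow> orientation_compatible p q"
  shows "is_orientation N M (generated_orientation N M \<Gamma>)" "\<Gamma> \<subseteq> generated_orientation N M \<Gamma>"
proof -
  let ?G = "generated_orientation N M \<Gamma>"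
  show G: "\<Gamma> \<subseteq> ?G" using sub comp by (auto simp: generated_orientation_def)
  have "orientation_compatible p q" if pq: "p \<in> ?G" "q \<in> ?G" for p q
  proof -
    obtain U g V h where eq: "p = (U, g)" "q = (V, h)" by (metis surj_pair)
    have s: "(U, g) \<in> surface_charts N M" "(V, h) \<in> surface_charts N M"
      using pq eq by (auto simp: generated_orientation_def)
    show ?thesis unfolding eq orientation_compatible_iff
    proof (intro ballI impI)
      fix z assume z: "z \<in> U" "g z \<in> h ` V"
      then have "g z \<in> M" using surface_chartD(7)[OF s(1)] by blast
      then obtain R k where r: "(R, k) \<in> \<Gamma>" "g z \<in> k ` R" using cov by blast
      have rs: "(R, k) \<in> surface_charts N M" using r sub by blast
      have "orientation_compatible (U, g) (R, k)" "orientation_compatible (V, h) (R, k)"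
        using pq r unfolding eq generated_orientation_def by auto
      then show "\<exists>A. ((\<lambda>t. inv_into V h (g t)) has_derivative A) (at z within U \<inter> g -` (h ` V)) \<and> 0 < cdet A"
        using orientation_compatible_trans_at[OF s(1) rs s(2)]
          orientation_compatible_sym[OF s(2) rs] z r by blast
    qed
  qed
  moreover have "(\<Union>(U, g)\<in>?G. g ` U) = M"
  proof
    show "(\<Union>(U, g)\<in>?G. g ` U) \<subseteq> M"
      using surface_chartD(7) by (fastforce simp: generated_orientation_def)
    show "M \<subseteq> (\<Union>(U, g)\<in>?G. g ` U)" using cov G by blast
  qed
  moreover have "p \<in> ?G" if "p \<in> surface_charts N M"
    "\<forall>q\<in>?G. orientation_compatible p q \<and> orientation_compatible q p" for p
    using that G by (auto simp: generated_orientation_def)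
  moreover have "?G \<subseteq> surface_charts N M" by (auto simp: generated_orientation_def)
  ultimately show "is_orientation N M ?G"
    unfolding is_orientation_def by (intro conjI ballI impI) assumption+
qed

text \<open>A transition map preserves the closed half plane and the real line, so at a real point its
  derivative maps \<open>1\<close> to a real number and \<open>\<i>\<close> into the half plane; positivity of the determinant
  then makes the real number positive.\<close>

lemma half_plane_transition_positive:
  assumes W: "openin (top_of_set {z. 0 \<le> Im z}) W" "z \<in> W" "Im z = 0"
    and T: "(T has_derivative A) (at z within W)" "0 < cdet A"
    and up: "\<And>w. w \<in> W \<Longrightarrow> 0 \<le> Im (T w)" and re: "\<And>w. w \<in> W \<Longrightarrow> Im w = 0 \<Longrightarrow> Im (T w) = 0"
  shows "Im (A 1) = 0" "0 < Re (A 1)"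
proof -
  obtain O1 where O1: "open O1" "W = {z. 0 \<le> Im z} \<inter> O1" using W(1) by (auto simp: openin_open)
  then obtain r0 where r0: "0 < r0" "ball z r0 \<subseteq> O1" using W(2) open_contains_ball by blast
  have lin: "linear A" using T(1) has_derivative_linear by blast
  have near: "\<exists>r>0. z + of_real r * \<xi> \<in> W \<and>
      norm (T (z + of_real r * \<xi>) - T z - of_real r * A \<xi>) \<le> e * r"
    if \<xi>: "norm \<xi> = 1" "0 \<le> Im \<xi>" "0 < e" for \<xi> e
  proof -
    obtain d where d: "0 < d" "\<And>w. w \<in> W \<Longrightarrow> norm (w - z) < d \<Longrightarrow>
        norm (T w - T z - A (w - z)) \<le> e * norm (w - z)"
      using T(1) \<xi>(3) unfolding has_derivative_within_alt by blast
    define r where "r = min (d / 2) (r0 / 2)"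
    have r: "0 < r" "r < d" "r < r0" using d r0 by (auto simp: r_def)
    have "z + of_real r * \<xi> \<in> W"
      using r \<xi> W(3) r0 O1 by (auto simp: dist_norm norm_mult subset_iff)
    moreover have "A (of_real r * \<xi>) = of_real r * A \<xi>"
      using linear_scale[OF lin, of r \<xi>] by (simp add: scaleR_conv_of_real)
    ultimately show ?thesis
      using d(2)[of "z + of_real r * \<xi>"] r \<xi> by (intro exI[of _ r]) (simp add: norm_mult)
  qed
  have Tz: "Im (T z) = 0" using re W by blast
  have "\<bar>Im (A 1)\<bar> \<le> e" if e: "0 < e" for e
  proof -
    obtain r where r: "0 < r" "z + of_real r * 1 \<in> W"
      "norm (T (z + of_real r * 1) - T z - of_real r * A 1) \<le> e * r" using near[of 1 e] e by auto
    have "\<bar>Im (T (z + of_real r * 1) - T z - of_real r * A 1)\<bar> \<le> e * r"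
      using abs_Im_le_cmod order_trans r(3) by blast
    then have "r * \<bar>Im (A 1)\<bar> \<le> r * e"
      using re[OF r(2)] W(3) Tz r(1) by (simp add: abs_mult mult.commute)
    then show ?thesis using r(1) by simp
  qed
  then have "\<bar>Im (A 1)\<bar> \<le> 0" by (rule field_le_epsilon[of _ 0, simplified]) auto
  then show im: "Im (A 1) = 0" by simp
  have "0 \<le> Im (A \<i>)"
  proof (rule ccontr)
    assume neg: "\<not> 0 \<le> Im (A \<i>)"
    define e where "e = - Im (A \<i>) / 2"
    obtain r where r: "0 < r" "z + of_real r * \<i> \<in> W"
      "norm (T (z + of_real r * \<i>) - T z - of_real r * A \<i>) \<le> e * r"
      using near[of \<i> e] neg by (auto simp: e_def)
    have "\<bar>Im (T (z + of_real r * \<i>) - T z - of_real r * A \<i>)\<bar> \<le> e * r"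
      using abs_Im_le_cmod order_trans r(3) by blast
    then have "Im (T (z + of_real r * \<i>)) \<le> r * Im (A \<i>) + e * r" using Tz by simp
    also have "\<dots> < 0" using neg r(1) by (simp add: e_def field_simps mult_less_0_iff)
    finally show False using up[OF r(2)] by simp
  qed
  moreover have "cdet A = Re (A 1) * Im (A \<i>)" using im by (simp add: cdet_def)
  ultimately show "0 < Re (A 1)" using T(2) by (simp add: zero_less_mult_iff)
qed

text \<open>Transition maps carry boundary points to boundary points: if a boundary point were sent to
  an interior point, the imaginary part of the inverse transition map would have a minimum there,
  and its differential would be singular.\<close>

lemma transition_boundary_point:
  assumes p: "(U, g) \<in> surface_charts N M" and q: "(V, h) \<in> surface_charts N M"
    and comp: "orientation_compatible (V, h) (U, g)"
    and z: "z \<in> U" "g z \<in> h ` V" "Im z = 0"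
  shows "Im (inv_into V h (g z)) = 0"
proof (rule ccontr)
  define w where "w = inv_into V h (g z)"
  assume "Im (inv_into V h (g z)) \<noteq> 0"
  moreover have w: "w \<in> V" "h w = g z"
    unfolding w_def using z by (auto intro: inv_into_into f_inv_into_f)
  ultimately have pos: "0 < Im w"
    using surface_chartD(6)[OF q] unfolding w_def by (metis order_le_less)
  let ?X = "V \<inter> h -` (g ` U)"
  let ?S = "\<lambda>t. inv_into U g (h t)"
  obtain B where B: "(?S has_derivative B) (at w within ?X)" "0 < cdet B"
    using comp w z unfolding orientation_compatible_iff by force
  have "openin (top_of_set {z. 0 \<le> Im z}) ?X"
    using openin_chart_domain[OF q p] surface_chartD(1)[OF q] openin_trans by blast
  then obtain O1 where O1: "open O1" "?X = {z. 0 \<le> Im z} \<inter> O1" by (auto simp: openin_open)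
  let ?O = "{z. 0 < Im z} \<inter> O1"
  have "w \<in> O1" using O1(2) w z by auto
  moreover have "?O \<subseteq> ?X" unfolding O1(2) by auto
  ultimately have O: "open ?O" "w \<in> ?O" "?O \<subseteq> ?X"
    using open_Int[OF open_halfspace_Im_gt O1(1), of 0] pos by simp_all
  have d: "(?S has_derivative B) (at w)"
    using has_derivative_subset[OF B(1) O(3)] at_within_open[OF O(2,1)] by simp
  have Sw: "?S w = z" using w z surface_chartD(4)[OF p] by simp
  have "(\<lambda>\<xi>. Im (B \<xi>)) = (\<lambda>\<xi>. 0)"
  proof (rule differential_zero_maxmin[OF O(2,1)])
    show "((\<lambda>t. Im (?S t)) has_derivative (\<lambda>\<xi>. Im (B \<xi>))) (at w)"
      by (rule has_derivative_Im[OF d])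
    have "0 \<le> Im (?S y)" if "y \<in> ?O" for y
    proof -
      have "h y \<in> g ` U" using that O(3) by blast
      then show ?thesis by (intro surface_chartD(6)[OF p] inv_into_into)
    qed
    then show "(\<forall>y\<in>?O. Im (?S y) \<le> Im (?S w)) \<or> (\<forall>y\<in>?O. Im (?S w) \<le> Im (?S y))"
      using Sw z by simp
  qed
  then have "Im (B 1) = 0" "Im (B \<i>) = 0" by metis+
  then show False using B(2) by (simp add: cdet_def)
qed

text \<open>It suffices to test a curve against an atlas in which it runs in the real line: the transition map
  to any other compatible chart preserves the real line and has a positive real derivative on it.\<close>

lemma boundary_orientation_atlas:
  assumes \<Gamma>: "\<Gamma> \<subseteq> surface_charts N M" and \<Gamma>0: "\<Gamma>0 \<subseteq> \<Gamma>"
    and comp: "\<And>p q. p \<in> \<Gamma> \<Longrightarrow> q \<in> \<Gamma>0 \<Longrightarrow> orientation_compatible p q"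
    and SM: "S \<subseteq> M" and cov: "S \<subseteq> (\<Union>(U, g)\<in>\<Gamma>0. g ` U)"
    and re: "\<And>U g z. (U, g) \<in> \<Gamma>0 \<Longrightarrow> z \<in> U \<Longrightarrow> g z \<in> S \<Longrightarrow> Im z = 0"
  shows "boundary_orientation N \<Gamma> S = boundary_orientation N \<Gamma>0 S"
proof
  show "boundary_orientation N \<Gamma> S \<subseteq> boundary_orientation N \<Gamma>0 S"
    using \<Gamma>0 unfolding boundary_orientation_def by blast
  show "boundary_orientation N \<Gamma>0 S \<subseteq> boundary_orientation N \<Gamma> S"
  proof
    fix x assume x: "x \<in> boundary_orientation N \<Gamma>0 S"
    obtain I c where xe: "x = (I, c)" by (cases x)
    have cc: "(I, c) \<in> curve_charts N S" using x unfolding xe boundary_orientation_def by blast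
    then have lp: "open I" "local_param N S I c" by (auto simp: curve_charts_def)
    have cS: "c t \<in> S" if "t \<in> I" for t
      using local_paramD(1)[OF lp(2)] openin_imp_subset that by blast
    have x0: "\<forall>(U, g)\<in>\<Gamma>0. \<forall>s\<in>I. c s \<in> g ` U \<longrightarrow>
        (\<exists>d>0. ((\<lambda>t. inv_into U g (c t)) has_vector_derivative complex_of_real d)
                  (at s within I \<inter> c -` (g ` U)))"
      using x unfolding xe boundary_orientation_def mem_Collect_eq prod.case by (rule conjunct2)
    have pos: "\<exists>d>0. ((\<lambda>t. inv_into V h (c t)) has_vector_derivative complex_of_real d)
        (at s within I \<inter> c -` (h ` V))" if q: "(V, h) \<in> \<Gamma>" and s: "s \<in> I" "c s \<in> h ` V" for V h s
    proof -
      obtain U g where p: "(U, g) \<in> \<Gamma>0" "c s \<in> g ` U" using cov cS[OF s(1)] by blast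
      have ps: "(U, g) \<in> surface_charts N M" and qs: "(V, h) \<in> surface_charts N M"
        using p q \<Gamma> \<Gamma>0 by auto
      have qp: "orientation_compatible (V, h) (U, g)" using comp q p by blast
      have pq: "orientation_compatible (U, g) (V, h)"
        by (rule orientation_compatible_sym[OF qs ps qp])
      define z where "z = inv_into U g (c s)"
      have z: "z \<in> U" "g z = c s"
        unfolding z_def using p by (auto intro: inv_into_into f_inv_into_f)
      have zre: "Im z = 0" using re[OF p(1) z(1)] z(2) cS s by simp
      let ?W = "U \<inter> g -` (h ` V)"
      let ?T = "\<lambda>t. inv_into V h (g t)"
      obtain A where A: "(?T has_derivative A) (at z within ?W)" "0 < cdet A"
        using pq z s unfolding orientation_compatible_iff by force
      have A1: "Im (A 1) = 0" "0 < Re (A 1)"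
      proof -
        have 1: "openin (top_of_set {z. 0 \<le> Im z}) ?W"
          by (rule openin_trans[OF openin_chart_domain[OF ps qs] surface_chartD(1)[OF ps]])
        have 2: "z \<in> ?W" using z s by simp
        have 3: "0 \<le> Im (?T w)" if "w \<in> ?W" for w
          using that by (intro surface_chartD(6)[OF qs] inv_into_into) simp
        have 4: "Im (?T w) = 0" if "w \<in> ?W" "Im w = 0" for w
          using that by (intro transition_boundary_point[OF ps qs qp]) simp_all
        show "Im (A 1) = 0" by (rule half_plane_transition_positive(1)[OF 1 2 zre A 3 4])
        show "0 < Re (A 1)" by (rule half_plane_transition_positive(2)[OF 1 2 zre A 3 4])
      qed
      obtain d where d: "0 < d" "((\<lambda>t. inv_into U g (c t)) has_vector_derivative complex_of_real d)
          (at s within I \<inter> c -` (g ` U))"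
        using bspec[OF x0 p(1), unfolded prod.case, THEN bspec, OF s(1)] p(2) by blast
      let ?J = "I \<inter> c -` (h ` V)"
      let ?J1 = "?J \<inter> (I \<inter> c -` (g ` U))"
      have "openin (top_of_set I) (I \<inter> c -` (g ` U))"
        by (rule continuous_openin_preimage[OF local_paramD(2)[OF lp(2)] _ surface_chartD(2)[OF ps]])
          (use cS SM in auto)
      then have "openin (top_of_set ?J) ?J1" by (auto simp: openin_open)
      then have at: "at s within ?J1 = at s within ?J"
        using s p by (intro at_within_Int_openin) auto
      have sJ: "s \<in> ?J1" using s p by auto
      let ?i = "\<lambda>t. inv_into U g (c t)"
      have gi: "g (?i t) = c t" "?i t \<in> U" if "t \<in> ?J1" for t
        using that by (auto intro: f_inv_into_f inv_into_into)
      have iz: "?i s = z" by (simp add: z_def)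
      have sub: "?i ` ?J1 \<subseteq> ?W"
      proof (rule image_subsetI)
        fix t assume "t \<in> ?J1"
        then show "?i t \<in> ?W" using gi[of t] by simp
      qed
      have di: "(?i has_derivative (\<lambda>r. r *\<^sub>R complex_of_real d)) (at s within ?J1)"
        using d(2)[unfolded has_vector_derivative_def] by (rule has_derivative_subset) auto
      have dT: "(?T has_derivative A) (at (?i s) within ?i ` ?J1)"
        unfolding iz using A(1) sub by (rule has_derivative_subset)
      have "((\<lambda>t. ?T (?i t)) has_derivative (\<lambda>r. A (r *\<^sub>R complex_of_real d))) (at s within ?J1)"
        by (rule has_derivative_in_compose[OF di dT])
      then have "((\<lambda>t. inv_into V h (c t)) has_derivative (\<lambda>r. A (r *\<^sub>R complex_of_real d))) (at s within ?J1)"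
        by (rule has_derivative_transform[OF sJ, rotated]) (simp add: gi)
      moreover have "A (r *\<^sub>R complex_of_real d) = r *\<^sub>R complex_of_real (d * Re (A 1))" for r
      proof -
        have "A (r *\<^sub>R complex_of_real d) = Re (r *\<^sub>R complex_of_real d) *\<^sub>R A 1
            + Im (r *\<^sub>R complex_of_real d) *\<^sub>R A \<i>"
          by (rule real_linear_complex[OF has_derivative_linear[OF A(1)]])
        then show ?thesis using A1(1) by (simp add: complex_eq_iff)
      qed
      ultimately show ?thesis
        unfolding has_vector_derivative_def at using d(1) A1(2)
        by (intro exI[of _ "d * Re (A 1)"]) simp
    qed
    then have "\<forall>(V, h)\<in>\<Gamma>. \<forall>s\<in>I. c s \<in> h ` V \<longrightarrow>
        (\<exists>d>0. ((\<lambda>t. inv_into V h (c t)) has_vector_derivative complex_of_real d)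
                  (at s within I \<inter> c -` (h ` V)))"
      by (intro ballI, unfold split_paired_all prod.case) blast
    then show "x \<in> boundary_orientation N \<Gamma> S"
      unfolding xe boundary_orientation_def mem_Collect_eq prod.case using cc by (rule conjI[rotated])
  qed
qed

section \<open>Nodes and chambers of a nodal arrangement\<close>

definition det2 :: "real ^ 2 \<Rightarrow> real ^ 2 \<Rightarrow> real" where
  "det2 a b = a $ 1 * b $ 2 - a $ 2 * b $ 1"

definition perp :: "real ^ 2 \<Rightarrow> real ^ 2" where
  "perp a = vector [- a $ 2, a $ 1]"

lemma inner_2: "a \<bullet> b = a $ 1 * b $ 1 + a $ 2 * b $ 2" for a b :: "real ^ 2"
  by (simp add: inner_vec_def sum_2)

lemma perp_nth [simp]: "perp a $ 1 = - a $ 2" "perp a $ 2 = a $ 1"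
  by (simp_all add: perp_def)

lemma inner_perp: "b \<bullet> perp a = det2 a b"
  by (simp add: inner_2 det2_def)

lemma det2_zero_parallel:
  assumes "det2 a b = 0" "a \<noteq> 0"
  shows "\<exists>c. b = c *\<^sub>R a"
proof -
  have a: "a $ 1 \<noteq> 0 \<or> a $ 2 \<noteq> 0" using assms(2) by (auto simp: vec_eq_iff forall_2)
  have d: "a $ 1 * b $ 2 = a $ 2 * b $ 1" using assms(1) by (simp add: det2_def)
  show ?thesis
  proof (cases "a $ 1 = 0")
    case True
    then have "b = (b $ 2 / a $ 2) *\<^sub>R a" using a d by (simp add: vec_eq_iff forall_2)
    then show ?thesis by blast
  next
    case False
    then have "b = (b $ 1 / a $ 1) *\<^sub>R a" using d by (simp add: vec_eq_iff forall_2 field_simps)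
    then show ?thesis by blast
  qed
qed

lemma det2_zero_inner:
  assumes "det2 a b \<noteq> 0" "a \<bullet> x = 0" "b \<bullet> x = 0"
  shows "x = 0"
proof -
  have "det2 a b * x $ 1 = b $ 2 * (a \<bullet> x) - a $ 2 * (b \<bullet> x)"
    "det2 a b * x $ 2 = a $ 1 * (b \<bullet> x) - b $ 1 * (a \<bullet> x)"
    by (simp_all add: det2_def inner_2 algebra_simps)
  then show ?thesis using assms by (simp add: vec_eq_iff forall_2)
qed

definition real_part :: "complex ^ 2 \<Rightarrow> real ^ 2" where
  "real_part Q = (\<chi> i. Re (Q $ i))"

definition imag_part :: "complex ^ 2 \<Rightarrow> real ^ 2" where
  "imag_part Q = (\<chi> i. Im (Q $ i))"

lemma complexify_nth [simp]: "complexify x $ i = of_real (x $ i)"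
  by (simp add: complexify_def)

lemma real_part_complexify [simp]: "real_part (complexify x) = x"
  by (simp add: real_part_def vec_eq_iff)

lemma complexify_eq_iff [simp]: "complexify x = complexify y \<longleftrightarrow> x = y"
  by (metis real_part_complexify)

lemma complexify_real_part: "imag_part Q = 0 \<Longrightarrow> complexify (real_part Q) = Q"
  by (simp add: vec_eq_iff real_part_def imag_part_def complex_eq_iff)

lemma complexify_add: "complexify (x + y) = complexify x + complexify y"
  by (simp add: vec_eq_iff)

lemma complexify_scaleR: "complexify (r *\<^sub>R x) = of_real r *s complexify x"
  by (simp add: vec_eq_iff)

lemma complexify_diff: "complexify (x - y) = complexify x - complexify y"
  by (simp add: vec_eq_iff)

definition complex_linear_part :: "real ^ 2 \<Rightarrow> complex ^ 2 \<Rightarrow> complex" where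
  "complex_linear_part a q = of_real (a $ 1) * q $ 1 + of_real (a $ 2) * q $ 2"

lemma complex_value_eq: "complex_value p Q = complex_linear_part (fst p) Q + of_real (snd p)"
  by (simp add: complex_value_def complex_linear_part_def sum_2)

lemma complex_value_complexify: "complex_value p (complexify x) = of_real (real_value p x)"
  by (simp add: complex_value_eq complex_linear_part_def real_value_def inner_2)

lemma complex_linear_part_complexify: "complex_linear_part a (complexify x) = of_real (a \<bullet> x)"
  by (simp add: complex_linear_part_def inner_2)

lemma complex_linear_part_add:
  "complex_linear_part a (q + r) = complex_linear_part a q + complex_linear_part a r"
  by (simp add: complex_linear_part_def algebra_simps)

lemma complex_linear_part_diff:
  "complex_linear_part a (q - r) = complex_linear_part a q - complex_linear_part a r"
  by (simp add: complex_linear_part_def algebra_simps)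

lemma complex_linear_part_scale:
  "complex_linear_part a (c *s q) = c * complex_linear_part a q"
  by (simp add: complex_linear_part_def algebra_simps)

lemma complex_linear_part_scaleR:
  "complex_linear_part (r *\<^sub>R a) q = of_real r * complex_linear_part a q"
  by (simp add: complex_linear_part_def algebra_simps)

lemma continuous_on_complex_linear_part [continuous_intros]:
  "continuous_on S f \<Longrightarrow> continuous_on S (\<lambda>x. complex_linear_part a (f x))"
  unfolding complex_linear_part_def by (intro continuous_intros)

lemma continuous_on_complex_value [continuous_intros]:
  "continuous_on S f \<Longrightarrow> continuous_on S (\<lambda>x. complex_value p (f x))"
  unfolding complex_value_eq by (intro continuous_intros)

lemma complex_value_diff:
  "complex_value p Q - complex_value p R = complex_linear_part (fst p) (Q - R)"
  by (simp add: complex_value_eq complex_linear_part_diff)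

lemma real_value_add_scaleR:
  "real_value p (x + t *\<^sub>R d) = real_value p x + t * (fst p \<bullet> d)"
  by (simp add: real_value_def inner_add_right)

locale nodal_lines =
  fixes \<A> :: "(real ^ 2) set set" and lam :: "(real ^ 2) set \<Rightarrow> affine_fun"
  assumes nodal: "nodal_arrangement \<A>" and lines: "defines_lines \<A> lam"
begin

abbreviation rv :: "(real ^ 2) set \<Rightarrow> real ^ 2 \<Rightarrow> real" where
  "rv l x \<equiv> real_value (lam l) x"

abbreviation nv :: "(real ^ 2) set \<Rightarrow> real ^ 2" where
  "nv l \<equiv> fst (lam l)"

abbreviation cv :: "(real ^ 2) set \<Rightarrow> complex ^ 2 \<Rightarrow> complex" where
  "cv l Q \<equiv> complex_value (lam l) Q"

abbreviation N :: "(complex ^ 2) set" where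
  "N \<equiv> nodes \<A> lam"

lemma finite_lines: "finite \<A>"
  using nodal unfolding nodal_arrangement_def by blast

lemma mem_line_iff: "l \<in> \<A> \<Longrightarrow> x \<in> l \<longleftrightarrow> rv l x = 0"
  using lines unfolding defines_lines_def by blast

lemma normal_nonzero:
  assumes "l \<in> \<A>"
  shows "nv l \<noteq> 0"
proof
  assume 0: "nv l = 0"
  have d: "aff_dim l = 1" using nodal assms unfolding nodal_arrangement_def by blast
  have "x \<in> l \<longleftrightarrow> snd (lam l) = 0" for x
    using mem_line_iff[OF assms, of x] 0 by (simp add: real_value_def)
  then have "l = UNIV \<or> l = {}" by blast
  moreover have "aff_dim (UNIV :: (real ^ 2) set) = 2" by (simp add: aff_dim_UNIV)
  ultimately show False using d by fastforce
qed

lemma no_three_concurrent: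
  assumes "l \<in> \<A>" "m \<in> \<A>" "k \<in> \<A>" "l \<noteq> m" "x \<in> l" "x \<in> m" "x \<in> k"
  shows "k = l \<or> k = m"
proof (rule ccontr)
  assume "\<not> (k = l \<or> k = m)"
  then have "l \<inter> m \<inter> k = {}"
    using nodal assms(1-4) unfolding nodal_arrangement_def by metis
  then show False using assms by blast
qed

text \<open>Parallel lines with a common point coincide.\<close>

lemma det_normals_nonzero:
  assumes lm: "l \<in> \<A>" "m \<in> \<A>" "l \<noteq> m" and x: "x \<in> l" "x \<in> m"
  shows "det2 (nv l) (nv m) \<noteq> 0"
proof
  assume "det2 (nv l) (nv m) = 0"
  then obtain c where c: "nv m = c *\<^sub>R nv l"
    using det2_zero_parallel normal_nonzero lm by blast
  have c0: "c \<noteq> 0" using c normal_nonzero[OF lm(2)] by auto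
  have "rv m y = c * rv l y" for y
  proof -
    have "rv l x = 0" "rv m x = 0" using x lm mem_line_iff by auto
    then show ?thesis unfolding real_value_def c by (simp add: algebra_simps)
      (metis (no_types, lifting) add.inverse_inverse add_eq_0_iff mult_minus_right)
  qed
  then have "y \<in> l \<longleftrightarrow> y \<in> m" for y using c0 mem_line_iff lm by simp
  then show False using lm(3) by blast
qed

lemma intersection_unique:
  assumes "l \<in> \<A>" "m \<in> \<A>" "l \<noteq> m" "x \<in> l" "x \<in> m" "y \<in> l" "y \<in> m"
  shows "x = y"
proof -
  have "nv l \<bullet> (x - y) = 0" "nv m \<bullet> (x - y) = 0"
    using assms mem_line_iff[of l x] mem_line_iff[of l y] mem_line_iff[of m x] mem_line_iff[of m y]
    by (simp_all add: real_value_def inner_diff_right)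
  then show ?thesis using det2_zero_inner det_normals_nonzero[OF assms(1-5)] by fastforce
qed

text \<open>The imaginary part of a common complex zero is killed by two independent real functionals.\<close>

lemma complex_intersection:
  assumes lm: "l \<in> \<A>" "m \<in> \<A>" "l \<noteq> m" and 0: "cv l Q = 0" "cv m Q = 0"
  obtains P where "Q = complexify P" "P \<in> l" "P \<in> m"
proof -
  have re: "real_part Q \<in> k" and im: "nv k \<bullet> imag_part Q = 0" if "k \<in> \<A>" "cv k Q = 0" for k
  proof -
    have "Re (cv k Q) = rv k (real_part Q)" "Im (cv k Q) = nv k \<bullet> imag_part Q"
      by (simp_all add: complex_value_eq complex_linear_part_def real_value_def inner_2
          real_part_def imag_part_def)
    then show "real_part Q \<in> k" "nv k \<bullet> imag_part Q = 0" using that mem_line_iff by simp_all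
  qed
  have "det2 (nv l) (nv m) \<noteq> 0"
    using det_normals_nonzero[OF lm] re[OF lm(1) 0(1)] re[OF lm(2) 0(2)] by blast
  then have "imag_part Q = 0"
    using det2_zero_inner im[OF lm(1) 0(1)] im[OF lm(2) 0(2)] by blast
  then show ?thesis
    using that[of "real_part Q"] complexify_real_part re lm 0 by metis
qed

lemma cv_complexify_eq_0: "l \<in> \<A> \<Longrightarrow> cv l (complexify x) = 0 \<longleftrightarrow> x \<in> l"
  by (simp add: complex_value_complexify mem_line_iff)

lemma arr_poly_has_derivative:
  "(arr_poly \<A> lam has_derivative
     (\<lambda>y. \<Sum>l\<in>\<A>. complex_linear_part (nv l) y * (\<Prod>k\<in>\<A> - {l}. cv k Q))) (at Q)"
proof -
  have "bounded_linear (complex_linear_part a)" for a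
    unfolding complex_linear_part_def
    by (intro bounded_linear_add bounded_linear_mult_const bounded_linear_const_mult
        bounded_linear_vec_nth)
  then have "(complex_value p has_derivative complex_linear_part (fst p)) (at Q)" for p
    unfolding complex_value_eq[abs_def]
    by (intro has_derivative_add_const bounded_linear_imp_has_derivative)
  then show ?thesis unfolding arr_poly_def[abs_def] by (intro has_derivative_prod)
qed

text \<open>If exactly one factor \<open>\<lambda>\<close> vanishes at \<open>Q\<close>, the differential of the product is a nonzero
  multiple of that of \<open>\<lambda>\<close>; if two do, it is zero.\<close>

lemma nodes_iff:
  "Q \<in> N \<longleftrightarrow> (\<exists>l\<in>\<A>. \<exists>m\<in>\<A>. l \<noteq> m \<and> (\<exists>P. P \<in> l \<and> P \<in> m \<and> Q = complexify P))"
proof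
  assume Q: "Q \<in> N"
  then obtain l where l: "l \<in> \<A>" "cv l Q = 0" unfolding nodes_def complex_curve_def by blast
  have d: "(arr_poly \<A> lam has_derivative (\<lambda>_. 0)) (at Q)" using Q unfolding nodes_def by blast
  have "\<exists>m\<in>\<A> - {l}. cv m Q = 0"
  proof (rule ccontr)
    assume "\<not> (\<exists>m\<in>\<A> - {l}. cv m Q = 0)"
    then have nz: "(\<Prod>k\<in>\<A> - {l}. cv k Q) \<noteq> 0" using finite_lines by simp
    have "(\<Prod>k\<in>\<A> - {i}. cv k Q) = 0" if "i \<in> \<A> - {l}" for i
      using that l finite_lines by (intro prod_zero) auto
    then have "(\<Sum>i\<in>\<A> - {l}. complex_linear_part (nv i) y * (\<Prod>k\<in>\<A> - {i}. cv k Q)) = 0" for y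
      by (intro sum.neutral) simp
    then have "(\<Sum>i\<in>\<A>. complex_linear_part (nv i) y * (\<Prod>k\<in>\<A> - {i}. cv k Q))
        = complex_linear_part (nv l) y * (\<Prod>k\<in>\<A> - {l}. cv k Q)" for y
      by (subst sum.remove[OF finite_lines l(1)]) simp
    then have "complex_linear_part (nv l) y * (\<Prod>k\<in>\<A> - {l}. cv k Q) = 0" for y
      using has_derivative_unique[OF arr_poly_has_derivative[of Q] d] by metis
    from this[of "complexify (nv l)"] have "nv l \<bullet> nv l = 0"
      using nz by (simp add: complex_linear_part_complexify)
    then show False using normal_nonzero[OF l(1)] by simp
  qed
  then obtain m where m: "m \<in> \<A>" "l \<noteq> m" "cv m Q = 0" by blast
  obtain P where "Q = complexify P" "P \<in> l" "P \<in> m"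
    using complex_intersection[OF l(1) m(1,2) l(2) m(3)] by blast
  then show "\<exists>l\<in>\<A>. \<exists>m\<in>\<A>. l \<noteq> m \<and> (\<exists>P. P \<in> l \<and> P \<in> m \<and> Q = complexify P)"
    using l m by blast
next
  assume "\<exists>l\<in>\<A>. \<exists>m\<in>\<A>. l \<noteq> m \<and> (\<exists>P. P \<in> l \<and> P \<in> m \<and> Q = complexify P)"
  then obtain l m P where lm: "l \<in> \<A>" "m \<in> \<A>" "l \<noteq> m" "P \<in> l" "P \<in> m" "Q = complexify P" by blast
  have 0: "cv l Q = 0" "cv m Q = 0" using lm cv_complexify_eq_0 by auto
  have "(\<Prod>k\<in>\<A> - {i}. cv k Q) = 0" for i
  proof (cases "i = l")
    case True
    then show ?thesis using lm 0 finite_lines by (intro prod_zero) auto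
  next
    case False
    then show ?thesis using lm 0 finite_lines by (intro prod_zero) auto
  qed
  then have "(arr_poly \<A> lam has_derivative (\<lambda>_. 0)) (at Q)"
    using arr_poly_has_derivative[of Q] by simp
  moreover have "Q \<in> complex_curve \<A> lam" using lm 0 unfolding complex_curve_def by blast
  ultimately show "Q \<in> N" unfolding nodes_def by blast
qed

lemma complexify_mem_nodes_iff:
  "complexify P \<in> N \<longleftrightarrow> (\<exists>l\<in>\<A>. \<exists>m\<in>\<A>. l \<noteq> m \<and> P \<in> l \<and> P \<in> m)"
  unfolding nodes_iff by auto

lemma finite_nodes: "finite N"
proof -
  have "N \<subseteq> (\<lambda>(l, m). complexify (SOME P. P \<in> l \<and> P \<in> m)) ` (\<A> \<times> \<A>)"
  proof
    fix Q assume "Q \<in> N"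
    then obtain l m P where lm: "l \<in> \<A>" "m \<in> \<A>" "l \<noteq> m" "P \<in> l" "P \<in> m" "Q = complexify P"
      unfolding nodes_iff by blast
    have "(SOME P. P \<in> l \<and> P \<in> m) = P"
      using lm intersection_unique by (intro some_equality) auto
    then show "Q \<in> (\<lambda>(l, m). complexify (SOME P. P \<in> l \<and> P \<in> m)) ` (\<A> \<times> \<A>)"
      using lm by (intro image_eqI[of _ _ "(l, m)"]) auto
  qed
  then show ?thesis using finite_lines finite_subset by blast
qed

text \<open>A bounded chamber is handled through the signs of the affine functions on its interior.\<close>

definition has_signs :: "(real ^ 2) set \<Rightarrow> ((real ^ 2) set \<Rightarrow> real) \<Rightarrow> bool" where
  "has_signs C eps \<longleftrightarrow> (\<forall>l. eps l = 1 \<or> eps l = -1) \<and>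
     C = {x. \<forall>l\<in>\<A>. 0 \<le> eps l * rv l x} \<and> (\<exists>x. \<forall>l\<in>\<A>. 0 < eps l * rv l x) \<and> bounded C"

lemma continuous_on_rv: "continuous_on S (rv l)"
  unfolding real_value_def by (intro continuous_intros)

lemma convex_cell: "convex {x. \<forall>l\<in>\<A>. 0 < eps l * rv l x}"
proof (rule convexI)
  fix x y and u v :: real
  assume xy: "x \<in> {x. \<forall>l\<in>\<A>. 0 < eps l * rv l x}" "y \<in> {x. \<forall>l\<in>\<A>. 0 < eps l * rv l x}"
    and uv: "0 \<le> u" "0 \<le> v" "u + v = 1"
  have "0 < eps l * rv l (u *\<^sub>R x + v *\<^sub>R y)" if "l \<in> \<A>" for l
  proof -
    have "rv l (u *\<^sub>R x + v *\<^sub>R y) = u * (nv l \<bullet> x) + v * (nv l \<bullet> y) + (u + v) * snd (lam l)"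
      using uv by (simp add: real_value_def inner_add_right)
    also have "\<dots> = u * rv l x + v * rv l y" by (simp add: real_value_def algebra_simps)
    finally have "eps l * rv l (u *\<^sub>R x + v *\<^sub>R y) = u * (eps l * rv l x) + v * (eps l * rv l y)"
      by (simp add: algebra_simps)
    moreover have "0 < u \<or> 0 < v" using uv by linarith
    moreover have "0 < eps l * rv l x" "0 < eps l * rv l y" using xy that by auto
    ultimately show ?thesis
      using uv by (metis add_nonneg_pos add_pos_nonneg less_eq_real_def mult_nonneg_nonneg mult_pos_pos)
  qed
  then show "u *\<^sub>R x + v *\<^sub>R y \<in> {x. \<forall>l\<in>\<A>. 0 < eps l * rv l x}" by simp
qed

text \<open>No function \<open>rv l\<close> changes sign on a component \<open>K\<close> of the complement, by the intermediate value
  theorem. Conversely the cell of all points with the signs of \<open>K\<close> is convex, hence connected, so it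
  is \<open>K\<close>. Segments to an interior point show that the closure is given by the weak inequalities.\<close>

lemma bounded_chamber_signs:
  assumes C: "C \<in> bounded_chambers \<A>"
  obtains eps where "has_signs C eps"
proof -
  obtain K where K: "K \<in> components (- \<Union>\<A>)" "C = closure K" "bounded C"
    using C unfolding bounded_chambers_def by blast
  have K1: "connected K" "K \<subseteq> - \<Union>\<A>" "K \<noteq> {}"
    using K(1) in_components_connected in_components_subset in_components_nonempty by blast+
  then obtain x0 where x0: "x0 \<in> K" by blast
  define eps where "eps l = (if 0 < rv l x0 then 1 else -1 :: real)" for l
  define cell where "cell = {x. \<forall>l\<in>\<A>. 0 < eps l * rv l x}"
  have nz: "rv l x \<noteq> 0" if "x \<in> K" "l \<in> \<A>" for x l
    using that K1(2) mem_line_iff by blast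
  have x0c: "x0 \<in> cell" using nz[OF x0] unfolding cell_def eps_def by force
  have "K \<subseteq> cell"
  proof
    fix x assume x: "x \<in> K"
    have "0 < eps l * rv l x" if l: "l \<in> \<A>" for l
    proof (rule ccontr)
      assume "\<not> 0 < eps l * rv l x"
      then have neg: "eps l * rv l x < 0" using nz[OF x l] by (auto simp: eps_def)
      have pos: "0 < eps l * rv l x0" using x0c l by (auto simp: cell_def)
      have "connected ((\<lambda>y. eps l * rv l y) ` K)"
        by (intro connected_continuous_image K1 continuous_on_mult continuous_on_const continuous_on_rv)
      then have "{eps l * rv l x .. eps l * rv l x0} \<subseteq> (\<lambda>y. eps l * rv l y) ` K"
        using x x0 by (intro connected_contains_Icc) auto
      then have "0 \<in> (\<lambda>y. eps l * rv l y) ` K" using neg pos by (auto simp: subset_iff)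
      then show False using nz l by (auto simp: eps_def split: if_splits)
    qed
    then show "x \<in> cell" by (simp add: cell_def)
  qed
  moreover have "cell \<subseteq> K"
  proof (rule components_maximal[OF K(1)])
    show "connected cell" unfolding cell_def by (rule convex_connected[OF convex_cell])
    show "cell \<subseteq> - \<Union>\<A>" using mem_line_iff unfolding cell_def by fastforce
    show "K \<inter> cell \<noteq> {}" using x0 x0c by blast
  qed
  ultimately have Kc: "K = cell" by blast
  have "closure cell = {x. \<forall>l\<in>\<A>. 0 \<le> eps l * rv l x}" (is "_ = ?C")
  proof
    have "closed ?C"
    proof -
      have "?C = (\<Inter>l\<in>\<A>. {x. 0 \<le> eps l * rv l x})" by blast
      moreover have "closed {x. 0 \<le> eps l * rv l x}" for l
        by (intro closed_Collect_le continuous_on_const continuous_on_mult continuous_on_rv)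
      ultimately show ?thesis by (simp add: closed_INT)
    qed
    then show "closure cell \<subseteq> ?C"
      by (intro closure_minimal) (auto simp: cell_def less_imp_le)
    show "?C \<subseteq> closure cell"
    proof
      fix x assume x: "x \<in> ?C"
      show "x \<in> closure cell"
      proof (subst closure_approachable, intro allI impI)
        fix e :: real assume e: "0 < e"
        define t where "t = min 1 (e / (2 * (norm (x0 - x) + 1)))"
        define b where "b = norm (x0 - x)"
        have n: "0 \<le> b" "0 < 2 * (b + 1)" by (simp_all add: b_def add_nonneg_pos)
        have t: "0 < t" "t \<le> 1" using divide_pos_pos[OF e n(2)] by (simp_all add: t_def b_def)
        have "t * b \<le> e / (2 * (b + 1)) * b"
          using n by (intro mult_right_mono) (simp_all add: t_def b_def)
        also have "\<dots> < e"
        proof -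
          have "e * b < e * (2 * (b + 1))"
            using e n(1) by (intro mult_strict_left_mono) simp_all
          then show ?thesis using n by (simp add: divide_less_eq)
        qed
        finally have "t * norm (x0 - x) < e" unfolding b_def .
        then have d: "dist (x + t *\<^sub>R (x0 - x)) x < e" using t by (simp add: dist_norm)
        have "0 < eps l * rv l (x + t *\<^sub>R (x0 - x))" if l: "l \<in> \<A>" for l
        proof -
          have "nv l \<bullet> (x0 - x) = rv l x0 - rv l x" by (simp add: real_value_def inner_diff_right)
          then have "eps l * rv l (x + t *\<^sub>R (x0 - x)) = (1 - t) * (eps l * rv l x) + t * (eps l * rv l x0)"
            unfolding real_value_add_scaleR by (simp only:) (simp add: algebra_simps)
          moreover have "0 \<le> (1 - t) * (eps l * rv l x)" "0 < t * (eps l * rv l x0)"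
            using x x0c l t by (auto simp: cell_def)
          ultimately show ?thesis by linarith
        qed
        then show "\<exists>y\<in>cell. dist y x < e"
          using d by (intro bexI[of _ "x + t *\<^sub>R (x0 - x)"]) (auto simp: cell_def)
      qed
    qed
  qed
  moreover have "\<exists>x. \<forall>l\<in>\<A>. 0 < eps l * rv l x" using x0c unfolding cell_def by blast
  moreover have "eps l = 1 \<or> eps l = -1" for l by (simp add: eps_def)
  ultimately have "has_signs C eps"
    unfolding has_signs_def using K(2,3) Kc by simp
  then show ?thesis using that by blast
qed

text \<open>The ray leaves the bounded chamber at the smallest of the times at which a function that decreases
  along the ray reaches zero.\<close>

lemma ray_meets_boundary:
  assumes s: "has_signs C eps" and x: "x \<in> C" and d: "d \<noteq> 0"
  obtains t k where "0 \<le> t" "x + t *\<^sub>R d \<in> C" "k \<in> \<A>" "x + t *\<^sub>R d \<in> k" "nv k \<bullet> d \<noteq> 0"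
proof -
  have C: "C = {x. \<forall>l\<in>\<A>. 0 \<le> eps l * rv l x}" and b: "bounded C"
    using s unfolding has_signs_def by auto
  define J where "J = {k \<in> \<A>. eps k * (nv k \<bullet> d) < 0}"
  define T where "T k = eps k * rv k x / (- (eps k * (nv k \<bullet> d)))" for k
  have val: "eps k * rv k (x + t *\<^sub>R d) = eps k * rv k x + t * (eps k * (nv k \<bullet> d))" for k t
    by (simp add: real_value_add_scaleR algebra_simps)
  have "J \<noteq> {}"
  proof
    assume J: "J = {}"
    have ray: "x + t *\<^sub>R d \<in> C" if "0 \<le> t" for t
    proof -
      have "0 \<le> eps k * rv k x + t * (eps k * (nv k \<bullet> d))" if "k \<in> \<A>" for k
      proof -
        have "0 \<le> eps k * (nv k \<bullet> d)" using J that unfolding J_def by force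
        moreover have "0 \<le> eps k * rv k x" using x that unfolding C by blast
        ultimately show ?thesis using \<open>0 \<le> t\<close> by simp
      qed
      then show ?thesis unfolding C mem_Collect_eq val by blast
    qed
    obtain B where B: "\<And>y. y \<in> C \<Longrightarrow> norm y \<le> B" using b unfolding bounded_iff by blast
    define t where "t = (B + norm x + 1) / norm d"
    have "0 \<le> B" using B[OF x] norm_ge_zero order_trans by blast
    then have t: "0 \<le> t" "t * norm d = B + norm x + 1" using d by (auto simp: t_def)
    have "norm (t *\<^sub>R d) - norm x \<le> norm (x + t *\<^sub>R d)"
      by (metis add.commute norm_diff_ineq)
    then show False using B[OF ray[OF t(1)]] t by simp
  qed
  moreover have fin: "finite J" using finite_lines by (simp add: J_def)
  ultimately obtain k where k: "k \<in> J" "\<And>j. j \<in> J \<Longrightarrow> T k \<le> T j"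
    using arg_min_if_finite[of J T] by (metis not_less)
  have neg: "eps j * (nv j \<bullet> d) < 0" if "j \<in> J" for j using that by (simp add: J_def)
  have cancel: "a / (- b) * - b = a" "a + a / (- b) * b = 0" if "b < 0" for a b :: real
    using that by simp_all
  have T0: "0 \<le> T k" using x neg[OF k(1)] k(1) unfolding T_def C J_def
    by (intro divide_nonneg_pos) auto
  have "0 \<le> eps j * rv j x + T k * (eps j * (nv j \<bullet> d))" if j: "j \<in> \<A>" for j
  proof (cases "j \<in> J")
    case True
    have "T k * - (eps j * (nv j \<bullet> d)) \<le> T j * - (eps j * (nv j \<bullet> d))"
      using k(2)[OF True] neg[OF True] by (intro mult_right_mono) auto
    also have "\<dots> = eps j * rv j x" unfolding T_def by (rule cancel(1)[OF neg[OF True]])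
    finally show ?thesis by simp
  next
    case False
    then have "0 \<le> eps j * (nv j \<bullet> d)" using j by (auto simp: J_def)
    moreover have "0 \<le> eps j * rv j x" using x j unfolding C by blast
    ultimately show ?thesis using T0 by simp
  qed
  then have "x + T k *\<^sub>R d \<in> C" unfolding C mem_Collect_eq val by blast
  moreover have "eps k * rv k x + T k * (eps k * (nv k \<bullet> d)) = 0"
    unfolding T_def by (rule cancel(2)[OF neg[OF k(1)]])
  then have "eps k * rv k (x + T k *\<^sub>R d) = 0" unfolding val .
  then have "rv k (x + T k *\<^sub>R d) = 0" using s unfolding has_signs_def by (metis mult_eq_0_iff zero_neq_neg_one zero_neq_one)
  ultimately show ?thesis
    using that[of "T k" k] T0 k(1) neg[OF k(1)] mem_line_iff unfolding J_def by fastforce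
qed

definition corner :: "(real ^ 2) set \<Rightarrow> (real ^ 2) set \<Rightarrow> (real ^ 2) set \<Rightarrow> real ^ 2 \<Rightarrow> bool" where
  "corner C l m P \<longleftrightarrow> l \<in> \<A> \<and> m \<in> \<A> \<and> l \<noteq> m \<and> P \<in> l \<and> P \<in> m \<and> P \<in> C"

lemma corner_swap: "corner C l m P \<longleftrightarrow> corner C m l P"
  unfolding corner_def by blast

text \<open>Follow the edge until it meets another line.\<close>

lemma corner_on_edge:
  assumes s: "has_signs C eps" and x: "x \<in> C" "x \<in> l" "l \<in> \<A>"
  obtains m P where "corner C l m P"
proof -
  have "perp (nv l) \<noteq> 0" using normal_nonzero[OF x(3)] by (auto simp: vec_eq_iff forall_2)
  then obtain t k where k: "x + t *\<^sub>R perp (nv l) \<in> C" "k \<in> \<A>" "x + t *\<^sub>R perp (nv l) \<in> k"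
    "nv k \<bullet> perp (nv l) \<noteq> 0"
    using ray_meets_boundary[OF s x(1)] by metis
  have 0: "nv l \<bullet> perp (nv l) = 0" by (simp add: inner_perp det2_def)
  then have "x + t *\<^sub>R perp (nv l) \<in> l"
    using x mem_line_iff by (simp add: real_value_add_scaleR)
  moreover have "k \<noteq> l" using 0 k by blast
  ultimately show ?thesis using that k x unfolding corner_def by blast
qed

lemma corner_exists:
  assumes s: "has_signs C eps"
  obtains l m P where "corner C l m P"
proof -
  obtain x where x: "\<forall>l\<in>\<A>. 0 < eps l * rv l x" using s unfolding has_signs_def by blast
  have C: "C = {x. \<forall>l\<in>\<A>. 0 \<le> eps l * rv l x}" using s unfolding has_signs_def by (elim conjE)
  have xC: "x \<in> C" unfolding C using x less_imp_le by blast
  have d: "axis 1 1 \<noteq> (0 :: real ^ 2)" by (simp add: axis_eq_0_iff)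
  obtain t k where k: "x + t *\<^sub>R axis 1 1 \<in> C" "k \<in> \<A>" "x + t *\<^sub>R axis 1 1 \<in> k"
    by (rule ray_meets_boundary[OF s xC d])
  obtain m P where "corner C k m P" by (rule corner_on_edge[OF s k(1,3,2)])
  then show ?thesis by (rule that)
qed

lemma corner_others_positive:
  assumes s: "has_signs C eps" and c: "corner C l m P" and k: "k \<in> \<A>" "k \<noteq> l" "k \<noteq> m"
  shows "0 < eps k * rv k P"
proof -
  have "P \<notin> k" using no_three_concurrent[of l m k P] c k unfolding corner_def by blast
  then have "rv k P \<noteq> 0" using k mem_line_iff by blast
  moreover have "0 \<le> eps k * rv k P" using s c k unfolding has_signs_def corner_def by blast
  moreover have "eps k \<noteq> 0" using s unfolding has_signs_def by (metis zero_neq_neg_one zero_neq_one)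
  ultimately show ?thesis by (simp add: order_less_le)
qed

text \<open>The tangent cone of a chamber at \<open>P\<close> is cut out by the lines through \<open>P\<close>.\<close>

lemma eventually_in_chamber:
  assumes s: "has_signs C eps" and P: "P \<in> C"
    and d: "\<And>k. k \<in> \<A> \<Longrightarrow> P \<in> k \<Longrightarrow> 0 \<le> eps k * (nv k \<bullet> d)"
  shows "\<forall>\<^sub>F t in at_right 0. P + t *\<^sub>R d \<in> C"
proof -
  have C: "C = {x. \<forall>l\<in>\<A>. 0 \<le> eps l * rv l x}" and e: "\<And>l. eps l \<noteq> 0"
    using s unfolding has_signs_def by (auto, metis zero_neq_neg_one zero_neq_one)
  have "\<forall>\<^sub>F t in at_right 0. 0 \<le> eps k * rv k (P + t *\<^sub>R d)" if k: "k \<in> \<A>" for k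
  proof (cases "P \<in> k")
    case True
    then have "rv k P = 0" using k mem_line_iff by blast
    then have "0 \<le> eps k * rv k (P + t *\<^sub>R d)" if "0 < t" for t
      using d[OF k True] that by (simp add: real_value_add_scaleR mult.left_commute)
    then show ?thesis by (auto simp: eventually_at_right_less intro: eventually_mono[OF eventually_at_right_less])
  next
    case False
    then have "rv k P \<noteq> 0" using k mem_line_iff by blast
    moreover have "0 \<le> eps k * rv k P" using P k unfolding C by blast
    ultimately have pos: "0 < eps k * rv k P" using e[of k] by (simp add: order_less_le)
    have "((\<lambda>t. eps k * rv k (P + t *\<^sub>R d)) \<longlongrightarrow> eps k * (rv k P + 0 * (nv k \<bullet> d))) (at_right 0)"
      unfolding real_value_add_scaleR by (intro tendsto_intros)
    then have "\<forall>\<^sub>F t in at_right 0. 0 < eps k * rv k (P + t *\<^sub>R d)"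
      using pos by (intro order_tendstoD(1)) auto
    then show ?thesis by (rule eventually_mono) simp
  qed
  then have "\<forall>\<^sub>F t in at_right 0. \<forall>k\<in>\<A>. 0 \<le> eps k * rv k (P + t *\<^sub>R d)"
    using finite_lines by (simp add: eventually_ball_finite)
  then show ?thesis unfolding C by simp
qed

text \<open>Two chambers meeting in a single point lie in opposite sectors there: if at most one of the
  lines through the point separated them, they would share a segment.\<close>

lemma opposite_corner:
  assumes s: "has_signs C eps" and s': "has_signs C' eps'" and P: "C \<inter> C' = {P}"
  obtains l m where "corner C l m P" "corner C' l m P" "eps' l = - eps l" "eps' m = - eps m"
    "\<And>k. k \<in> \<A> \<Longrightarrow> k \<noteq> l \<Longrightarrow> k \<noteq> m \<Longrightarrow> eps' k = eps k"
proof -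
  have e: "eps k = 1 \<or> eps k = -1" "eps' k = 1 \<or> eps' k = -1" for k
    using s s' unfolding has_signs_def by blast+
  have C: "C = {x. \<forall>l\<in>\<A>. 0 \<le> eps l * rv l x}" "C' = {x. \<forall>l\<in>\<A>. 0 \<le> eps' l * rv l x}"
    using s s' unfolding has_signs_def by blast+
  have PC: "P \<in> C" "P \<in> C'" using P by blast+
  have off: "eps' k = eps k" if "k \<in> \<A>" "P \<notin> k" for k
  proof -
    have "rv k P \<noteq> 0" using that mem_line_iff by blast
    moreover have "0 \<le> eps k * rv k P" "0 \<le> eps' k * rv k P" using PC that unfolding C by blast+
    ultimately show ?thesis using e[of k] by auto
  qed
  have no_common: "\<not> (\<forall>k\<in>\<A>. P \<in> k \<longrightarrow> 0 \<le> eps k * (nv k \<bullet> d) \<and> 0 \<le> eps' k * (nv k \<bullet> d))"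
    if d: "d \<noteq> 0" for d
  proof
    assume a: "\<forall>k\<in>\<A>. P \<in> k \<longrightarrow> 0 \<le> eps k * (nv k \<bullet> d) \<and> 0 \<le> eps' k * (nv k \<bullet> d)"
    have "\<forall>\<^sub>F t in at_right 0. P + t *\<^sub>R d \<in> C" "\<forall>\<^sub>F t in at_right 0. P + t *\<^sub>R d \<in> C'"
      using a by (auto intro!: eventually_in_chamber[OF s PC(1)] eventually_in_chamber[OF s' PC(2)])
    then have "\<forall>\<^sub>F t in at_right 0. P + t *\<^sub>R d \<in> C \<and> P + t *\<^sub>R d \<in> C' \<and> 0 < (t :: real)"
      using eventually_at_right_less[of "0 :: real"] by (intro eventually_conj) auto
    then obtain t :: real where t: "P + t *\<^sub>R d \<in> C" "P + t *\<^sub>R d \<in> C'" "0 < t"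
      using eventually_happens trivial_limit_at_right_real by blast
    then have "P + t *\<^sub>R d = P" using P by blast
    then show False using t d by simp
  qed
  have "\<exists>l m. l \<in> \<A> \<and> m \<in> \<A> \<and> P \<in> l \<and> P \<in> m \<and> l \<noteq> m \<and> eps' l \<noteq> eps l \<and> eps' m \<noteq> eps m"
  proof (rule ccontr)
    assume none: "\<not> ?thesis"
    \<comment> \<open>A direction along the only line that may separate the chambers. At most one other line \<open>m\<close> passes
      through \<open>P\<close>, and it does not separate them, so that one of \<open>d\<close> and \<open>- d\<close> points into both.\<close>
    have "\<exists>d. d \<noteq> 0 \<and> (\<exists>m. eps' m = eps m \<and> (\<forall>k\<in>\<A>. P \<in> k \<longrightarrow> k \<noteq> m \<longrightarrow> nv k \<bullet> d = 0)) "
    proof (cases "\<exists>l\<in>\<A>. P \<in> l")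
      case False
      then show ?thesis using off e by (metis axis_eq_0_iff mem_line_iff no_common zero_neq_one)
    next
      case True
      then obtain l where l: "l \<in> \<A>" "P \<in> l"
        "\<And>m. m \<in> \<A> \<Longrightarrow> P \<in> m \<Longrightarrow> m \<noteq> l \<Longrightarrow> eps' m = eps m" using none by metis
      have d: "perp (nv l) \<noteq> 0" "nv l \<bullet> perp (nv l) = 0"
        using normal_nonzero[OF l(1)] by (auto simp: vec_eq_iff forall_2 inner_perp det2_def)
      show ?thesis
      proof (cases "\<exists>m\<in>\<A>. P \<in> m \<and> m \<noteq> l")
        case True
        then obtain m where m: "m \<in> \<A>" "P \<in> m" "m \<noteq> l" by blast
        then have "k = l" if "k \<in> \<A>" "P \<in> k" "k \<noteq> m" for k
          using no_three_concurrent[of l m k P] l that by blast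
        then show ?thesis using d l(3)[OF m] by blast
      next
        case False
        then have "nv k \<bullet> perp (nv l) = 0" if "k \<in> \<A>" "P \<in> k" for k using d that by blast
        then show ?thesis using no_common[OF d(1)] by auto
      qed
    qed
    then obtain d m where d: "d \<noteq> 0" "eps' m = eps m"
      "\<And>k. k \<in> \<A> \<Longrightarrow> P \<in> k \<Longrightarrow> k \<noteq> m \<Longrightarrow> nv k \<bullet> d = 0" by blast
    show False
    proof (cases "0 \<le> eps m * (nv m \<bullet> d)")
      case True
      then show False using no_common[OF d(1)] d(2,3) by (metis mult_zero_right order_refl)
    next
      case False
      then have "0 \<le> eps m * (nv m \<bullet> (- d))" by simp
      moreover have "nv k \<bullet> (- d) = 0" if "k \<in> \<A>" "P \<in> k" "k \<noteq> m" for k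
        using d(3)[OF that] by simp
      moreover have "- d \<noteq> 0" using d(1) by simp
      ultimately show False using no_common[of "- d"] d(2) by (metis mult_zero_right order_refl)
    qed
  qed
  then obtain l m where lm: "l \<in> \<A>" "m \<in> \<A>" "P \<in> l" "P \<in> m" "l \<noteq> m" "eps' l \<noteq> eps l" "eps' m \<noteq> eps m"
    by blast
  have "eps' l = - eps l" "eps' m = - eps m" using lm e[of l] e[of m] by auto
  moreover have "eps' k = eps k" if "k \<in> \<A>" "k \<noteq> l" "k \<noteq> m" for k
    using no_three_concurrent[of l m k P] lm that off by blast
  ultimately show ?thesis using that[of l m] lm PC unfolding corner_def by blast
qed

end

section \<open>The resolution as an explicit set\<close>

lemma join_nth [simp]: "join w v $ 1 = w" "join w v $ 2 = v $ 1" "join w v $ 3 = v $ 2"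
  by (simp_all add: join_def)

lemma plane_part_nth [simp]: "plane_part u $ 1 = u $ 2" "plane_part u $ 2 = u $ 3"
  by (simp_all add: plane_part_def)

lemma plane_part_join [simp]: "plane_part (join w v) = v"
  by (simp add: vec_eq_iff forall_2)

lemma join_collapse: "join (u $ 1) (plane_part u) = u"
  by (simp add: vec_eq_iff forall_3)

lemma plane_part_scale: "plane_part (c *s u) = c *s plane_part u"
  by (simp add: vec_eq_iff forall_2)

lemma join_scale: "join (c * w) (c *s v) = c *s join w v"
  by (simp add: vec_eq_iff forall_3)

lemma join_eq_0_iff: "join w v = 0 \<longleftrightarrow> w = 0 \<and> v = 0"
  by (simp add: vec_eq_iff forall_3 forall_2)

lemma bounded_linear_join: "bounded_linear (\<lambda>x. join (fst x) (snd x))"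
  by (intro linear_conv_bounded_linear[THEN iffD1] linearI) (simp_all add: vec_eq_iff forall_3)

lemma continuous_on_join:
  "continuous_on S f \<Longrightarrow> continuous_on S g \<Longrightarrow> continuous_on S (\<lambda>x. join (f x) (g x))"
  using bounded_linear.continuous_on[OF bounded_linear_join continuous_on_Pair[of S f g]] by simp

lemma bounded_bilinear_scale: "bounded_bilinear (\<lambda>(c :: complex) (v :: complex ^ 2). c *s v)"
  by (intro bilinear_conv_bounded_bilinear[THEN iffD1])
    (auto simp: bilinear_def vec_eq_iff algebra_simps intro!: linearI)

lemmas continuous_on_scale = bounded_bilinear.continuous_on[OF bounded_bilinear_scale]

lemma closed_condition_coordinate:
  fixes F :: "'a::topological_space \<Rightarrow> complex ^ 'n \<Rightarrow> 'b::{t1_space,zero}"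
  assumes "continuous_on UNIV (\<lambda>(a, v). F a v)"
    and "\<And>a v c. c \<noteq> 0 \<Longrightarrow> F a (c *s v) = 0 \<longleftrightarrow> F a v = 0"
  shows "closed {x :: 'a \<times> ('i \<Rightarrow> 'n cproj). F (fst x) (crep (snd x i)) = 0}"
proof -
  have "continuous_on UNIV (\<lambda>x :: 'a \<times> ('i \<Rightarrow> 'n cproj). snd x i)"
    by (rule continuous_on_product_then_coordinatewise[OF continuous_on_snd[OF continuous_on_id]])
  then have c: "continuous_on UNIV (\<lambda>x :: 'a \<times> ('i \<Rightarrow> 'n cproj). (fst x, snd x i))"
    by (rule continuous_on_Pair[OF continuous_on_fst[OF continuous_on_id]])
  have "closed ((\<lambda>x :: 'a \<times> ('i \<Rightarrow> 'n cproj). (fst x, snd x i)) -` {(a, p). F a (crep p) = 0})"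
    by (rule closed_vimage[OF closed_Collect_crep_eq[OF assms] c])
  then show ?thesis by (simp add: vimage_def)
qed

lemma closed_minors:
  fixes g :: "'a::topological_space \<Rightarrow> complex ^ 'n::finite"
  assumes "continuous_on UNIV g"
  shows "closed {x :: 'a \<times> ('i \<Rightarrow> 'n cproj).
    \<forall>j k. crep (snd x i) $ j * g (fst x) $ k = crep (snd x i) $ k * g (fst x) $ j}"
proof -
  have "closed {x :: 'a \<times> ('i \<Rightarrow> 'n cproj).
    crep (snd x i) $ j * g (fst x) $ k - crep (snd x i) $ k * g (fst x) $ j = 0}" for j k
  proof (rule closed_condition_coordinate[where F = "\<lambda>a v. v $ j * g a $ k - v $ k * g a $ j"])
    have "continuous_on UNIV (\<lambda>x :: 'a \<times> (complex ^ 'n). g (fst x))"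
      using continuous_on_compose2[OF assms continuous_on_fst[OF continuous_on_id]] by auto
    then show "continuous_on UNIV (\<lambda>(a, v). v $ j * g a $ k - v $ k * g a $ j)"
      unfolding case_prod_unfold by (intro continuous_intros)
    fix a and v :: "complex ^ 'n" and c :: complex assume "c \<noteq> 0"
    have "(c *s v) $ j * g a $ k - (c *s v) $ k * g a $ j = c * (v $ j * g a $ k - v $ k * g a $ j)"
      by (simp add: algebra_simps)
    then show "(c *s v) $ j * g a $ k - (c *s v) $ k * g a $ j = 0
      \<longleftrightarrow> v $ j * g a $ k - v $ k * g a $ j = 0" using \<open>c \<noteq> 0\<close> by simp
  qed
  then have "closed (\<Inter>j. \<Inter>k. {x :: 'a \<times> ('i \<Rightarrow> 'n cproj).
    crep (snd x i) $ j * g (fst x) $ k - crep (snd x i) $ k * g (fst x) $ j = 0})"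
    by (intro closed_INT ballI)
  also have "(\<Inter>j. \<Inter>k. {x :: 'a \<times> ('i \<Rightarrow> 'n cproj).
    crep (snd x i) $ j * g (fst x) $ k - crep (snd x i) $ k * g (fst x) $ j = 0}) =
    {x. \<forall>j k. crep (snd x i) $ j * g (fst x) $ k = crep (snd x i) $ k * g (fst x) $ j}"
    by auto
  finally show ?thesis .
qed

lemma closed_snd_coord_eq:
  "closed {x :: 'a::topological_space \<times> ('i \<Rightarrow> 'n::finite cproj). snd x i = q}"
proof -
  have "closed (snd -` {p :: 'i \<Rightarrow> 'n cproj. p i = q} :: ('a \<times> _) set)"
    by (rule closed_vimage[OF closed_cproj_eq_coord continuous_on_snd[OF continuous_on_id]])
  then show ?thesis by (simp add: vimage_def)
qed

text \<open>The spaces in question are not metrized, so limits are taken along curves instead of sequences.\<close>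

lemma curve_end_in_closure:
  fixes \<phi> :: "real \<Rightarrow> 'a::topological_space"
  assumes "0 < \<delta>" "continuous_on {0..\<delta>} \<phi>" "\<And>r. 0 < r \<Longrightarrow> r \<le> \<delta> \<Longrightarrow> \<phi> r \<in> G"
  shows "\<phi> 0 \<in> closure G"
proof -
  have cl: "closure {0<..\<delta>} = {0..\<delta>}" using assms(1) by (rule closure_greaterThanAtMost)
  have "\<phi> ` closure {0<..\<delta>} \<subseteq> closure G"
    using assms closure_subset[of G] unfolding cl[symmetric]
    by (intro image_closure_subset) auto
  then show ?thesis using assms(1) unfolding cl by auto
qed

lemma cpoint_plane_part:
  assumes "plane_part v \<noteq> 0"
  shows "cpoint (plane_part (crep (cpoint v))) = cpoint (plane_part v)"
proof -
  have "v \<noteq> 0" using assms by (auto simp: vec_eq_iff forall_2)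
  then obtain c where c: "c \<noteq> 0" "crep (cpoint v) = c *s v" by (rule crep_cpoint)
  show ?thesis unfolding c(2) plane_part_scale by (rule cpoint_scale[OF assms c(1)])
qed

context nodal_lines
begin

text \<open>Points of the resolution and of the blow-up that do not lie over a node.\<close>

definition xgraph :: "complex \<Rightarrow> complex ^ 2 \<Rightarrow> xpoint" where
  "xgraph \<omega> Q = ((\<omega>, Q), \<lambda>P\<in>N. cpoint (join \<omega> (Q - P)))"

definition ygraph :: "complex ^ 2 \<Rightarrow> ypoint" where
  "ygraph Q = (Q, \<lambda>P\<in>N. cpoint (Q - P))"

text \<open>The point \<open>[q]\<close> of the exceptional curve over the node \<open>P\<close>.\<close>

definition yexc :: "complex ^ 2 \<Rightarrow> complex ^ 2 \<Rightarrow> ypoint" where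
  "yexc P q = (P, \<lambda>P'\<in>N. if P' = P then cpoint q else cpoint (P - P'))"

definition xexc :: "complex ^ 2 \<Rightarrow> complex \<Rightarrow> complex ^ 2 \<Rightarrow> xpoint" where
  "xexc P w q = ((0, P), \<lambda>P'\<in>N. if P' = P then cpoint (join w q) else cpoint (join 0 (P - P')))"

lemma resolution_eq: "resolution \<A> lam = closure {xgraph \<omega> Q | \<omega> Q. \<omega>\<^sup>2 = arr_poly \<A> lam Q \<and> Q \<notin> N}"
  unfolding resolution_def xgraph_def double_plane_def by simp

lemma blowup_eq: "blowup \<A> lam = closure {ygraph Q | Q. Q \<notin> N}"
  unfolding blowup_def ygraph_def ..

lemma resolution_minimal:
  assumes "closed T" "\<And>\<omega> Q. \<omega>\<^sup>2 = arr_poly \<A> lam Q \<Longrightarrow> Q \<notin> N \<Longrightarrow> xgraph \<omega> Q \<in> T"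
    and "x \<in> resolution \<A> lam"
  shows "x \<in> T"
proof -
  have "{xgraph \<omega> Q | \<omega> Q. \<omega>\<^sup>2 = arr_poly \<A> lam Q \<and> Q \<notin> N} \<subseteq> T" using assms(2) by auto
  then have "resolution \<A> lam \<subseteq> T" unfolding resolution_eq using assms(1) by (rule closure_minimal)
  then show ?thesis using assms(3) by (rule subsetD)
qed

lemma continuous_on_arr_poly: "continuous_on S (arr_poly \<A> lam)"
  unfolding arr_poly_def by (intro continuous_intros)

lemma resolution_double_plane:
  assumes "x \<in> resolution \<A> lam"
  shows "(fst (fst x))\<^sup>2 = arr_poly \<A> lam (snd (fst x))"
proof -
  have c: "continuous_on UNIV (\<lambda>x :: xpoint. arr_poly \<A> lam (snd (fst x)))"
    by (rule continuous_on_compose2[OF continuous_on_arr_poly[of UNIV]])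
      (intro continuous_intros subset_UNIV)+
  have "x \<in> {x. (fst (fst x))\<^sup>2 = arr_poly \<A> lam (snd (fst x))}"
    by (rule resolution_minimal[OF _ _ assms])
      (use c in \<open>auto simp: xgraph_def intro!: closed_Collect_eq continuous_intros\<close>)
  then show ?thesis by simp
qed

lemma resolution_outside:
  assumes "x \<in> resolution \<A> lam" "P \<notin> N"
  shows "snd x P = undefined"
proof -
  have "x \<in> {x. snd x P = undefined}"
    by (rule resolution_minimal[OF closed_snd_coord_eq _ assms(1)])
      (use assms(2) in \<open>simp add: xgraph_def\<close>)
  then show ?thesis by simp
qed

text \<open>The map \<open>Q \<mapsto> [\<omega> : Q - P]\<close> is continuous away from \<open>P\<close>, so its values on the closure of the graph
  are forced there.\<close>

lemma resolution_coordinate: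
  assumes x: "x \<in> resolution \<A> lam" and P: "P \<in> N" "P \<noteq> snd (fst x)"
  shows "snd x P = cpoint (join (fst (fst x)) (snd (fst x) - P))"
proof -
  let ?g = "\<lambda>y :: complex \<times> (complex ^ 2). join (fst y) (snd y - P)"
  let ?T = "{x. \<forall>j k. crep (snd x P) $ j * ?g (fst x) $ k = crep (snd x P) $ k * ?g (fst x) $ j}"
  have "continuous_on UNIV ?g" by (intro continuous_on_join continuous_intros)
  then have "closed ?T" by (rule closed_minors)
  moreover have "xgraph \<omega> Q \<in> ?T" if "Q \<notin> N" for \<omega> Q
  proof -
    have "join \<omega> (Q - P) \<noteq> 0" using that P by (auto simp: join_eq_0_iff)
    then show ?thesis using minors_cpoint[of "join \<omega> (Q - P)"] P unfolding xgraph_def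
      by (auto simp only: fst_conv snd_conv restrict_apply' mem_Collect_eq)
  qed
  ultimately have "x \<in> ?T" by (rule resolution_minimal[OF _ _ x])
  moreover have "join (fst (fst x)) (snd (fst x) - P) \<noteq> 0" using P by (auto simp: join_eq_0_iff)
  ultimately show ?thesis by (intro cpoint_eqI_minors) simp_all
qed

lemma resolution_off_nodes:
  assumes x: "x \<in> resolution \<A> lam" and Q: "snd (fst x) \<notin> N"
  shows "x = xgraph (fst (fst x)) (snd (fst x))"
proof -
  have "snd x = (\<lambda>P\<in>N. cpoint (join (fst (fst x)) (snd (fst x) - P)))"
  proof
    fix P show "snd x P = (\<lambda>P\<in>N. cpoint (join (fst (fst x)) (snd (fst x) - P))) P"
      using resolution_outside[OF x, of P] resolution_coordinate[OF x, of P] Q by auto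
  qed
  then show ?thesis unfolding xgraph_def by (metis prod.collapse)
qed

lemma xgraph_in_resolution:
  "\<omega>\<^sup>2 = arr_poly \<A> lam Q \<Longrightarrow> Q \<notin> N \<Longrightarrow> xgraph \<omega> Q \<in> resolution \<A> lam"
  unfolding resolution_eq by (rule subsetD[OF closure_subset]) auto

lemma yclosure_minimal:
  assumes "closed T" "\<And>Q. Q \<in> S \<Longrightarrow> Q \<notin> N \<Longrightarrow> ygraph Q \<in> T"
    and "y \<in> closure {ygraph Q | Q. Q \<in> S \<and> Q \<notin> N}"
  shows "y \<in> T"
proof -
  have "{ygraph Q | Q. Q \<in> S \<and> Q \<notin> N} \<subseteq> T" using assms(2) by auto
  then have "closure {ygraph Q | Q. Q \<in> S \<and> Q \<notin> N} \<subseteq> T" using assms(1) by (rule closure_minimal)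
  then show ?thesis using assms(3) by (rule subsetD)
qed

lemma yclosure_off_nodes:
  assumes y: "y \<in> closure {ygraph Q | Q. Q \<in> S \<and> Q \<notin> N}" and Q: "fst y \<notin> N"
  shows "y = ygraph (fst y)"
proof -
  have "snd y P = (\<lambda>P\<in>N. cpoint (fst y - P)) P" for P
  proof (cases "P \<in> N")
    case True
    let ?g = "\<lambda>Q :: complex ^ 2. Q - P"
    let ?T = "{x. \<forall>j k. crep (snd x P) $ j * ?g (fst x) $ k = crep (snd x P) $ k * ?g (fst x) $ j}"
    have "continuous_on UNIV ?g" by (intro continuous_intros)
    then have "closed ?T" by (rule closed_minors)
    moreover have "ygraph Q \<in> ?T" if "Q \<notin> N" for Q
    proof -
      have "Q - P \<noteq> 0" using that True by auto
      then show ?thesis using minors_cpoint[of "Q - P"] True unfolding ygraph_def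
        by (auto simp only: fst_conv snd_conv restrict_apply' mem_Collect_eq)
    qed
    ultimately have "y \<in> ?T" by (rule yclosure_minimal[OF _ _ y])
    moreover have "fst y - P \<noteq> 0" using True Q by auto
    ultimately have "snd y P = cpoint (fst y - P)" by (intro cpoint_eqI_minors) simp_all
    then show ?thesis using True by simp
  next
    case False
    have "y \<in> {y. snd y P = undefined}"
      by (rule yclosure_minimal[OF closed_snd_coord_eq _ y]) (use False in \<open>simp add: ygraph_def\<close>)
    then show ?thesis using False by simp
  qed
  then show ?thesis unfolding ygraph_def by (metis ext prod.collapse)
qed

lemma eventually_off_nodes:
  assumes "q \<noteq> 0"
  shows "\<forall>\<^sub>F r in at_right 0. P + of_real r *s q \<notin> N"
proof -
  have "\<forall>\<^sub>F r in at_right 0. P + of_real r *s q \<noteq> R" if "R \<in> N" for R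
  proof (cases "\<exists>r :: real. P + of_real r *s q = R")
    case True
    then obtain r0 :: real where r0: "P + of_real r0 *s q = R" by blast
    have "r = r0" if "P + of_real r *s q = R" for r :: real
    proof -
      have "of_real r *s q = of_real r0 *s q" using r0 that by (metis add_left_cancel)
      moreover obtain i where "q $ i \<noteq> 0" using assms by (auto simp: vec_eq_iff)
      ultimately show ?thesis by (metis mult_right_cancel of_real_eq_iff vector_smult_component)
    qed
    moreover have "\<forall>\<^sub>F r in at_right 0. r \<noteq> r0" by (rule eventually_neq_at_within)
    ultimately show ?thesis by (auto elim: eventually_mono)
  qed auto
  then have "\<forall>\<^sub>F r in at_right 0. \<forall>R\<in>N. P + of_real r *s q \<noteq> R"
    using finite_nodes by (simp add: eventually_ball_finite)
  then show ?thesis by (rule eventually_mono) blast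
qed

text \<open>Approach the node along the line in the direction \<open>q\<close>.\<close>

lemma yexc_in_closure:
  assumes P: "P \<in> N" and q: "q \<noteq> 0" and S: "\<forall>\<^sub>F r in at_right 0. P + of_real r *s q \<in> S"
  shows "yexc P q \<in> closure {ygraph Q | Q. Q \<in> S \<and> Q \<notin> N}"
proof -
  have "\<forall>\<^sub>F r in at_right 0. P + of_real r *s q \<in> S \<and> P + of_real r *s q \<notin> N"
    using S eventually_off_nodes[OF q] by (rule eventually_conj)
  then obtain \<delta>' where d': "0 < \<delta>'"
    "\<And>r :: real. 0 < r \<Longrightarrow> r < \<delta>' \<Longrightarrow> P + of_real r *s q \<in> S \<and> P + of_real r *s q \<notin> N"
    unfolding eventually_at_right_field by blast
  define \<delta> where "\<delta> = \<delta>' / 2"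
  define \<phi> :: "real \<Rightarrow> ypoint" where "\<phi> r = (P + of_real r *s q,
    \<lambda>P'\<in>N. if P' = P then cpoint q else cpoint (P + of_real r *s q - P'))" for r
  have r: "P + of_real r *s q \<in> S" "P + of_real r *s q \<notin> N" if "0 < r" "r \<le> \<delta>" for r
    using d' that by (auto simp: \<delta>_def)
  have lin: "continuous_on {0..\<delta>} (\<lambda>r :: real. P + of_real r *s q)"
    by (intro continuous_intros continuous_on_scale)
  have "\<phi> 0 \<in> closure {ygraph Q | Q. Q \<in> S \<and> Q \<notin> N}"
  proof (rule curve_end_in_closure)
    show "0 < \<delta>" using d' by (simp add: \<delta>_def)
    show "continuous_on {0..\<delta>} \<phi>" unfolding \<phi>_def
    proof (intro continuous_on_Pair lin continuous_on_coordinatewise_then_product)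
      fix P'
      have nz: "P + of_real r *s q - P' \<noteq> 0" if "P' \<in> N" "P' \<noteq> P" "r \<in> {0..\<delta>}" for r
        using r[of r] that by (cases "r = 0") auto
      show "continuous_on {0..\<delta>} (\<lambda>x. (\<lambda>P'\<in>N. if P' = P then cpoint q
        else cpoint (P + of_real x *s q - P')) P')"
      proof (cases "P' \<in> N \<and> P' \<noteq> P")
        case True
        have "continuous_on {0..\<delta>} (\<lambda>r :: real. P + of_real r *s q - P')"
          by (intro continuous_on_diff lin continuous_on_const)
        then have "continuous_on {0..\<delta>} (\<lambda>r :: real. cpoint (P + of_real r *s q - P'))"
          using nz True by (intro continuous_on_cpoint) blast+
        then show ?thesis using True by simp
      next
        case False
        then show ?thesis by (cases "P' \<in> N") (simp_all add: continuous_on_const)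
      qed
    qed
    fix r :: real assume r0: "0 < r" "r \<le> \<delta>"
    have "cpoint (of_real r *s q) = cpoint q" using r0 q by (intro cpoint_scale) auto
    then have "\<phi> r = ygraph (P + of_real r *s q)"
      unfolding \<phi>_def ygraph_def by (auto intro!: restrict_ext)
    then show "\<phi> r \<in> {ygraph Q | Q. Q \<in> S \<and> Q \<notin> N}" using r[OF r0] by blast
  qed
  moreover have "\<phi> 0 = yexc P q" unfolding \<phi>_def yexc_def by (auto intro!: restrict_ext)
  ultimately show ?thesis by simp
qed

lemma double_cover_xgraph:
  assumes "Q \<notin> N"
  shows "double_cover \<A> lam (xgraph \<omega> Q) = ygraph Q"
proof -
  have "cpoint (plane_part (crep (cpoint (join \<omega> (Q - P))))) = cpoint (Q - P)" if "P \<in> N" for P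
  proof -
    have "Q - P \<noteq> 0" using assms that by auto
    then show ?thesis using cpoint_plane_part[of "join \<omega> (Q - P)"] by simp
  qed
  then show ?thesis
    unfolding double_cover_def xgraph_def ygraph_def by (auto intro!: restrict_ext)
qed

lemma double_cover_xexc:
  assumes "q \<noteq> 0"
  shows "double_cover \<A> lam (xexc P w q) = yexc P q"
proof -
  have "cpoint (plane_part (crep (cpoint (join w v)))) = cpoint v" if "v \<noteq> 0" for w v
    using that cpoint_plane_part[of "join w v"] by simp
  then show ?thesis using assms
    unfolding double_cover_def xexc_def yexc_def by (auto intro!: restrict_ext)
qed

lemma strict_transform_eq:
  "strict_transform \<A> lam S = closure {ygraph Q | Q. Q \<in> S \<and> Q \<notin> N}"
proof -
  have b: "blowup \<A> lam = closure {ygraph Q | Q. Q \<in> UNIV \<and> Q \<notin> N}" by (simp add: blowup_eq)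
  have "{y \<in> blowup \<A> lam. blowdown y \<in> S - S \<inter> N} = {ygraph Q | Q. Q \<in> S \<and> Q \<notin> N}"
  proof (intro equalityI subsetI)
    fix y assume y: "y \<in> {y \<in> blowup \<A> lam. blowdown y \<in> S - S \<inter> N}"
    then have "y = ygraph (fst y)"
      using yclosure_off_nodes[of y UNIV] unfolding b blowdown_def by blast
    then show "y \<in> {ygraph Q | Q. Q \<in> S \<and> Q \<notin> N}" using y by (auto simp: blowdown_def)
  next
    fix y assume "y \<in> {ygraph Q | Q. Q \<in> S \<and> Q \<notin> N}"
    then obtain Q where Q: "y = ygraph Q" "Q \<in> S" "Q \<notin> N" by blast
    then have "y \<in> blowup \<A> lam"
      unfolding blowup_eq by (intro subsetD[OF closure_subset]) auto
    then show "y \<in> {y \<in> blowup \<A> lam. blowdown y \<in> S - S \<inter> N}"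
      using Q by (simp add: blowdown_def ygraph_def)
  qed
  moreover have "closure {ygraph Q | Q. Q \<in> S \<and> Q \<notin> N} \<subseteq> blowup \<A> lam"
    unfolding blowup_eq by (intro closure_mono) blast
  ultimately show ?thesis unfolding strict_transform_def by auto
qed

lemma closed_complexify_chamber:
  assumes "has_signs C eps"
  shows "closed (complexify ` C)"
proof -
  have C: "C = {x. \<forall>l\<in>\<A>. 0 \<le> eps l * rv l x}" using assms unfolding has_signs_def by (elim conjE)
  have "complexify ` C = {Q. imag_part Q = 0} \<inter> (\<Inter>l\<in>\<A>. {Q. 0 \<le> eps l * rv l (real_part Q)})"
  proof (intro equalityI subsetI)
    fix Q assume "Q \<in> complexify ` C"
    then show "Q \<in> {Q. imag_part Q = 0} \<inter> (\<Inter>l\<in>\<A>. {Q. 0 \<le> eps l * rv l (real_part Q)})"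
      unfolding C by (auto simp: imag_part_def vec_eq_iff)
  next
    fix Q assume Q: "Q \<in> {Q. imag_part Q = 0} \<inter> (\<Inter>l\<in>\<A>. {Q. 0 \<le> eps l * rv l (real_part Q)})"
    then have "Q = complexify (real_part Q)" by (simp add: complexify_real_part)
    moreover have "real_part Q \<in> C" using Q unfolding C by simp
    ultimately show "Q \<in> complexify ` C" by (rule image_eqI)
  qed
  moreover have "closed {Q. imag_part Q = 0}"
    unfolding imag_part_def by (intro closed_Collect_eq continuous_intros continuous_on_vec_lambda)
  moreover have "closed {Q. 0 \<le> eps l * rv l (real_part Q)}" for l
    unfolding imag_part_def real_value_def real_part_def
    by (intro closed_Collect_le continuous_intros continuous_on_vec_lambda)
  ultimately show ?thesis by (auto intro!: closed_Int closed_INT)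
qed

text \<open>The projection of the strict transform stays in the chamber because the chamber is closed.\<close>

lemma strict_transform_fst:
  assumes "has_signs C eps" "y \<in> strict_transform \<A> lam (complexify ` C)"
  shows "fst y \<in> complexify ` C"
proof -
  have "closed (fst -` (complexify ` C) :: ypoint set)"
    by (rule closed_vimage[OF closed_complexify_chamber[OF assms(1)] continuous_on_fst[OF continuous_on_id]])
  then have "y \<in> fst -` (complexify ` C)"
    by (rule yclosure_minimal[OF _ _ assms(2)[unfolded strict_transform_eq]]) (simp add: ygraph_def)
  then show ?thesis by simp
qed

lemma double_cover_fst: "fst (double_cover \<A> lam x) = snd (fst x)"
  by (simp add: double_cover_def)

lemma lifted_chamber_fst:
  assumes "has_signs C eps" "x \<in> lifted_chamber \<A> lam C"
  shows "snd (fst x) \<in> complexify ` C"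
proof -
  have "fst (double_cover \<A> lam x) \<in> complexify ` C"
    using assms(2) unfolding lifted_chamber_def by (intro strict_transform_fst[OF assms(1)]) simp
  then show ?thesis by (simp add: double_cover_fst)
qed

lemma xgraph_in_lifted_chamber:
  assumes "Q \<in> complexify ` C" "Q \<notin> N" "\<omega>\<^sup>2 = arr_poly \<A> lam Q"
  shows "xgraph \<omega> Q \<in> lifted_chamber \<A> lam C"
proof -
  have "ygraph Q \<in> strict_transform \<A> lam (complexify ` C)"
    unfolding strict_transform_eq using assms by (intro subsetD[OF closure_subset]) auto
  then show ?thesis
    using xgraph_in_resolution[OF assms(3,2)] double_cover_xgraph[OF assms(2)]
    unfolding lifted_chamber_def by simp
qed

end

section \<open>Adapted coordinates at a corner of a chamber\<close>

lemma real_of_square_nonneg: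
  fixes c :: complex
  assumes "Im (c\<^sup>2) = 0" "0 \<le> Re (c\<^sup>2)"
  shows "Im c = 0"
proof -
  have "Re c * Im c = 0" "Im c * Im c \<le> Re c * Re c"
    using assms by (auto simp: power2_eq_square)
  then show ?thesis by (cases "Re c = 0") (auto simp: mult_le_0_iff)
qed

locale nodal_corner = nodal_lines +
  fixes C :: "(real ^ 2) set" and eps :: "(real ^ 2) set \<Rightarrow> real" and l m :: "(real ^ 2) set"
    and P :: "real ^ 2"
  assumes signs: "has_signs C eps" and corner: "corner C l m P"
begin

abbreviation cP :: "complex ^ 2" where "cP \<equiv> complexify P"

text \<open>The linear parts of the normalized functions \<open>u\<close> and \<open>v\<close>, which are nonnegative on the chamber.\<close>

definition a :: "real ^ 2" where "a = eps l *\<^sub>R nv l"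
definition b :: "real ^ 2" where "b = eps m *\<^sub>R nv m"

text \<open>The basis dual to \<open>(a, b)\<close>: \<open>P + u *\<^sub>R eu + v *\<^sub>R ev\<close> is the point with coordinates \<open>u\<close> and \<open>v\<close>.\<close>

definition eu :: "real ^ 2" where "eu = (1 / det2 a b) *\<^sub>R (- perp b)"
definition ev :: "real ^ 2" where "ev = (1 / det2 a b) *\<^sub>R perp a"

text \<open>The sign of the area form \<open>du \<and> dv\<close> with respect to \<open>dx\<^sub>1 \<and> dx\<^sub>2\<close>.\<close>

definition \<sigma> :: real where "\<sigma> = sgn (det2 a b)"

abbreviation U :: "complex ^ 2 \<Rightarrow> complex" where "U q \<equiv> complex_linear_part a q"
abbreviation V :: "complex ^ 2 \<Rightarrow> complex" where "V q \<equiv> complex_linear_part b q"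
abbreviation Eu :: "complex ^ 2" where "Eu \<equiv> complexify eu"
abbreviation Ev :: "complex ^ 2" where "Ev \<equiv> complexify ev"

definition h :: "real ^ 2 \<Rightarrow> real" where "h x = (\<Prod>k\<in>\<A> - {l, m}. eps k * rv k x)"
definition H :: "complex ^ 2 \<Rightarrow> complex" where "H Q = (\<Prod>k\<in>\<A> - {l, m}. of_real (eps k) * cv k Q)"

text \<open>The sign of \<open>f\<close> on the chamber.\<close>

definition \<eta> :: real where "\<eta> = (\<Prod>k\<in>\<A>. eps k)"

text \<open>On the chamber, \<open>\<omega> = \<kappa>0 * y\<close> for a real \<open>y\<close>.\<close>

definition \<kappa>0 :: complex where "\<kappa>0 = csqrt (of_real \<eta>)"
definition \<kappa> :: complex where "\<kappa> = \<kappa>0 * of_real (sqrt (h P))"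

lemma C_eq: "C = {x. \<forall>l\<in>\<A>. 0 \<le> eps l * rv l x}"
  using signs unfolding has_signs_def by (elim conjE)

lemma eps_cases: "eps k = 1 \<or> eps k = -1"
  using signs unfolding has_signs_def by (elim conjE) (erule spec)

lemma eps_sq: "eps k * eps k = 1"
  using eps_cases[of k] by auto

lemma eps_nonzero: "eps k \<noteq> 0"
  using eps_cases[of k] by auto

lemma corner_lines: "l \<in> \<A>" "m \<in> \<A>" "l \<noteq> m" "P \<in> l" "P \<in> m" "P \<in> C"
  using corner unfolding corner_def by blast+

lemma P_node: "cP \<in> N"
  using corner_lines unfolding complexify_mem_nodes_iff by blast

lemma rv_P: "rv l P = 0" "rv m P = 0"
  using corner_lines mem_line_iff by auto

lemma det_nonzero: "det2 a b \<noteq> 0"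
proof -
  have "det2 a b = eps l * eps m * det2 (nv l) (nv m)"
    by (simp add: det2_def a_def b_def algebra_simps)
  then show ?thesis
    using det_normals_nonzero[OF corner_lines(1-5)] eps_nonzero by simp
qed

lemma sigma_cases: "\<sigma> = 1 \<or> \<sigma> = -1"
  using det_nonzero unfolding \<sigma>_def by (simp add: sgn_real_def)

lemma sigma_sq: "\<sigma> * \<sigma> = 1"
  using sigma_cases by auto

lemma sigma_det: "0 < \<sigma> * det2 a b"
  using det_nonzero unfolding \<sigma>_def by (simp add: sgn_real_def)

lemma dual_basis: "a \<bullet> eu = 1" "a \<bullet> ev = 0" "b \<bullet> eu = 0" "b \<bullet> ev = 1"
proof -
  have "det2 b a = - det2 a b" "det2 a a = 0" "det2 b b = 0" by (simp_all add: det2_def)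
  then show "a \<bullet> eu = 1" "a \<bullet> ev = 0" "b \<bullet> eu = 0" "b \<bullet> ev = 1"
    using det_nonzero by (simp_all add: eu_def ev_def inner_perp)
qed

lemma det_dual_basis: "det2 eu ev = 1 / det2 a b"
proof -
  have "det2 (r *\<^sub>R x) (r *\<^sub>R y) = r * r * det2 x y" for r x y
    by (simp add: det2_def algebra_simps)
  moreover have "det2 (- perp b) (perp a) = det2 a b" by (simp add: det2_def algebra_simps)
  ultimately have "det2 eu ev = (1 / det2 a b) * (1 / det2 a b) * det2 a b"
    unfolding eu_def ev_def by (simp only:)
  then show ?thesis using det_nonzero by simp
qed

lemma UV_basis [simp]: "U Eu = 1" "U Ev = 0" "V Eu = 0" "V Ev = 1"
  by (simp_all add: complex_linear_part_complexify dual_basis)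

lemma UV_comb [simp]: "U (c *s Eu + d *s Ev) = c" "V (c *s Eu + d *s Ev) = d"
  by (simp_all add: complex_linear_part_add complex_linear_part_scale)

lemma UV_zero: "U q = 0 \<Longrightarrow> V q = 0 \<Longrightarrow> q = 0"
proof -
  assume 0: "U q = 0" "V q = 0"
  have "of_real (det2 a b) * q $ 1 = of_real (b $ 2) * U q - of_real (a $ 2) * V q"
    "of_real (det2 a b) * q $ 2 = of_real (a $ 1) * V q - of_real (b $ 1) * U q"
    by (simp_all add: det2_def complex_linear_part_def algebra_simps)
  then show "q = 0" using 0 det_nonzero by (simp add: vec_eq_iff forall_2)
qed

lemma decompose: "q = U q *s Eu + V q *s Ev"
proof -
  have "q - (U q *s Eu + V q *s Ev) = 0"
    by (rule UV_zero) (simp_all add: complex_linear_part_diff)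
  then show ?thesis by simp
qed

lemma rv_l: "eps l * rv l x = a \<bullet> (x - P)" and rv_m: "eps m * rv m x = b \<bullet> (x - P)"
  using rv_P unfolding real_value_def a_def b_def
  by (simp_all add: inner_diff_right algebra_simps)
    (metis add.inverse_inverse add_eq_0_iff mult_minus_right)+

lemma cv_l: "of_real (eps l) * cv l Q = U (Q - cP)" and cv_m: "of_real (eps m) * cv m Q = V (Q - cP)"
proof -
  have "cv l cP = 0" "cv m cP = 0" using rv_P by (simp_all add: complex_value_complexify)
  then have "cv l Q = complex_linear_part (nv l) (Q - cP)" "cv m Q = complex_linear_part (nv m) (Q - cP)"
    using complex_value_diff[of "lam l" Q cP] complex_value_diff[of "lam m" Q cP] by simp_all
  then show "of_real (eps l) * cv l Q = U (Q - cP)" "of_real (eps m) * cv m Q = V (Q - cP)"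
    by (simp_all add: a_def b_def complex_linear_part_scaleR)
qed

lemma eta_cases: "\<eta> = 1 \<or> \<eta> = -1"
proof -
  have "(\<Prod>k\<in>K. eps k) = 1 \<or> (\<Prod>k\<in>K. eps k) = -1" for K
    by (induction K rule: infinite_finite_induct) (use eps_cases in force)+
  then show ?thesis unfolding \<eta>_def by blast
qed

lemma kappa0_sq: "\<kappa>0\<^sup>2 = of_real \<eta>" and kappa0_nonzero: "\<kappa>0 \<noteq> 0"
  using eta_cases unfolding \<kappa>0_def by (auto simp: csqrt_eq_0)

lemma split_lines: "\<A> = insert l (insert m (\<A> - {l, m}))"
  using corner_lines by blast

lemma prod_lines: "(\<Prod>k\<in>\<A>. g k) = g l * (g m * (\<Prod>k\<in>\<A> - {l, m}. g k))" for g :: "_ \<Rightarrow> 'z::comm_monoid_mult"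
  using finite_lines corner_lines by (subst split_lines) simp

text \<open>In the normalized functions \<open>f\<close> becomes \<open>\<eta> u v h\<close>, with all sign changes collected in \<open>\<eta>\<close>.\<close>

lemma arr_poly_eq: "arr_poly \<A> lam Q = of_real \<eta> * (U (Q - cP) * V (Q - cP) * H Q)"
proof -
  have "arr_poly \<A> lam Q = (\<Prod>k\<in>\<A>. of_real (eps k) * (of_real (eps k) * cv k Q))"
    unfolding arr_poly_def
  proof (rule prod.cong[OF refl])
    fix k
    have "of_real (eps k) * (of_real (eps k) * cv k Q) = of_real (eps k * eps k) * cv k Q"
      by (simp add: mult.assoc)
    then show "cv k Q = of_real (eps k) * (of_real (eps k) * cv k Q)" by (simp add: eps_sq)
  qed
  also have "\<dots> = of_real \<eta> * (\<Prod>k\<in>\<A>. of_real (eps k) * cv k Q)"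
    by (simp add: prod.distrib \<eta>_def)
  also have "(\<Prod>k\<in>\<A>. of_real (eps k) * cv k Q) = U (Q - cP) * V (Q - cP) * H Q"
    by (subst prod_lines) (simp add: cv_l cv_m H_def)
  finally show ?thesis .
qed

lemma H_complexify: "H (complexify x) = of_real (h x)"
  by (simp add: H_def h_def complex_value_complexify)

lemma arr_poly_complexify:
  "arr_poly \<A> lam (complexify x) = of_real (\<eta> * (a \<bullet> (x - P) * (b \<bullet> (x - P)) * h x))"
  by (simp add: arr_poly_eq H_complexify complexify_diff[symmetric] complex_linear_part_complexify)

lemma hP_pos: "0 < h P"
  unfolding h_def using corner_others_positive[OF signs corner] by (intro prod_pos) auto

lemma kappa_sq: "\<kappa>\<^sup>2 = of_real (\<eta> * h P)" and kappa_nonzero: "\<kappa> \<noteq> 0"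
  using kappa0_sq kappa0_nonzero hP_pos unfolding \<kappa>_def
  by (simp_all add: power_mult_distrib of_real_power[symmetric] del: of_real_power)

lemma continuous_on_H: "continuous_on S H"
  unfolding H_def by (intro continuous_intros)

section \<open>The exceptional conic\<close>

definition dir :: "complex \<Rightarrow> complex \<Rightarrow> complex ^ 2" where
  "dir s t = s\<^sup>2 *s Eu + t\<^sup>2 *s Ev"

text \<open>The conic \<open>w\<^sup>2 = \<kappa>\<^sup>2 U V\<close> in homogeneous parameters \<open>(s : t)\<close>. They treat both lines alike, so that
  exchanging the lines exchanges \<open>s\<close> and \<open>t\<close>.\<close>

definition E :: "complex \<Rightarrow> complex \<Rightarrow> xpoint" where
  "E s t = xexc cP (\<kappa> * s * t) (dir s t)"

lemma UV_dir [simp]: "U (dir s t) = s\<^sup>2" "V (dir s t) = t\<^sup>2"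
  by (simp_all add: dir_def)

lemma dir_eq_0_iff: "dir s t = 0 \<longleftrightarrow> s = 0 \<and> t = 0"
proof
  assume "dir s t = 0"
  then have "U (dir s t) = 0" "V (dir s t) = 0" by (simp_all add: complex_linear_part_def)
  then show "s = 0 \<and> t = 0" by simp
qed (simp add: dir_def)

lemma E_scale: "c \<noteq> 0 \<Longrightarrow> (s, t) \<noteq> (0, 0) \<Longrightarrow> E (c * s) (c * t) = E s t"
proof -
  assume c: "c \<noteq> 0" and st: "(s, t) \<noteq> (0, 0)"
  have "join (\<kappa> * (c * s) * (c * t)) (dir (c * s) (c * t)) = c\<^sup>2 *s join (\<kappa> * s * t) (dir s t)"
    unfolding join_scale[symmetric]
    by (simp add: dir_def vec_eq_iff forall_3 power_mult_distrib algebra_simps power2_eq_square)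
  moreover have "join (\<kappa> * s * t) (dir s t) \<noteq> 0" using st by (auto simp: join_eq_0_iff dir_eq_0_iff)
  ultimately have "cpoint (join (\<kappa> * (c * s) * (c * t)) (dir (c * s) (c * t))) = cpoint (join (\<kappa> * s * t) (dir s t))"
    using c by (simp add: cpoint_scale)
  then show ?thesis unfolding E_def xexc_def by (simp only:)
qed

lemma E_fst: "fst (E s t) = (0, cP)"
  by (simp add: E_def xexc_def)

lemma E_coordinate: "snd (E s t) cP = cpoint (join (\<kappa> * s * t) (dir s t))"
  using P_node by (simp add: E_def xexc_def)

text \<open>The equation \<open>w\<^sup>2 = \<kappa>\<^sup>2 U V\<close> of the conic extends to a closed condition on the resolution.\<close>

lemma conic_equation:
  assumes x: "x \<in> resolution \<A> lam"
  defines "p \<equiv> crep (snd x cP)"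
  shows "(p $ 1)\<^sup>2 = of_real \<eta> * (U (plane_part p) * V (plane_part p) * H (snd (fst x)))"
proof -
  define F where "F = (\<lambda>(y :: complex \<times> (complex ^ 2)) (p :: complex ^ 3).
    (p $ 1)\<^sup>2 - of_real \<eta> * (U (plane_part p) * V (plane_part p) * H (snd y)))"
  have F_scale: "F y (c *s p) = c\<^sup>2 * F y p" for y c p
    unfolding F_def plane_part_scale complex_linear_part_scale
    by (simp add: power2_eq_square algebra_simps)
  have "closed {x :: xpoint. F (fst x) (crep (snd x cP)) = 0}"
  proof (rule closed_condition_coordinate)
    have "continuous_on UNIV (\<lambda>x :: (complex \<times> (complex ^ 2)) \<times> (complex ^ 3). H (snd (fst x)))"
      by (rule continuous_on_compose2[OF continuous_on_H[of UNIV]]) (intro continuous_intros subset_UNIV)+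
    then show "continuous_on UNIV (\<lambda>(y, p). F y p)"
      unfolding F_def case_prod_unfold complex_linear_part_def plane_part_nth
      by (intro continuous_intros)
  qed (simp add: F_scale)
  then have "x \<in> {x :: xpoint. F (fst x) (crep (snd x cP)) = 0}"
  proof (rule resolution_minimal[OF _ _ x])
    fix \<omega> Q assume Q: "\<omega>\<^sup>2 = arr_poly \<A> lam Q" "Q \<notin> N"
    have "join \<omega> (Q - cP) \<noteq> 0" using Q P_node by (auto simp: join_eq_0_iff)
    then obtain c where c: "crep (cpoint (join \<omega> (Q - cP))) = c *s join \<omega> (Q - cP)"
      using crep_cpoint by metis
    have "F (\<omega>, Q) (join \<omega> (Q - cP)) = 0"
      using Q(1) by (simp add: F_def arr_poly_eq)
    then show "xgraph \<omega> Q \<in> {x :: xpoint. F (fst x) (crep (snd x cP)) = 0}"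
      using P_node c by (simp add: xgraph_def F_scale)
  qed
  then show ?thesis by (simp add: F_def p_def)
qed

text \<open>On the conic \<open>t\<close> is a square root of \<open>V\<close> and \<open>s\<close> is \<open>w / (\<kappa> t)\<close>, unless \<open>V = 0\<close>.\<close>

lemma resolution_over_P:
  assumes x: "x \<in> resolution \<A> lam" and P: "snd (fst x) = cP"
  obtains s t where "(s, t) \<noteq> (0, 0)" "x = E s t"
proof -
  define p where "p = crep (snd x cP)"
  define q where "q = plane_part p"
  have H: "H (snd (fst x)) = of_real (h P)" using P H_complexify by simp
  have w: "(p $ 1)\<^sup>2 = \<kappa>\<^sup>2 * (U q * V q)"
    using conic_equation[OF x] unfolding p_def q_def H kappa_sq by (simp add: algebra_simps)
  have "\<exists>s t. s\<^sup>2 = U q \<and> t\<^sup>2 = V q \<and> p $ 1 = \<kappa> * s * t"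
  proof (cases "V q = 0")
    case True
    then have "p $ 1 = 0" using w by simp
    then show ?thesis using True by (intro exI[of _ "csqrt (U q)"] exI[of _ 0]) simp
  next
    case False
    define t where "t = csqrt (V q)"
    define s where "s = p $ 1 / (\<kappa> * t)"
    have t: "t\<^sup>2 = V q" "t \<noteq> 0" using False by (auto simp: t_def)
    have "s\<^sup>2 = U q" using w t kappa_nonzero False by (simp add: s_def power_divide power_mult_distrib)
    moreover have "p $ 1 = \<kappa> * s * t" using t kappa_nonzero by (simp add: s_def)
    ultimately show ?thesis using t by blast
  qed
  then obtain s t where st: "s\<^sup>2 = U q" "t\<^sup>2 = V q" "p $ 1 = \<kappa> * s * t" by blast
  have "q = dir s t" unfolding dir_def st(1,2) by (rule decompose)
  then have p: "p = join (\<kappa> * s * t) (dir s t)" using st(3) join_collapse[of p] unfolding q_def by simp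
  then have "join (\<kappa> * s * t) (dir s t) \<noteq> 0" using crep_nonzero unfolding p_def by metis
  then have nz: "(s, t) \<noteq> (0, 0)" by (auto simp: join_eq_0_iff dir_eq_0_iff)
  have "fst (fst x) = 0"
    using resolution_double_plane[OF x] P arr_poly_complexify[of P] by simp
  then have f: "fst x = (0, cP)" using P by (metis prod.collapse)
  have pc: "snd x cP = cpoint (join (\<kappa> * s * t) (dir s t))"
    using cpoint_crep[of "snd x cP"] unfolding p_def[symmetric] p by simp
  have "snd x = (\<lambda>P'\<in>N. if P' = cP then cpoint (join (\<kappa> * s * t) (dir s t)) else cpoint (join 0 (cP - P')))"
  proof
    fix P'
    show "snd x P' = (\<lambda>P'\<in>N. if P' = cP then cpoint (join (\<kappa> * s * t) (dir s t))
      else cpoint (join 0 (cP - P'))) P'"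
      using resolution_outside[OF x, of P'] resolution_coordinate[OF x, of P'] f pc by auto
  qed
  then have "x = E s t" unfolding E_def xexc_def using f by (metis prod.collapse)
  then show ?thesis using that nz by blast
qed

text \<open>Approach the node along the line in the direction \<open>dir s t\<close> with
  \<open>\<omega> = r \<kappa> s t \<surd>(H Q / H P)\<close>. The quotient under the root tends to \<open>1\<close>, so the principal square root
  is continuous along the curve.\<close>

lemma E_in_resolution:
  assumes st: "(s, t) \<noteq> (0, 0)"
  shows "E s t \<in> resolution \<A> lam"
proof -
  let ?q = "dir s t"
  have q: "?q \<noteq> 0" using st by (auto simp: dir_eq_0_iff)
  define Q where "Q r = cP + of_real r *s ?q" for r :: real
  define g where "g r = H (Q r) / H cP" for r
  have HP: "H cP \<noteq> 0" using hP_pos by (simp add: H_complexify)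
  have contQ: "continuous_on S Q" for S unfolding Q_def
    by (intro continuous_intros continuous_on_scale)
  have contg: "continuous_on S g" for S unfolding g_def
    using HP by (intro continuous_on_divide continuous_on_const continuous_on_compose2[OF continuous_on_H[of UNIV] contQ]) auto
  have "(g \<longlongrightarrow> g 0) (at_right 0)"
    using contg[of UNIV] by (simp add: continuous_on_def filterlim_at_split)
  moreover have "g 0 = 1" using HP by (simp add: g_def Q_def)
  ultimately have "(g \<longlongrightarrow> 1) (at_right 0)" by simp
  then have "\<forall>\<^sub>F r in at_right 0. dist (g r) 1 < 1" by (rule tendstoD) simp
  then have "\<forall>\<^sub>F r in at_right 0. dist (g r) 1 < 1 \<and> Q r \<notin> N"
    unfolding Q_def using eventually_off_nodes[OF q] by (rule eventually_conj)
  then obtain \<delta>' where d': "0 < \<delta>'"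
    "\<And>r :: real. 0 < r \<Longrightarrow> r < \<delta>' \<Longrightarrow> dist (g r) 1 < 1 \<and> Q r \<notin> N"
    unfolding eventually_at_right_field by blast
  define \<delta> where "\<delta> = \<delta>' / 2"
  have r: "dist (g r) 1 < 1" "Q r \<notin> N" if "0 < r" "r \<le> \<delta>" for r
    using d' that by (auto simp: \<delta>_def)
  have gpos: "g r \<notin> \<real>\<^sub>\<le>\<^sub>0" if "r \<in> {0..\<delta>}" for r
  proof (cases "r = 0")
    case True
    then show ?thesis using \<open>g 0 = 1\<close> by simp
  next
    case False
    then have "dist (g r) 1 < 1" using r that by simp
    then have "\<bar>Re (g r) - 1\<bar> < 1"
      using abs_Re_le_cmod[of "g r - 1"] by (simp add: dist_norm)
    then show ?thesis by (auto simp: complex_nonpos_Reals_iff)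
  qed
  define S where "S r = csqrt (g r)" for r
  have contS: "continuous_on {0..\<delta>} S" unfolding S_def
    by (rule continuous_on_compose2[OF continuous_on_csqrt contg]) (use gpos in auto)
  define w where "w r = \<kappa> * s * t * S r" for r
  have contw: "continuous_on {0..\<delta>} w" unfolding w_def by (intro continuous_intros contS)
  define \<phi> :: "real \<Rightarrow> xpoint" where "\<phi> r = ((of_real r * w r, Q r),
    \<lambda>P'\<in>N. if P' = cP then cpoint (join (w r) ?q) else cpoint (join (of_real r * w r) (Q r - P')))" for r
  have "\<phi> 0 \<in> closure {xgraph \<omega> Q | \<omega> Q. \<omega>\<^sup>2 = arr_poly \<A> lam Q \<and> Q \<notin> N}"
  proof (rule curve_end_in_closure)
    show "0 < \<delta>" using d' by (simp add: \<delta>_def)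
    show "continuous_on {0..\<delta>} \<phi>" unfolding \<phi>_def
    proof (intro continuous_on_Pair contQ continuous_on_coordinatewise_then_product)
      show contrw: "continuous_on {0..\<delta>} (\<lambda>r. of_real r * w r)"
        by (intro continuous_intros contw)
      fix P'
      have nz: "Q r - P' \<noteq> 0" if "P' \<in> N" "P' \<noteq> cP" "r \<in> {0..\<delta>}" for r
        using r[of r] that by (cases "r = 0") (auto simp: Q_def)
      show "continuous_on {0..\<delta>} (\<lambda>r. (\<lambda>P'\<in>N. if P' = cP then cpoint (join (w r) ?q)
        else cpoint (join (of_real r * w r) (Q r - P'))) P')"
      proof (cases "P' \<in> N")
        case True
        show ?thesis
        proof (cases "P' = cP")
          case True
          have "continuous_on {0..\<delta>} (\<lambda>r. cpoint (join (w r) ?q))"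
            using q by (intro continuous_on_cpoint continuous_on_join contw continuous_on_const)
              (simp add: join_eq_0_iff)
          then show ?thesis using True P_node by simp
        next
          case False
          have "continuous_on {0..\<delta>} (\<lambda>r. cpoint (join (of_real r * w r) (Q r - P')))"
            using nz[OF \<open>P' \<in> N\<close> False]
            by (intro continuous_on_cpoint continuous_on_join contrw continuous_on_diff contQ continuous_on_const)
              (simp add: join_eq_0_iff)
          then show ?thesis using True False by simp
        qed
      qed (simp add: continuous_on_const)
    qed
    fix r :: real assume r0: "0 < r" "r \<le> \<delta>"
    have "cpoint (join (of_real r * w r) (of_real r *s ?q)) = cpoint (join (w r) ?q)"
      unfolding join_scale using r0 q by (intro cpoint_scale) (auto simp: join_eq_0_iff)
    then have "\<phi> r = xgraph (of_real r * w r) (Q r)"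
      unfolding \<phi>_def xgraph_def by (auto intro!: restrict_ext simp: Q_def)
    moreover have "(of_real r * w r)\<^sup>2 = arr_poly \<A> lam (Q r)"
    proof -
      have "(S r)\<^sup>2 = H (Q r) / H cP" by (simp add: S_def g_def)
      moreover have "\<kappa>\<^sup>2 = of_real \<eta> * H cP" by (simp add: kappa_sq H_complexify)
      ultimately have "(of_real r * w r)\<^sup>2 = (of_real r)\<^sup>2 * (of_real \<eta> * s\<^sup>2 * t\<^sup>2 * H (Q r))"
        using HP by (simp add: w_def power_mult_distrib)
      also have "\<dots> = arr_poly \<A> lam (Q r)"
        by (simp add: arr_poly_eq Q_def complex_linear_part_scale power2_eq_square mult_ac)
      finally show ?thesis .
    qed
    ultimately show "\<phi> r \<in> {xgraph \<omega> Q | \<omega> Q. \<omega>\<^sup>2 = arr_poly \<A> lam Q \<and> Q \<notin> N}"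
      using r[OF r0] by blast
  qed
  moreover have "\<phi> 0 = E s t"
    using \<open>g 0 = 1\<close> unfolding \<phi>_def E_def xexc_def
    by (auto intro!: restrict_ext simp: w_def S_def Q_def)
  ultimately show ?thesis unfolding resolution_eq by simp
qed

abbreviation D :: "xpoint set" where "D \<equiv> exceptional_sphere \<A> lam cP"
abbreviation S :: "xpoint set" where "S \<equiv> boundary_circle \<A> lam C cP"
abbreviation M :: "xpoint set" where "M \<equiv> lifted_chamber \<A> lam C"

lemma exceptional_sphere_eq: "D = {E s t | s t. (s, t) \<noteq> (0, 0)}"
proof (intro equalityI subsetI)
  fix x assume "x \<in> D"
  then have "x \<in> resolution \<A> lam" "snd (fst x) = cP"
    unfolding exceptional_sphere_def exceptional_curve_def blowdown_def by (auto simp: double_cover_fst)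
  then obtain s t where "(s, t) \<noteq> (0, 0)" "x = E s t" by (rule resolution_over_P)
  then show "x \<in> {E s t | s t. (s, t) \<noteq> (0, 0)}" by blast
next
  fix x assume "x \<in> {E s t | s t. (s, t) \<noteq> (0, 0)}"
  then obtain s t where st: "(s, t) \<noteq> (0, 0)" "x = E s t" by blast
  have q: "dir s t \<noteq> 0" using st by (auto simp: dir_eq_0_iff)
  have "yexc cP (dir s t) \<in> closure {ygraph Q | Q. Q \<in> UNIV \<and> Q \<notin> N}"
    using P_node q by (rule yexc_in_closure) simp
  then have "double_cover \<A> lam x \<in> blowup \<A> lam"
    unfolding st E_def double_cover_xexc[OF q] blowup_eq by simp
  then show "x \<in> D"
    using E_in_resolution[OF st(1)] E_fst[of s t] st(2)
    unfolding exceptional_sphere_def exceptional_curve_def blowdown_def by (simp add: double_cover_fst)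
qed

text \<open>Limits of the directions \<open>[Q - P]\<close> with \<open>Q\<close> in the chamber satisfy \<open>U / V \<in> [0, \<infinity>]\<close>.\<close>

lemma strict_transform_direction:
  assumes y: "y \<in> strict_transform \<A> lam (complexify ` C)"
  defines "q \<equiv> crep (snd y cP)"
  shows "Im (U q * cnj (V q)) = 0" "0 \<le> Re (U q * cnj (V q))"
proof -
  define F where "F q = U q * cnj (V q)" for q
  have F_scale: "F (c *s q) = of_real ((norm c)\<^sup>2) * F q" for c q
    unfolding F_def complex_linear_part_scale complex_norm_square by (simp add: mult_ac)
  have contF: "continuous_on UNIV F" unfolding F_def by (intro continuous_intros)
  have c1: "closed {y :: ypoint. Im (F (crep (snd y cP))) = 0}"
    using continuous_on_Im[OF continuous_on_compose2[OF contF continuous_on_snd[OF continuous_on_id]]]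
    by (intro closed_condition_coordinate[where F = "\<lambda>_ q. Im (F q)"])
      (auto simp: F_scale case_prod_unfold)
  have "open {p. 0 < - Re (F (crep p))}"
    by (rule open_Collect_crep_pos) (auto simp: F_scale mult_less_0_iff intro!: continuous_intros contF)
  then have "closed {p. 0 \<le> Re (F (crep p))}"
    unfolding closed_def Collect_neg_eq[symmetric] not_le by simp
  then have c2: "closed {y :: ypoint. 0 \<le> Re (F (crep (snd y cP)))}"
    using closed_vimage[of "{p. 0 \<le> Re (F (crep p))}" "\<lambda>y :: ypoint. snd y cP"]
      continuous_on_product_then_coordinatewise[OF continuous_on_snd[OF continuous_on_id[of "UNIV :: ypoint set"]]]
    by (simp add: vimage_def)
  have *: "\<exists>c\<ge>0. F (crep (snd (ygraph Q) cP)) = of_real c" if Q: "Q \<in> complexify ` C" "Q \<notin> N" for Q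
  proof -
    obtain x where x: "x \<in> C" "Q = complexify x" using Q(1) by blast
    have nz: "Q - cP \<noteq> 0" using Q(2) P_node by auto
    obtain c where c: "crep (cpoint (Q - cP)) = c *s (Q - cP)" using crep_cpoint[OF nz] by blast
    have "F (Q - cP) = of_real ((eps l * rv l x) * (eps m * rv m x))"
      unfolding F_def x complexify_diff[symmetric] complex_linear_part_complexify rv_l rv_m by simp
    moreover have y: "snd (ygraph Q) cP = cpoint (Q - cP)" using P_node by (simp add: ygraph_def)
    ultimately have "F (crep (snd (ygraph Q) cP)) = of_real ((norm c)\<^sup>2 * ((eps l * rv l x) * (eps m * rv m x)))"
      unfolding y c F_scale by simp
    moreover have "0 \<le> eps l * rv l x" "0 \<le> eps m * rv m x"
      using x(1) corner_lines(1,2) unfolding C_eq by blast+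
    then have "0 \<le> (norm c)\<^sup>2 * ((eps l * rv l x) * (eps m * rv m x))" by simp
    ultimately show ?thesis by blast
  qed
  have "y \<in> {y :: ypoint. Im (F (crep (snd y cP))) = 0}"
    by (rule yclosure_minimal[OF c1 _ y[unfolded strict_transform_eq]]) (use * in fastforce)
  then show "Im (U q * cnj (V q)) = 0" by (simp add: F_def q_def)
  have "y \<in> {y :: ypoint. 0 \<le> Re (F (crep (snd y cP)))}"
    by (rule yclosure_minimal[OF c2 _ y[unfolded strict_transform_eq]]) (use * in fastforce)
  then show "0 \<le> Re (U q * cnj (V q))" by (simp add: F_def q_def)
qed

text \<open>For real \<open>s\<close> and \<open>t\<close> the direction has \<open>u = s\<^sup>2 \<ge> 0\<close> and \<open>v = t\<^sup>2 \<ge> 0\<close>, so it points into the chamber.\<close>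

lemma E_real_in_lifted_chamber:
  fixes s t :: real
  assumes st: "(s, t) \<noteq> (0, 0)"
  shows "E (of_real s) (of_real t) \<in> M"
proof -
  let ?d = "s\<^sup>2 *\<^sub>R eu + t\<^sup>2 *\<^sub>R ev"
  have dir: "dir (of_real s) (of_real t) = complexify ?d"
    by (simp add: dir_def complexify_add complexify_scaleR)
  have q: "dir (of_real s) (of_real t) \<noteq> 0" using st by (auto simp: dir_eq_0_iff)
  have "\<forall>\<^sub>F r in at_right 0. P + r *\<^sub>R ?d \<in> C"
  proof (rule eventually_in_chamber[OF signs corner_lines(6)])
    fix k assume k: "k \<in> \<A>" "P \<in> k"
    then have "k = l \<or> k = m"
      using no_three_concurrent[OF corner_lines(1,2) k(1) corner_lines(3,4,5) k(2)] by blast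
    moreover have "eps l * (nv l \<bullet> ?d) = s\<^sup>2" "eps m * (nv m \<bullet> ?d) = t\<^sup>2"
    proof -
      have "eps l * (nv l \<bullet> ?d) = a \<bullet> ?d" "eps m * (nv m \<bullet> ?d) = b \<bullet> ?d"
        by (simp_all add: a_def b_def)
      then show "eps l * (nv l \<bullet> ?d) = s\<^sup>2" "eps m * (nv m \<bullet> ?d) = t\<^sup>2"
        by (simp_all add: inner_add_right dual_basis)
    qed
    ultimately show "0 \<le> eps k * (nv k \<bullet> ?d)" by auto
  qed
  then have "\<forall>\<^sub>F r in at_right 0. cP + of_real r *s dir (of_real s) (of_real t) \<in> complexify ` C"
    unfolding dir complexify_scaleR[symmetric] complexify_add[symmetric]
    by (rule eventually_mono) blast
  then have "yexc cP (dir (of_real s) (of_real t)) \<in> strict_transform \<A> lam (complexify ` C)"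
    unfolding strict_transform_eq by (rule yexc_in_closure[OF P_node q])
  then show ?thesis
    using E_in_resolution[of "of_real s" "of_real t"] st double_cover_xexc[OF q]
    unfolding lifted_chamber_def E_def by simp
qed

text \<open>Here \<open>U / V\<close> is the square of \<open>s / t\<close>, and a complex number with a nonnegative real square is real.\<close>

lemma E_in_lifted_chamber_iff:
  assumes st: "(s, t) \<noteq> (0, 0)"
  shows "E s t \<in> M \<longleftrightarrow> Im (s * cnj t) = 0"
proof
  assume "E s t \<in> M"
  then have "double_cover \<A> lam (E s t) \<in> strict_transform \<A> lam (complexify ` C)"
    unfolding lifted_chamber_def by blast
  moreover have q: "dir s t \<noteq> 0" using st by (auto simp: dir_eq_0_iff)
  ultimately have y: "yexc cP (dir s t) \<in> strict_transform \<A> lam (complexify ` C)"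
    by (simp add: E_def double_cover_xexc)
  obtain c where c: "c \<noteq> 0" "crep (cpoint (dir s t)) = c *s dir s t" by (rule crep_cpoint[OF q])
  have e: "crep (snd (yexc cP (dir s t)) cP) = c *s dir s t" using c P_node by (simp add: yexc_def)
  have F: "U (c *s dir s t) * cnj (V (c *s dir s t)) = of_real ((norm c)\<^sup>2) * (s * cnj t)\<^sup>2"
    unfolding complex_linear_part_scale UV_dir complex_norm_square
    by (simp add: power2_eq_square mult_ac)
  have im: "Im ((s * cnj t)\<^sup>2) = 0" "0 \<le> Re ((s * cnj t)\<^sup>2)"
    using strict_transform_direction[OF y] c(1) unfolding e F by (simp_all add: zero_le_mult_iff)
  show "Im (s * cnj t) = 0" by (rule real_of_square_nonneg[OF im])
next
  assume im: "Im (s * cnj t) = 0"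
  show "E s t \<in> M"
  proof (cases "t = 0")
    case True
    then have "E s t = E (of_real 1) (of_real 0)" using E_scale[of s 1 0] st by simp
    then show ?thesis using E_real_in_lifted_chamber[of 1 0] by simp
  next
    case False
    have "cnj t * s = of_real (Re (s * cnj t))"
      using im by (simp add: complex_eq_iff mult.commute)
    moreover have "cnj t * t = of_real ((norm t)\<^sup>2)"
      unfolding complex_norm_square by (rule mult.commute)
    ultimately have "E s t = E (of_real (Re (s * cnj t))) (of_real ((norm t)\<^sup>2))"
      using E_scale[of "cnj t" s t] False by simp
    then show ?thesis using E_real_in_lifted_chamber[of "Re (s * cnj t)" "(norm t)\<^sup>2"] False by simp
  qed
qed

end

section \<open>Charts of the lifted chamber at its corners\<close>

lemma bounded_linear_euclidean:
  fixes f :: "'a::euclidean_space \<Rightarrow> 'b::real_normed_vector"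
  shows "linear f \<Longrightarrow> bounded_linear f"
  by (rule linear_conv_bounded_linear[THEN iffD1])

lemma bounded_linear_complexify: "bounded_linear complexify"
  by (intro bounded_linear_euclidean linearI) (simp_all add: vec_eq_iff complex_eq_iff)

lemma bounded_linear_real_part: "bounded_linear real_part"
  by (intro bounded_linear_euclidean linearI) (simp_all add: vec_eq_iff real_part_def)

lemma bounded_linear_plane_part: "bounded_linear plane_part"
  by (intro bounded_linear_euclidean linearI) (simp_all add: vec_eq_iff forall_2)

lemma bounded_linear_complex_linear_part: "bounded_linear (complex_linear_part a)"
  by (intro bounded_linear_euclidean linearI)
    (simp_all add: complex_linear_part_def complex_eq_iff algebra_simps)

lemma C1_on_join: "C1_on W f \<Longrightarrow> C1_on W g \<Longrightarrow> C1_on W (\<lambda>t. join (f t) (g t))"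
  using C1_on_bounded_linear[OF bounded_linear_join C1_on_Pair[of W f g]] by simp

lemma C1_on_complexify: "C1_on W f \<Longrightarrow> C1_on W (\<lambda>t. complexify (f t))"
  by (rule C1_on_bounded_linear[OF bounded_linear_complexify])

lemma C1_on_of_real: "C1_on W f \<Longrightarrow> C1_on W (\<lambda>t. complex_of_real (f t))"
  by (rule C1_on_bounded_linear[OF bounded_linear_of_real])

lemma C1_on_diff_const:
  fixes c :: "'b::real_normed_vector"
  shows "C1_on W f \<Longrightarrow> C1_on W (\<lambda>t. f t - c)"
  using C1_on_add[OF _ C1_on_const, of W f "- c"] by simp

lemma det2_linear_image:
  fixes X :: "complex \<Rightarrow> real ^ 2"
  assumes "linear X"
  shows "det2 (X (A 1)) (X (A \<i>)) = det2 (X 1) (X \<i>) * cdet A"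
  by (subst (1 2) real_linear_complex[OF assms]) (simp add: det2_def cdet_def algebra_simps)

context nodal_corner
begin

lemma real_decompose: "x = P + (a \<bullet> (x - P)) *\<^sub>R eu + (b \<bullet> (x - P)) *\<^sub>R ev"
proof -
  have "complexify (x - P) = U (complexify (x - P)) *s Eu + V (complexify (x - P)) *s Ev"
    by (rule decompose)
  then have "complexify (x - P) = complexify ((a \<bullet> (x - P)) *\<^sub>R eu + (b \<bullet> (x - P)) *\<^sub>R ev)"
    by (simp only: complex_linear_part_complexify complexify_add complexify_scaleR)
  then show ?thesis by (simp add: algebra_simps)
qed

text \<open>The chart sends \<open>\<zeta> + \<i> \<rho>\<close> to the point with \<open>u = \<rho> \<zeta>\<^sup>2\<close>, \<open>v = \<rho>\<close>, so that \<open>u * v\<close> becomes a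
  square and \<open>y = \<sigma> \<rho> \<zeta> \<surd>h\<close> is smooth. The boundary line \<open>\<rho> = 0\<close> parametrizes the circle over \<open>P\<close>
  minus a point. The sign \<open>\<sigma>\<close> makes all these charts positive for \<open>dx\<^sub>1 \<and> dx\<^sub>2 / y\<close>.\<close>

definition pt :: "complex \<Rightarrow> real ^ 2" where
  "pt z = P + Im z *\<^sub>R ((Re z)\<^sup>2 *\<^sub>R eu + ev)"

text \<open>This is \<open>y / \<rho>\<close>, and \<open>height\<close> below is \<open>y\<close>; the quotient stays meaningful at \<open>\<rho> = 0\<close>.\<close>

definition slope :: "complex \<Rightarrow> real" where
  "slope z = \<sigma> * Re z * sqrt (h (pt z))"

definition height :: "complex \<Rightarrow> real" where
  "height z = Im z * slope z"

definition chart :: "complex \<Rightarrow> xpoint" where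
  "chart z = ((\<kappa>0 * of_real (height z), complexify (pt z)),
     \<lambda>P'\<in>N. if P' = cP then cpoint (join (\<kappa>0 * of_real (slope z)) (complexify ((Re z)\<^sup>2 *\<^sub>R eu + ev)))
       else cpoint (join (\<kappa>0 * of_real (height z)) (complexify (pt z) - P')))"

definition others_pos :: "real ^ 2 \<Rightarrow> bool" where
  "others_pos x \<longleftrightarrow> (\<forall>k\<in>\<A> - {l, m}. 0 < eps k * rv k x)"

definition dom :: "complex set" where
  "dom = {z. 0 \<le> Im z \<and> others_pos (pt z)}"

definition ratio :: "3 cproj \<Rightarrow> complex" where
  "ratio p = crep p $ 1 / V (plane_part (crep p))"

definition rng :: "xpoint set" where
  "rng = {x \<in> M. V (plane_part (crep (snd x cP))) \<noteq> 0 \<and> others_pos (real_part (snd (fst x)))}"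

text \<open>The inverse of the chart, read off from \<open>w / V = \<kappa>0 \<sigma> \<zeta> \<surd>h\<close> in the projective coordinate at \<open>P\<close> and
  from \<open>v = \<rho>\<close>.\<close>

definition coord :: "xpoint \<Rightarrow> complex" where
  "coord x = (let r = real_part (snd (fst x)) in
     Complex (Re (ratio (snd x cP) / (\<kappa>0 * of_real (\<sigma> * sqrt (h r))))) (b \<bullet> (r - P)))"

lemma h_pos: "others_pos x \<Longrightarrow> 0 < h x"
  unfolding others_pos_def h_def by (intro prod_pos) auto

lemma others_pos_P: "others_pos P"
  unfolding others_pos_def using corner_others_positive[OF signs corner] by auto

lemma ab_pt: "a \<bullet> (pt z - P) = Im z * (Re z)\<^sup>2" "b \<bullet> (pt z - P) = Im z"
  unfolding pt_def by (simp_all add: inner_add_right dual_basis)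

text \<open>Every line through a node other than \<open>P\<close> would have to be \<open>l\<close> or \<open>m\<close>, as the remaining functions are
  positive; so a corner chart reaches no node but its own.\<close>

lemma node_others_pos:
  assumes "complexify x \<in> N" "others_pos x"
  shows "x = P"
proof -
  obtain k j where kj: "k \<in> \<A>" "j \<in> \<A>" "k \<noteq> j" "x \<in> k" "x \<in> j"
    using assms(1) unfolding complexify_mem_nodes_iff by blast
  have "i = l \<or> i = m" if "i \<in> \<A>" "x \<in> i" for i
  proof (rule ccontr)
    assume "\<not> (i = l \<or> i = m)"
    then have "0 < eps i * rv i x" using assms(2) that unfolding others_pos_def by blast
    moreover have "rv i x = 0" using that mem_line_iff by blast
    ultimately show False by simp
  qed
  then have "x \<in> l" "x \<in> m" using kj by metis+
  then show ?thesis using intersection_unique[of l m x P] corner_lines by blast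
qed

lemma pt_off_nodes:
  assumes "z \<in> dom" "0 < Im z"
  shows "complexify (pt z) \<notin> N"
proof
  assume "complexify (pt z) \<in> N"
  then have "pt z = P" using node_others_pos assms unfolding dom_def by blast
  then have "Im z = 0" using ab_pt(2)[of z] by simp
  then show False using assms by simp
qed

lemma pt_in_chamber:
  assumes "z \<in> dom"
  shows "pt z \<in> C"
  unfolding C_eq
proof (intro CollectI ballI)
  fix k assume k: "k \<in> \<A>"
  consider "k = l" | "k = m" | "k \<in> \<A> - {l, m}" using k by blast
  then show "0 \<le> eps k * rv k (pt z)"
  proof cases
    case 1
    then show ?thesis using assms by (simp add: rv_l ab_pt dom_def)
  next
    case 2
    then show ?thesis using assms by (simp add: rv_m ab_pt dom_def)
  next
    case 3
    then have "0 < eps k * rv k (pt z)" using assms unfolding dom_def others_pos_def by blast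
    then show ?thesis by simp
  qed
qed

text \<open>For \<open>\<rho> > 0\<close> the coordinate at \<open>P\<close> is the one of the graph, rescaled by \<open>\<rho>\<close>.\<close>

lemma chart_interior:
  assumes z: "z \<in> dom" "0 < Im z"
  shows "chart z = xgraph (\<kappa>0 * of_real (height z)) (complexify (pt z))"
proof -
  let ?d = "(Re z)\<^sup>2 *\<^sub>R eu + ev"
  have e: "complexify (pt z) - cP = of_real (Im z) *s complexify ?d"
    by (simp add: pt_def complexify_add complexify_scaleR)
  have "b \<bullet> ?d = 1" by (simp add: inner_add_right dual_basis)
  then have "?d \<noteq> 0" by auto
  then have "complexify ?d \<noteq> complexify 0" unfolding complexify_eq_iff .
  then have "complexify ?d \<noteq> 0" by (simp add: complexify_def zero_vec_def)
  moreover have "join (\<kappa>0 * of_real (height z)) (complexify (pt z) - cP)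
      = of_real (Im z) *s join (\<kappa>0 * of_real (slope z)) (complexify ?d)"
    unfolding e join_scale[symmetric] by (simp add: height_def mult_ac)
  ultimately have "cpoint (join (\<kappa>0 * of_real (height z)) (complexify (pt z) - cP))
      = cpoint (join (\<kappa>0 * of_real (slope z)) (complexify ?d))"
    using z(2) by (simp add: cpoint_scale join_eq_0_iff)
  then show ?thesis unfolding chart_def xgraph_def by (auto intro!: restrict_ext)
qed

lemma chart_boundary:
  assumes "Im z = 0"
  shows "chart z = E (of_real (\<sigma> * Re z)) 1"
proof -
  have "pt z = P" using assms by (simp add: pt_def)
  moreover have "dir (of_real (\<sigma> * Re z)) 1 = complexify ((Re z)\<^sup>2 *\<^sub>R eu + ev)"
  proof -
    have "(\<sigma> * Re z)\<^sup>2 = (Re z)\<^sup>2" using sigma_cases by auto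
    then have "(complex_of_real (\<sigma> * Re z))\<^sup>2 = of_real ((Re z)\<^sup>2)" unfolding of_real_power[symmetric] by simp
    then show ?thesis unfolding dir_def complexify_add complexify_scaleR by simp
  qed
  moreover have "\<kappa> * of_real (\<sigma> * Re z) * 1 = \<kappa>0 * of_real (\<sigma> * Re z * sqrt (h P))"
    unfolding \<kappa>_def by simp
  ultimately show ?thesis
    unfolding chart_def E_def xexc_def slope_def height_def by (simp only: assms mult_zero_left mult_zero_right of_real_0)
qed

lemma height_sq:
  assumes "z \<in> dom"
  shows "(height z)\<^sup>2 = a \<bullet> (pt z - P) * (b \<bullet> (pt z - P)) * h (pt z)"
proof -
  have "(sqrt (h (pt z)))\<^sup>2 = h (pt z)" "\<sigma>\<^sup>2 = 1"
    using assms h_pos sigma_sq unfolding dom_def by (auto simp: power2_eq_square less_imp_le)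
  then show ?thesis unfolding ab_pt height_def slope_def power_mult_distrib
    by (simp add: power2_eq_square mult_ac)
qed

lemma chart_in_lifted_chamber:
  assumes z: "z \<in> dom"
  shows "chart z \<in> M"
proof (cases "Im z = 0")
  case True
  then show ?thesis using E_real_in_lifted_chamber[of "\<sigma> * Re z" 1] by (simp add: chart_boundary)
next
  case False
  then have i: "0 < Im z" using z by (simp add: dom_def)
  have "(\<kappa>0 * of_real (height z))\<^sup>2 = arr_poly \<A> lam (complexify (pt z))"
    unfolding arr_poly_complexify height_sq[OF z, symmetric] by (simp add: power_mult_distrib kappa0_sq)
  then show ?thesis
    unfolding chart_interior[OF z i] using pt_in_chamber[OF z] pt_off_nodes[OF z i]
    by (intro xgraph_in_lifted_chamber) auto
qed

lemma ratio_cpoint: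
  assumes "v \<noteq> 0"
  shows "ratio (cpoint v) = v $ 1 / V (plane_part v)"
    "V (plane_part (crep (cpoint v))) = 0 \<longleftrightarrow> V (plane_part v) = 0"
proof -
  obtain c where "c \<noteq> 0" "crep (cpoint v) = c *s v" by (rule crep_cpoint[OF assms])
  then show "ratio (cpoint v) = v $ 1 / V (plane_part v)"
    "V (plane_part (crep (cpoint v))) = 0 \<longleftrightarrow> V (plane_part v) = 0"
    unfolding ratio_def by (simp_all add: plane_part_scale complex_linear_part_scale)
qed

lemma V_chart: "V (complexify ((Re z)\<^sup>2 *\<^sub>R eu + ev)) = 1"
  by (simp add: complex_linear_part_complexify inner_add_right dual_basis)

lemma chart_coordinate:
  "snd (chart z) cP = cpoint (join (\<kappa>0 * of_real (slope z)) (complexify ((Re z)\<^sup>2 *\<^sub>R eu + ev)))"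
  using P_node by (simp add: chart_def)

lemma join_chart_nonzero: "join w (complexify ((Re z)\<^sup>2 *\<^sub>R eu + ev)) \<noteq> 0"
proof
  assume "join w (complexify ((Re z)\<^sup>2 *\<^sub>R eu + ev)) = 0"
  then have "V (complexify ((Re z)\<^sup>2 *\<^sub>R eu + ev)) = V 0" by (simp add: join_eq_0_iff)
  then show False unfolding V_chart by (simp add: complex_linear_part_def)
qed

lemma coord_chart:
  assumes z: "z \<in> dom"
  shows "coord (chart z) = z"
proof -
  have h: "0 < h (pt z)" using z h_pos unfolding dom_def by blast
  have "ratio (snd (chart z) cP) = \<kappa>0 * of_real (slope z)"
    unfolding chart_coordinate by (subst ratio_cpoint[OF join_chart_nonzero]) (simp add: V_chart)
  moreover have "\<kappa>0 * of_real (slope z) / (\<kappa>0 * of_real (\<sigma> * sqrt (h (pt z)))) = of_real (Re z)"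
    using kappa0_nonzero h sigma_cases by (auto simp: slope_def)
  moreover have "snd (fst (chart z)) = complexify (pt z)" by (simp add: chart_def)
  ultimately show ?thesis unfolding coord_def by (simp add: ab_pt Let_def)
qed

lemma chart_in_rng: "z \<in> dom \<Longrightarrow> chart z \<in> rng"
proof -
  assume z: "z \<in> dom"
  have "V (plane_part (crep (snd (chart z) cP))) \<noteq> 0"
    unfolding chart_coordinate ratio_cpoint(2)[OF join_chart_nonzero] by (simp add: V_chart)
  moreover have "snd (fst (chart z)) = complexify (pt z)" by (simp add: chart_def)
  ultimately show ?thesis
    using chart_in_lifted_chamber[OF z] z unfolding rng_def dom_def by simp
qed

text \<open>The normalization of a real point of the conic with \<open>V \<noteq> 0\<close>.\<close>

lemma E_real_normal:
  assumes "(s, t) \<noteq> (0, 0)" "Im (s * cnj t) = 0" "t \<noteq> 0"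
  obtains r :: real where "s / t = of_real r" "E s t = E (of_real r) 1"
proof -
  have "s / t = s * cnj t / (t * cnj t)" using assms(3) by simp
  also have "s * cnj t = of_real (Re (s * cnj t))" using assms(2) by (simp add: complex_eq_iff)
  also have "t * cnj t = of_real ((norm t)\<^sup>2)" by (rule complex_norm_square[symmetric])
  finally have r: "s / t = of_real (Re (s * cnj t) / (norm t)\<^sup>2)" by simp
  have "E s t = E (s / t) 1" using E_scale[of "1 / t" s t] assms by simp
  then show ?thesis using r that by metis
qed

text \<open>Over \<open>P\<close> the point is on the real part of the conic. Elsewhere \<open>\<omega> / \<kappa>0\<close> is a real square root \<open>y\<close> of
  \<open>u v h\<close>, and \<open>\<zeta> = \<sigma> y / (v \<surd>h)\<close>, \<open>\<rho> = v\<close> solve \<open>u = \<rho> \<zeta>\<^sup>2\<close>.\<close>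

lemma chart_coord:
  assumes x: "x \<in> rng"
  shows "coord x \<in> dom \<and> chart (coord x) = x"
proof -
  have xM: "x \<in> M" and Vx: "V (plane_part (crep (snd x cP))) \<noteq> 0"
    and pos: "others_pos (real_part (snd (fst x)))" using x unfolding rng_def by auto
  have xX: "x \<in> resolution \<A> lam" using xM unfolding lifted_chamber_def by blast
  obtain r where r: "r \<in> C" "snd (fst x) = complexify r"
    using lifted_chamber_fst[OF signs xM] by blast
  have pr: "others_pos r" using pos r by simp
  have hr: "0 < h r" by (rule h_pos[OF pr])
  show ?thesis
  proof (cases "r = P")
    case True
    then obtain s t where st: "(s, t) \<noteq> (0, 0)" "x = E s t"
      using resolution_over_P[OF xX] r by metis
    have im: "Im (s * cnj t) = 0" using E_in_lifted_chamber_iff[OF st(1)] xM st(2) by simp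
    have "t \<noteq> 0"
    proof
      assume "t = 0"
      moreover have "join (\<kappa> * s * t) (dir s t) \<noteq> 0" using st(1) by (auto simp: join_eq_0_iff dir_eq_0_iff)
      ultimately show False using Vx unfolding st(2) E_coordinate by (simp add: ratio_cpoint(2))
    qed
    then obtain r where rr: "s / t = of_real r" "E s t = E (of_real r) 1"
      using E_real_normal[OF st(1) im] by blast
    let ?z = "Complex (\<sigma> * r) 0"
    have "\<sigma> * (\<sigma> * r) = r" using sigma_sq by (simp add: mult.assoc[symmetric])
    then have "complex_of_real (\<sigma> * Re ?z) = of_real r" by (simp only: complex.sel)
    moreover have "chart ?z = E (of_real (\<sigma> * Re ?z)) 1" by (rule chart_boundary) simp
    ultimately have "chart ?z = x" unfolding st(2) rr(2) by (simp only:)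
    moreover have zd: "?z \<in> dom" using others_pos_P by (simp add: dom_def pt_def)
    ultimately show ?thesis using coord_chart[OF zd] by simp
  next
    case False
    have off: "complexify r \<notin> N" using node_others_pos[OF _ pr] False by blast
    define \<omega> where "\<omega> = fst (fst x)"
    have xg: "x = xgraph \<omega> (complexify r)"
      using resolution_off_nodes[OF xX] off r unfolding \<omega>_def by simp
    define u where "u = a \<bullet> (r - P)"
    define v where "v = b \<bullet> (r - P)"
    have nz: "join \<omega> (complexify r - cP) \<noteq> 0" using False by (auto simp: join_eq_0_iff)
    have "V (complexify r - cP) \<noteq> 0"
      using Vx ratio_cpoint(2)[OF nz] P_node unfolding xg xgraph_def by simp
    then have "v \<noteq> 0"
      by (simp add: complexify_diff[symmetric] complex_linear_part_complexify v_def)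
    moreover have uv: "0 \<le> u" "0 \<le> v"
    proof -
      have "0 \<le> eps l * rv l r" "0 \<le> eps m * rv m r"
        using r(1) corner_lines(1,2) unfolding C_eq by blast+
      then show "0 \<le> u" "0 \<le> v" unfolding rv_l rv_m u_def v_def .
    qed
    ultimately have v: "0 < v" by simp
    have w2: "(\<omega> / \<kappa>0)\<^sup>2 = of_real (u * v * h r)"
    proof -
      have "\<eta> \<noteq> 0" using eta_cases by auto
      then show ?thesis
        using resolution_double_plane[OF xX] r(2) arr_poly_complexify[of r] kappa0_sq
        unfolding \<omega>_def u_def v_def by (simp add: power_divide)
    qed
    define y where "y = Re (\<omega> / \<kappa>0)"
    have "\<omega> / \<kappa>0 = of_real y \<and> y\<^sup>2 = u * v * h r"
    proof -
      let ?c = "\<omega> / \<kappa>0"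
      have "0 \<le> u * v * h r" using uv hr by simp
      moreover have "Re (?c\<^sup>2) = u * v * h r" "Im (?c\<^sup>2) = 0" unfolding w2 by simp_all
      ultimately have "Im ?c = 0" using real_of_square_nonneg[of ?c] by (simp only:)
      then have c: "?c = of_real y" by (simp add: y_def complex_eq_iff)
      then have "of_real (y\<^sup>2) = complex_of_real (u * v * h r)" using w2 by simp
      then show ?thesis using c of_real_eq_iff by blast
    qed
    then have y: "\<omega> = \<kappa>0 * of_real y" "y\<^sup>2 = u * v * h r"
      using kappa0_nonzero by (simp_all add: field_simps)
    define z where "z = Complex (\<sigma> * y / (v * sqrt (h r))) v"
    have "(Re z)\<^sup>2 = y\<^sup>2 / (v\<^sup>2 * h r)"
      using sigma_cases hr by (auto simp: z_def power_divide power_mult_distrib)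
    then have u: "v * (Re z)\<^sup>2 = u" using v hr unfolding y(2) by (simp add: power2_eq_square)
    have pz: "pt z = r"
    proof -
      have "Im z = v" by (simp add: z_def)
      then have "pt z = P + (v * (Re z)\<^sup>2) *\<^sub>R eu + v *\<^sub>R ev"
        unfolding pt_def by (simp add: scaleR_add_right add.assoc)
      also have "\<dots> = r" unfolding u unfolding u_def v_def by (rule real_decompose[symmetric])
      finally show ?thesis .
    qed
    have zd: "z \<in> dom" using v pr by (simp add: dom_def pz) (simp add: z_def)
    have zi: "0 < Im z" using v by (simp add: z_def)
    have "height z = \<sigma> * \<sigma> * y"
      using v hr unfolding height_def slope_def pz by (simp add: z_def)
    then have "chart z = x"
      unfolding chart_interior[OF zd zi] xg pz y(1) using sigma_sq by simp
    then show ?thesis using coord_chart[OF zd] zd by metis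
  qed
qed

lemma chart_image: "chart ` dom = rng"
proof
  show "chart ` dom \<subseteq> rng" by (rule image_subsetI[OF chart_in_rng])
  show "rng \<subseteq> chart ` dom"
  proof
    fix x assume "x \<in> rng"
    then have "x = chart (coord x)" "coord x \<in> dom" using chart_coord[of x] by simp_all
    then show "x \<in> chart ` dom" by (rule image_eqI)
  qed
qed

lemma C1_on_pt: "C1_on W pt"
  unfolding pt_def
  by (intro C1_on_add C1_on_const C1_on_scaleR C1_on_power2 C1_on_Re C1_on_Im)

lemma C1_on_rv: "C1_on W f \<Longrightarrow> C1_on W (\<lambda>z. rv k (f z))"
  unfolding real_value_def
  by (intro C1_on_add C1_on_const C1_on_bounded_linear[OF bounded_linear_inner_right])

lemma C1_on_h: "C1_on W f \<Longrightarrow> C1_on W (\<lambda>z. h (f z))"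
  unfolding h_def by (intro C1_on_prod C1_on_mult C1_on_const C1_on_rv)

lemma C1_on_slope: "W \<subseteq> dom \<Longrightarrow> C1_on W slope"
  unfolding slope_def
  by (intro C1_on_mult C1_on_const C1_on_Re C1_on_sqrt C1_on_h C1_on_pt) (auto simp: dom_def intro: h_pos)

lemma C1_on_height: "W \<subseteq> dom \<Longrightarrow> C1_on W height"
  unfolding height_def by (intro C1_on_mult C1_on_Im C1_on_slope)

definition lift :: "complex ^ 2 \<Rightarrow> complex \<Rightarrow> complex ^ 3" where
  "lift P' z = (if P' = cP then join (\<kappa>0 * of_real (slope z)) (complexify ((Re z)\<^sup>2 *\<^sub>R eu + ev))
     else join (\<kappa>0 * of_real (height z)) (complexify (pt z) - P'))"

lemma lift_nonzero:
  assumes "z \<in> dom" "P' \<in> N"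
  shows "lift P' z \<noteq> 0"
proof (cases "P' = cP")
  case True
  then show ?thesis using join_chart_nonzero by (simp add: lift_def)
next
  case False
  have "complexify (pt z) \<noteq> P'"
  proof
    assume e: "complexify (pt z) = P'"
    then have "pt z = P" using node_others_pos[of "pt z"] assms unfolding dom_def by blast
    then show False using e False by simp
  qed
  then show ?thesis using False by (simp add: lift_def join_eq_0_iff)
qed

lemma snd_chart: "P' \<in> N \<Longrightarrow> snd (chart z) P' = cpoint (lift P' z)"
  by (simp add: chart_def lift_def)

lemma C1_on_lift: "C1_on dom (lift P')"
proof (cases "P' = cP")
  case True
  show ?thesis unfolding lift_def using True
    by (simp, intro C1_on_join C1_on_mult C1_on_const C1_on_of_real C1_on_slope C1_on_complexify
        C1_on_add C1_on_scaleR C1_on_power2 C1_on_Re order_refl)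
next
  case False
  show ?thesis unfolding lift_def using False
    by (simp, intro C1_on_join C1_on_mult C1_on_const C1_on_of_real C1_on_height C1_on_complexify
        C1_on_diff_const C1_on_pt order_refl)
qed

lemma C1_on_fst_chart: "C1_on dom (\<lambda>z. fst (chart z))"
  unfolding chart_def fst_conv
  by (intro C1_on_Pair C1_on_mult C1_on_const C1_on_of_real C1_on_height C1_on_complexify C1_on_pt order_refl)

lemma openin_dom: "openin (top_of_set {z. 0 \<le> Im z}) dom"
proof -
  have "continuous_on UNIV (\<lambda>z. eps k * rv k (pt z))" for k
    by (intro continuous_on_mult continuous_on_const C1_on_continuous_on[OF C1_on_rv[OF C1_on_pt]])
  then have "open (\<Inter>k\<in>\<A> - {l, m}. {z. 0 < eps k * rv k (pt z)})"
    using finite_lines by (intro open_INT ballI open_Collect_less continuous_on_const) auto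
  moreover have "dom = {z. 0 \<le> Im z} \<inter> (\<Inter>k\<in>\<A> - {l, m}. {z. 0 < eps k * rv k (pt z)})"
    unfolding dom_def others_pos_def by auto
  ultimately show ?thesis unfolding openin_open by blast
qed

text \<open>The function \<open>\<rho> = v\<close> is already seen in the plane. A vector killed by the differential is thus real.
  In the affine chart \<open>V = 1\<close> of the projective coordinate at \<open>P\<close> one sees \<open>U = \<zeta>\<^sup>2\<close>, which detects it
  for \<open>\<zeta> \<noteq> 0\<close>, and \<open>w = \<kappa>0 \<sigma> \<zeta> \<surd>h\<close>, which detects it for \<open>\<zeta> = 0\<close>.\<close>

lemma chart_immersion: "C1_immersion N dom chart"
proof (rule C1_immersionI)
  show "lifts_to N dom chart lift"
    unfolding lifts_to_def using lift_nonzero snd_chart by blast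
  show "C1_on dom (\<lambda>z. fst (chart z))" by (rule C1_on_fst_chart)
  show "C1_on dom (lift P')" for P' by (rule C1_on_lift)
  fix z q' h' \<xi>
  assume z: "z \<in> dom" and q': "((\<lambda>t. fst (chart t)) has_derivative q') (at z within dom)"
    and h': "\<And>P'. P' \<in> N \<Longrightarrow> (lift P' has_derivative h' P') (at z within dom)"
    and 0: "q' \<xi> = 0" and c: "\<And>P'. P' \<in> N \<Longrightarrow> \<exists>c. h' P' \<xi> = c *s lift P' z"
  note uniq = derivative_unique_reachable[OF reachable_half_plane[OF openin_dom z]]
  have bL: "bounded_linear (\<lambda>y :: complex \<times> (complex ^ 2). b \<bullet> real_part (snd y))"
    by (intro bounded_linear_compose[OF bounded_linear_inner_right]
        bounded_linear_compose[OF bounded_linear_real_part] bounded_linear_snd)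
  have "((\<lambda>t. b \<bullet> real_part (snd (fst (chart t)))) has_derivative (\<lambda>\<xi>. b \<bullet> real_part (snd (q' \<xi>)))) (at z within dom)"
    by (rule bounded_linear.has_derivative[OF bL q'])
  moreover have "b \<bullet> real_part (snd (fst (chart t))) = b \<bullet> P + Im t" for t
    using ab_pt(2)[of t] by (simp add: chart_def inner_diff_right)
  ultimately have "((\<lambda>t. b \<bullet> P + Im t) has_derivative (\<lambda>\<xi>. b \<bullet> real_part (snd (q' \<xi>)))) (at z within dom)"
    by simp
  moreover have "((\<lambda>t. b \<bullet> P + Im t) has_derivative Im) (at z within dom)"
    by (auto intro!: derivative_eq_intros)
  ultimately have "(\<lambda>\<xi>. b \<bullet> real_part (snd (q' \<xi>))) = Im" by (rule uniq)
  then have "b \<bullet> real_part (snd (q' \<xi>)) = Im \<xi>" by (rule fun_cong)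
  then have im: "Im \<xi> = 0" using 0 by (simp add: real_part_def zero_vec_def[symmetric] inner_2)
  define g where "g = h' cP"
  have lift_cP: "lift cP = (\<lambda>z. join (\<kappa>0 * of_real (slope z)) (complexify ((Re z)\<^sup>2 *\<^sub>R eu + ev)))"
    by (simp add: lift_def fun_eq_iff)
  have g: "(lift cP has_derivative g) (at z within dom)" unfolding g_def by (rule h'[OF P_node])
  obtain c where c: "g \<xi> = c *s lift cP z" using c[OF P_node] unfolding g_def by blast
  have Vd: "((\<lambda>t. V (plane_part (lift cP t))) has_derivative (\<lambda>\<xi>. V (plane_part (g \<xi>)))) (at z within dom)"
    by (rule bounded_linear.has_derivative[OF bounded_linear_compose[OF
          bounded_linear_complex_linear_part bounded_linear_plane_part] g])
  have "((\<lambda>t. V (plane_part (lift cP t))) has_derivative (\<lambda>\<xi>. 0)) (at z within dom)"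
    unfolding lift_cP plane_part_join V_chart by simp
  from uniq[OF Vd this] have "V (plane_part (g \<xi>)) = 0" by (rule fun_cong)
  then have "c = 0"
    unfolding c plane_part_scale complex_linear_part_scale lift_cP plane_part_join V_chart by simp
  then have g0: "g \<xi> = 0" using c by simp
  have Ud: "((\<lambda>t. U (plane_part (lift cP t))) has_derivative (\<lambda>\<xi>. U (plane_part (g \<xi>)))) (at z within dom)"
    by (rule bounded_linear.has_derivative[OF bounded_linear_compose[OF
          bounded_linear_complex_linear_part bounded_linear_plane_part] g])
  have Ue: "U (plane_part (lift cP t)) = of_real (Re t * Re t)" for t
    unfolding lift_cP plane_part_join
    by (simp add: complex_linear_part_complexify inner_add_right dual_basis power2_eq_square)
  have "((\<lambda>t. of_real (Re t * Re t)) has_derivative (\<lambda>\<xi>. complex_of_real (Re z * Re \<xi> + Re \<xi> * Re z))) (at z within dom)"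
    by (auto intro!: derivative_eq_intros)
  from uniq[OF Ud[unfolded Ue] this] have "U (plane_part (g \<xi>)) = complex_of_real (Re z * Re \<xi> + Re \<xi> * Re z)"
    by (rule fun_cong)
  moreover have "U (plane_part (g \<xi>)) = 0" unfolding g0 by (simp add: complex_linear_part_def)
  ultimately have "complex_of_real (Re z * Re \<xi> + Re \<xi> * Re z) = 0" by simp
  then have "Re z * Re \<xi> + Re \<xi> * Re z = 0" unfolding of_real_eq_0_iff .
  then have zr: "Re z * Re \<xi> = 0" by (simp add: mult.commute)
  have "Re \<xi> = 0"
  proof (cases "Re z = 0")
    case True
    \<comment> \<open>At \<open>\<zeta> = 0\<close> the derivative of \<open>\<zeta> \<surd>h\<close> is \<open>\<surd>h\<close> times that of \<open>\<zeta>\<close>.\<close>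
    have C1s: "C1_on dom (\<lambda>t. sqrt (h (pt t)))"
      by (intro C1_on_sqrt C1_on_h C1_on_pt) (auto simp: dom_def intro: h_pos)
    obtain s' where s': "((\<lambda>t. sqrt (h (pt t))) has_derivative s') (at z within dom)"
      using C1_on_differentiable[OF C1s z] unfolding differentiable_def by blast
    have "((\<lambda>t. \<kappa>0 * of_real (\<sigma> * (Re t * sqrt (h (pt t))))) has_derivative
        (\<lambda>\<xi>. \<kappa>0 * of_real (\<sigma> * (Re z * s' \<xi> + Re \<xi> * sqrt (h (pt z)))))) (at z within dom)"
      by (intro has_derivative_mult_right has_derivative_of_real has_derivative_mult s'
          has_derivative_Re has_derivative_ident)
    moreover have "\<kappa>0 * of_real (\<sigma> * (Re t * sqrt (h (pt t)))) = lift cP t $ 1" for t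
      unfolding lift_cP slope_def by (simp add: mult.assoc)
    ultimately have "((\<lambda>t. lift cP t $ 1) has_derivative
        (\<lambda>\<xi>. \<kappa>0 * of_real (\<sigma> * (Re z * s' \<xi> + Re \<xi> * sqrt (h (pt z)))))) (at z within dom)" by simp
    from uniq[OF bounded_linear.has_derivative[OF bounded_linear_vec_nth g] this]
    have "g \<xi> $ 1 = \<kappa>0 * of_real (\<sigma> * (Re z * s' \<xi> + Re \<xi> * sqrt (h (pt z))))" by (rule fun_cong)
    then have "\<sigma> * (Re \<xi> * sqrt (h (pt z))) = 0"
      using g0 True kappa0_nonzero by (simp del: of_real_mult)
    moreover have "0 < h (pt z)" using z h_pos unfolding dom_def by blast
    ultimately show ?thesis using sigma_cases by auto
  qed (use zr in simp)
  then show "\<xi> = 0" using im by (simp add: complex_eq_iff)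
qed

lemma continuous_on_chart: "continuous_on dom chart"
proof -
  have "continuous_on dom (\<lambda>z. (fst (chart z), snd (chart z)))"
  proof (intro continuous_on_Pair C1_on_continuous_on[OF C1_on_fst_chart]
      continuous_on_coordinatewise_then_product)
    fix P'
    show "continuous_on dom (\<lambda>z. snd (chart z) P')"
    proof (cases "P' \<in> N")
      case True
      then show ?thesis unfolding snd_chart[OF True]
        using lift_nonzero by (intro continuous_on_cpoint C1_on_continuous_on[OF C1_on_lift]) blast
    next
      case False
      then show ?thesis by (simp add: chart_def continuous_on_const)
    qed
  qed
  then show ?thesis by simp
qed

lemma open_V_neq: "open {p :: 3 cproj. V (plane_part (crep p)) \<noteq> 0}"
  and continuous_on_ratio: "continuous_on {p :: 3 cproj. V (plane_part (crep p)) \<noteq> 0} ratio"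
proof -
  have c: "continuous_on UNIV (\<lambda>p. V (plane_part p))" "continuous_on UNIV (\<lambda>p :: complex ^ 3. p $ 1)"
    by (intro bounded_linear.continuous_on[OF bounded_linear_compose[OF
          bounded_linear_complex_linear_part bounded_linear_plane_part]] continuous_intros)+
  have s: "V (plane_part (c *s v)) = c * V (plane_part v)" "(c *s v) $ 1 = c * v $ 1" for c v
    by (simp_all add: plane_part_scale complex_linear_part_scale)
  show "open {p :: 3 cproj. V (plane_part (crep p)) \<noteq> 0}"
    by (rule open_Collect_crep_linear_neq[OF c(1) s(1)])
  show "continuous_on {p :: 3 cproj. V (plane_part (crep p)) \<noteq> 0} ratio"
    using continuous_on_crep_ratio[OF c(2,1) s(2,1)] unfolding ratio_def[abs_def] by simp
qed

lemma continuous_on_coordinate: "continuous_on W (\<lambda>x :: xpoint. snd x P')"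
  by (rule continuous_on_product_then_coordinatewise[OF continuous_on_snd[OF continuous_on_id]])

lemma open_V_coordinate: "open {x :: xpoint. V (plane_part (crep (snd x cP))) \<noteq> 0}"
  using open_vimage[OF open_V_neq continuous_on_coordinate[of UNIV cP]] by (simp add: vimage_def)

lemma continuous_on_real_part_fst: "continuous_on W (\<lambda>x :: xpoint. real_part (snd (fst x)))"
  by (rule bounded_linear.continuous_on[OF bounded_linear_real_part]) (intro continuous_intros)

lemma continuous_on_h: "continuous_on W h"
  unfolding h_def by (intro continuous_intros continuous_on_rv)

lemma continuous_on_coord: "continuous_on rng coord"
proof -
  have r: "continuous_on rng (\<lambda>x. ratio (snd x cP))"
    by (rule continuous_on_compose2[OF continuous_on_ratio continuous_on_coordinate])
      (auto simp: rng_def)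
  have hh: "continuous_on rng (\<lambda>x. h (real_part (snd (fst x))))"
    by (rule continuous_on_compose2[OF continuous_on_h[of UNIV] continuous_on_real_part_fst]) simp
  have nz: "\<kappa>0 * of_real (\<sigma> * sqrt (h (real_part (snd (fst x))))) \<noteq> 0" if "x \<in> rng" for x
    using that h_pos[of "real_part (snd (fst x))"] kappa0_nonzero sigma_cases unfolding rng_def by auto
  show ?thesis unfolding coord_def Let_def Complex_eq
    by (intro continuous_intros continuous_on_divide r hh continuous_on_real_part_fst) (use nz in simp_all)
qed

lemma openin_rng: "openin (top_of_set M) rng"
proof -
  have "continuous_on UNIV (\<lambda>x :: xpoint. eps k * rv k (real_part (snd (fst x))))" for k
    unfolding real_value_def
    by (intro continuous_on_mult continuous_on_add continuous_on_inner continuous_on_const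
        continuous_on_real_part_fst)
  then have "open {x :: xpoint. 0 < eps k * rv k (real_part (snd (fst x)))}" for k
    by (intro open_Collect_less continuous_on_const)
  then have "open (\<Inter>k\<in>\<A> - {l, m}. {x :: xpoint. 0 < eps k * rv k (real_part (snd (fst x)))})"
    using finite_lines by (intro open_INT ballI) auto
  then have "open ({x. V (plane_part (crep (snd x cP))) \<noteq> 0} \<inter>
      (\<Inter>k\<in>\<A> - {l, m}. {x :: xpoint. 0 < eps k * rv k (real_part (snd (fst x)))}))"
    by (rule open_Int[OF open_V_coordinate])
  moreover have "rng = M \<inter> ({x. V (plane_part (crep (snd x cP))) \<noteq> 0} \<inter>
      (\<Inter>k\<in>\<A> - {l, m}. {x :: xpoint. 0 < eps k * rv k (real_part (snd (fst x)))}))"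
    unfolding rng_def others_pos_def by auto
  ultimately show ?thesis unfolding openin_open by blast
qed

lemma corner_chart: "(dom, chart) \<in> surface_charts N M"
proof -
  have "coord ` rng = dom"
    unfolding chart_image[symmetric] image_image using coord_chart by simp
  then have "homeomorphism dom (chart ` dom) chart coord"
    unfolding homeomorphism_def
    by (simp add: chart_image coord_chart chart_coord continuous_on_chart continuous_on_coord)
  then have "local_param N M dom chart"
    unfolding local_param_def using openin_rng chart_immersion by (simp add: chart_image) blast
  then show ?thesis unfolding surface_charts_def using openin_dom by simp
qed

lemma inv_chart: "x \<in> chart ` dom \<Longrightarrow> inv_into dom chart x = coord x"
  using coord_chart[OF inv_into_into[of x chart dom]] f_inv_into_f[of x chart dom] by simp

end

section \<open>Compatibility of the corner charts\<close>

lemma has_derivative_Complex: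
  assumes "(f has_derivative f') F" "(g has_derivative g') F"
  shows "((\<lambda>x. Complex (f x) (g x)) has_derivative (\<lambda>\<xi>. Complex (f' \<xi>) (g' \<xi>))) F"
  unfolding Complex_eq
  by (intro has_derivative_add has_derivative_mult_right has_derivative_of_real assms)

context nodal_corner
begin

text \<open>The derivative of \<open>pt\<close>.\<close>

definition dpt :: "complex \<Rightarrow> complex \<Rightarrow> real ^ 2" where
  "dpt z \<xi> = (Im z * (2 * Re z * Re \<xi>)) *\<^sub>R eu + Im \<xi> *\<^sub>R ((Re z)\<^sup>2 *\<^sub>R eu + ev)"

lemma pt_has_derivative: "(pt has_derivative dpt z) (at z within W)"
proof -
  have sq: "((\<lambda>z. (Re z)\<^sup>2) has_derivative (\<lambda>\<xi>. 2 * Re z * Re \<xi>)) (at z within W)"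
    by (auto intro!: derivative_eq_intros)
  have "((\<lambda>z. P + Im z *\<^sub>R ((Re z)\<^sup>2 *\<^sub>R eu + ev)) has_derivative
    (\<lambda>\<xi>. 0 + (Im z *\<^sub>R ((2 * Re z * Re \<xi>) *\<^sub>R eu + 0) + Im \<xi> *\<^sub>R ((Re z)\<^sup>2 *\<^sub>R eu + ev)))) (at z within W)"
    by (intro has_derivative_add has_derivative_scaleR has_derivative_const sq
        has_derivative_Im has_derivative_ident has_derivative_scaleR_left)
  then show ?thesis
    unfolding pt_def[abs_def] dpt_def[abs_def] by simp
qed

lemma linear_dpt: "linear (dpt z)"
  using has_derivative_linear[OF pt_has_derivative[of z UNIV]] .

lemma det_dpt: "det2 (dpt z 1) (dpt z \<i>) = 2 * Im z * Re z / det2 a b"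
proof -
  have "det2 (r *\<^sub>R eu) (q *\<^sub>R eu + ev) = r * det2 eu ev" for r q
    by (simp add: det2_def algebra_simps)
  then show ?thesis by (simp add: dpt_def det_dual_basis)
qed

text \<open>The chart is positive for \<open>dx\<^sub>1 \<and> dx\<^sub>2 / y\<close>: the Jacobian of its projection to the plane has the sign
  of \<open>y\<close>.\<close>

lemma chart_orientation:
  assumes "z \<in> dom" "0 < Im z" "Re z \<noteq> 0"
  shows "0 < det2 (dpt z 1) (dpt z \<i>) * height z"
proof -
  have h: "0 < h (pt z)" using assms(1) h_pos unfolding dom_def by blast
  have "0 < \<sigma> / det2 a b"
  proof -
    have "\<sigma> / det2 a b = \<sigma> * det2 a b / (det2 a b)\<^sup>2" using det_nonzero by (simp add: power2_eq_square)
    then show ?thesis using sigma_det det_nonzero by simp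
  qed
  moreover have "det2 (dpt z 1) (dpt z \<i>) * height z
      = 2 * (Im z)\<^sup>2 * (Re z)\<^sup>2 * sqrt (h (pt z)) * (\<sigma> / det2 a b)"
    unfolding det_dpt height_def slope_def by (simp add: power2_eq_square mult_ac)
  moreover have "0 < 2 * (Im z)\<^sup>2 * (Re z)\<^sup>2 * sqrt (h (pt z))" using assms h by simp
  ultimately show ?thesis by (simp only: mult_pos_pos)
qed

lemma coord_xgraph:
  assumes Q: "complexify x \<notin> N" and v: "b \<bullet> (x - P) \<noteq> 0" and pos: "others_pos x"
  shows "coord (xgraph (\<kappa>0 * of_real y) (complexify x))
    = Complex (\<sigma> * y / (b \<bullet> (x - P) * sqrt (h x))) (b \<bullet> (x - P))"
proof -
  have h: "0 < h x" by (rule h_pos[OF pos])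
  have "complexify x - cP \<noteq> 0" using Q P_node by auto
  then have nz: "join (\<kappa>0 * of_real y) (complexify x - cP) \<noteq> 0" by (simp add: join_eq_0_iff)
  have "ratio (snd (xgraph (\<kappa>0 * of_real y) (complexify x)) cP) = \<kappa>0 * of_real y / of_real (b \<bullet> (x - P))"
    using P_node ratio_cpoint(1)[OF nz]
    by (simp add: xgraph_def complexify_diff[symmetric] complex_linear_part_complexify)
  moreover have "\<kappa>0 * of_real y / of_real (b \<bullet> (x - P)) / (\<kappa>0 * of_real (\<sigma> * sqrt (h x)))
      = of_real (\<sigma> * y / (b \<bullet> (x - P) * sqrt (h x)))"
    using kappa0_nonzero sigma_cases v h by (auto simp: field_simps)
  ultimately show ?thesis unfolding coord_def by (simp add: xgraph_def Let_def)
qed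

lemma xgraph_in_rng_iff:
  assumes Q: "complexify x \<notin> N"
  shows "xgraph \<omega> (complexify x) \<in> rng \<longleftrightarrow>
    xgraph \<omega> (complexify x) \<in> M \<and> b \<bullet> (x - P) \<noteq> 0 \<and> others_pos x"
proof -
  have "complexify x - cP \<noteq> 0" using Q P_node by auto
  then have nz: "join \<omega> (complexify x - cP) \<noteq> 0" by (simp add: join_eq_0_iff)
  have "V (plane_part (crep (snd (xgraph \<omega> (complexify x)) cP))) = 0 \<longleftrightarrow> b \<bullet> (x - P) = 0"
    using P_node ratio_cpoint(2)[OF nz]
    by (simp add: xgraph_def complexify_diff[symmetric] complex_linear_part_complexify)
  then show ?thesis unfolding rng_def by (simp add: xgraph_def)
qed

lemma E_in_rng_iff:
  assumes st: "(s, t) \<noteq> (0, 0)"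
  shows "E s t \<in> rng \<longleftrightarrow> E s t \<in> M \<and> t \<noteq> 0"
proof -
  have nz: "join (\<kappa> * s * t) (dir s t) \<noteq> 0" using st by (auto simp: join_eq_0_iff dir_eq_0_iff)
  have "V (plane_part (crep (snd (E s t) cP))) = 0 \<longleftrightarrow> t = 0"
    unfolding E_coordinate ratio_cpoint(2)[OF nz] by simp
  moreover have "real_part (snd (fst (E s t))) = P" by (simp add: E_fst)
  ultimately show ?thesis using others_pos_P unfolding rng_def by auto
qed

end

locale corner_pair =
  c1: nodal_corner \<A> lam C eps l m P + c2: nodal_corner \<A> lam C' eps' l' m' P'
  for \<A> lam C eps l m P C' eps' l' m' P'
begin

context
  assumes swapped: "l' = m" "m' = l" "P' = P" "eps' = eps"
begin

lemma swapped_ab: "c2.a = c1.b" "c2.b = c1.a"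
  unfolding c1.a_def c1.b_def c2.a_def c2.b_def
  unfolding swapped by simp_all

lemma swapped_basis: "c2.eu = c1.ev" "c2.ev = c1.eu" "c2.\<sigma> = - c1.\<sigma>"
proof -
  have d: "det2 c1.b c1.a = - det2 c1.a c1.b" by (simp add: det2_def)
  show "c2.eu = c1.ev" "c2.ev = c1.eu"
    unfolding c2.eu_def c1.eu_def c2.ev_def c1.ev_def swapped_ab d by simp_all
  show "c2.\<sigma> = - c1.\<sigma>" unfolding c1.\<sigma>_def c2.\<sigma>_def swapped_ab d by (rule sgn_minus)
qed

lemma swapped_h: "c2.h = c1.h" and swapped_others_pos: "c2.others_pos = c1.others_pos"
  unfolding c1.h_def[abs_def] c2.h_def[abs_def] c1.others_pos_def[abs_def] c2.others_pos_def[abs_def]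
  unfolding swapped by (simp_all add: insert_commute)

lemma swapped_kappa: "c2.\<kappa>0 = c1.\<kappa>0" "c2.\<kappa> = c1.\<kappa>"
  unfolding c1.\<kappa>_def c2.\<kappa>_def c1.\<kappa>0_def c2.\<kappa>0_def c1.\<eta>_def c2.\<eta>_def swapped_h
  unfolding swapped by simp_all

lemma swapped_E: "c2.E s t = c1.E t s"
proof -
  have "c2.dir s t = c1.dir t s"
    unfolding c1.dir_def c2.dir_def swapped_basis by (rule add.commute)
  then show ?thesis
    unfolding c1.E_def c2.E_def swapped_kappa
    unfolding swapped(3) by (simp add: mult_ac)
qed

text \<open>The two charts at one corner are related by \<open>\<zeta> + \<i> \<rho> \<mapsto> - 1 / \<zeta> + \<i> \<rho> \<zeta>\<^sup>2\<close>.\<close>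

lemma swapped_chart:
  assumes z: "z \<in> c1.dom" "Re z \<noteq> 0"
  defines "w \<equiv> Complex (- (1 / Re z)) (Im z * (Re z)\<^sup>2)"
  shows "w \<in> c2.dom" "c2.chart w = c1.chart z"
proof -
  have pt: "c2.pt w = c1.pt z"
  proof -
    have "(Im z * (Re z)\<^sup>2) *\<^sub>R ((- (1 / Re z))\<^sup>2 *\<^sub>R c1.ev + c1.eu)
        = (Im z * (Re z)\<^sup>2 * (- (1 / Re z))\<^sup>2) *\<^sub>R c1.ev + (Im z * (Re z)\<^sup>2) *\<^sub>R c1.eu"
      by (simp add: scaleR_add_right)
    also have "Im z * (Re z)\<^sup>2 * (- (1 / Re z))\<^sup>2 = Im z"
      using z(2) by (simp add: power_divide)
    finally have e: "(Im z * (Re z)\<^sup>2) *\<^sub>R ((- (1 / Re z))\<^sup>2 *\<^sub>R c1.ev + c1.eu)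
        = Im z *\<^sub>R c1.ev + (Im z * (Re z)\<^sup>2) *\<^sub>R c1.eu" .
    show ?thesis
      unfolding c1.pt_def c2.pt_def swapped_basis
      unfolding swapped(3) w_def complex.sel e by (simp add: scaleR_add_right add.commute)
  qed
  then show "w \<in> c2.dom"
    using z(1) unfolding c1.dom_def c2.dom_def swapped_others_pos by (simp add: w_def)
  have slope: "c2.slope w = c1.slope z / (Re z)\<^sup>2"
    unfolding c1.slope_def c2.slope_def pt swapped_h swapped_basis
    using z(2) by (simp add: w_def power2_eq_square)
  then have height: "c2.height w = c1.height z"
    unfolding c1.height_def c2.height_def using z(2) by (simp add: w_def)
  let ?j = "join (c1.\<kappa>0 * of_real (c1.slope z)) (complexify ((Re z)\<^sup>2 *\<^sub>R c1.eu + c1.ev))"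
  let ?c = "complex_of_real (1 / (Re z)\<^sup>2)"
  have "join (c2.\<kappa>0 * of_real (c2.slope w)) (complexify ((Re w)\<^sup>2 *\<^sub>R c2.eu + c2.ev)) = ?c *s ?j"
  proof -
    have "(Re w)\<^sup>2 *\<^sub>R c2.eu + c2.ev = (1 / (Re z)\<^sup>2) *\<^sub>R ((Re z)\<^sup>2 *\<^sub>R c1.eu + c1.ev)"
      unfolding swapped_basis using z(2) by (simp add: w_def scaleR_add_right power_divide add.commute)
    moreover have "c2.\<kappa>0 * of_real (c2.slope w) = ?c * (c1.\<kappa>0 * of_real (c1.slope z))"
      unfolding slope swapped_kappa by simp
    ultimately show ?thesis
      unfolding join_scale[symmetric] complexify_scaleR[symmetric] by (simp only:)
  qed
  then have "cpoint (join (c2.\<kappa>0 * of_real (c2.slope w)) (complexify ((Re w)\<^sup>2 *\<^sub>R c2.eu + c2.ev))) = cpoint ?j"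
    using z(2) c1.join_chart_nonzero by (simp only:) (rule cpoint_scale; simp)
  then show "c2.chart w = c1.chart z"
    unfolding c1.chart_def c2.chart_def height pt swapped_kappa
    unfolding swapped(3) by (auto intro!: restrict_ext)
qed

end

text \<open>Where \<open>y \<noteq> 0\<close>, the determinant of the transition map is the quotient of the Jacobians of the
  projections of the two charts to the plane, and these have the same sign as they both have the
  sign of \<open>y\<close>. Where \<open>y = 0\<close> both Jacobians vanish, and the determinant is computed directly from
  the real part \<open>\<zeta> R\<close> of the transition map.\<close>

lemma transition_interior:
  assumes same: "eps' = eps" "C' = C"
    and z: "z \<in> c1.dom" "c1.chart z \<in> c2.rng" "0 < Im z"
  shows "\<exists>A. ((\<lambda>t. c2.coord (c1.chart t)) has_derivative A) (at z within c1.dom \<inter> c1.chart -` c2.rng)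
    \<and> 0 < cdet A"
proof -
  let ?X = "c1.dom \<inter> c1.chart -` c2.rng"
  define X0 where "X0 = {z \<in> ?X. 0 < Im z}"
  have zX: "z \<in> X0" using z by (simp add: X0_def)
  have kap: "c2.\<kappa>0 = c1.\<kappa>0"
    unfolding c1.\<kappa>0_def c2.\<kappa>0_def c1.\<eta>_def c2.\<eta>_def same by simp
  have opX: "openin (top_of_set c1.dom) ?X"
    using openin_chart_domain[OF c1.corner_chart c2.corner_chart[unfolded same(2)]]
    unfolding c2.chart_image .
  have "openin (top_of_set ?X) X0"
  proof -
    have "X0 = ?X \<inter> {z. 0 < Im z}" unfolding X0_def by blast
    then show ?thesis using open_halfspace_Im_gt[of 0] unfolding openin_open by blast
  qed
  then have at: "at z within X0 = at z within ?X" using zX by (rule at_within_Int_openin)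
  have X0H: "openin (top_of_set {z. 0 \<le> Im z}) X0"
    using openin_trans[OF openin_trans[OF \<open>openin (top_of_set ?X) X0\<close> opX] c1.openin_dom] .
  note uniq = derivative_unique_reachable[OF reachable_half_plane[OF X0H zX]]
  define v where "v t = c2.b \<bullet> (c1.pt t - P')" for t
  have X0: "t \<in> c1.dom" "0 < Im t" "complexify (c1.pt t) \<notin> c1.N" "0 < v t" "c2.others_pos (c1.pt t)"
    "c1.chart t = c1.xgraph (c1.\<kappa>0 * of_real (c1.height t)) (complexify (c1.pt t))" if "t \<in> X0" for t
  proof -
    show t: "t \<in> c1.dom" "0 < Im t" using that unfolding X0_def by auto
    show off: "complexify (c1.pt t) \<notin> c1.N" by (rule c1.pt_off_nodes[OF t])
    show ch: "c1.chart t = c1.xgraph (c1.\<kappa>0 * of_real (c1.height t)) (complexify (c1.pt t))"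
      by (rule c1.chart_interior[OF t])
    have "c1.xgraph (c1.\<kappa>0 * of_real (c1.height t)) (complexify (c1.pt t)) \<in> c2.rng"
      using that ch unfolding X0_def by auto
    then have r: "v t \<noteq> 0" "c2.others_pos (c1.pt t)"
      unfolding c2.xgraph_in_rng_iff[OF off] v_def by auto
    then show "c2.others_pos (c1.pt t)" by simp
    have "c1.pt t \<in> C'" using c1.pt_in_chamber[OF t(1)] same by simp
    then have "0 \<le> v t" unfolding v_def c2.rv_m[symmetric] c2.C_eq using c2.corner_lines(2) by blast
    then show "0 < v t" using r by simp
  qed
  \<comment> \<open>The second coordinate is \<open>\<zeta>\<^sub>2 = \<sigma>\<^sub>2 y / (v\<^sub>2 \<surd>h\<^sub>2)\<close> with \<open>y = \<sigma>\<^sub>1 \<rho> \<zeta> \<surd>h\<^sub>1\<close>, which is \<open>\<zeta> R\<close>.\<close>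
  define R where "R t = c2.\<sigma> * (c1.\<sigma> * (Im t * sqrt (c1.h (c1.pt t)))) * inverse (v t * sqrt (c2.h (c1.pt t)))" for t
  have T: "c2.coord (c1.chart t) = Complex (Re t * R t) (v t)" if t: "t \<in> X0" for t
  proof -
    have "c2.coord (c1.chart t) = Complex (c2.\<sigma> * c1.height t / (v t * sqrt (c2.h (c1.pt t)))) (v t)"
      unfolding X0(6)[OF t] v_def kap[symmetric]
      using X0(3,4,5)[OF t] unfolding v_def by (intro c2.coord_xgraph) simp_all
    moreover have "c2.\<sigma> * c1.height t / (v t * sqrt (c2.h (c1.pt t))) = Re t * R t"
      unfolding R_def c1.height_def c1.slope_def divide_inverse by (simp add: mult_ac)
    ultimately show ?thesis by simp
  qed
  have C1h: "C1_on X0 (\<lambda>t. sqrt (c1.h (c1.pt t)))" "C1_on X0 (\<lambda>t. sqrt (c2.h (c1.pt t)))"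
    using X0 c1.h_pos c2.h_pos unfolding c1.dom_def
    by (auto intro!: C1_on_sqrt c1.C1_on_h c2.C1_on_h c1.C1_on_pt)
  have C1v: "C1_on X0 v"
    unfolding v_def[abs_def]
    by (intro C1_on_bounded_linear[OF bounded_linear_inner_right] C1_on_diff_const c1.C1_on_pt)
  have "C1_on X0 R"
    unfolding R_def[abs_def]
  proof (intro C1_on_mult C1_on_const C1_on_inverse C1h C1v C1_on_Im)
    fix t assume t: "t \<in> X0"
    show "v t * sqrt (c2.h (c1.pt t)) \<noteq> 0" using X0(4)[OF t] c2.h_pos[OF X0(5)[OF t]] by simp
  qed
  then obtain R' where R': "(R has_derivative R') (at z within X0)"
    using C1_on_differentiable zX unfolding differentiable_def by blast
  have v': "(v has_derivative (\<lambda>\<xi>. c2.b \<bullet> (c1.dpt z \<xi> - 0))) (at z within X0)"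
    unfolding v_def[abs_def]
    by (intro has_derivative_inner_right has_derivative_diff has_derivative_const c1.pt_has_derivative)
  define A where "A \<xi> = Complex (Re z * R' \<xi> + Re \<xi> * R z) (c2.b \<bullet> c1.dpt z \<xi>)" for \<xi>
  have "((\<lambda>t. Complex (Re t * R t) (v t)) has_derivative A) (at z within X0)"
    unfolding A_def[abs_def]
    by (intro has_derivative_Complex has_derivative_mult has_derivative_Re has_derivative_ident R')
      (use v' in simp)
  then have A: "((\<lambda>t. c2.coord (c1.chart t)) has_derivative A) (at z within X0)"
    by (rule has_derivative_transform[OF zX, rotated]) (rule T)
  define w where "w = c2.coord (c1.chart z)"
  have w: "w \<in> c2.dom" "c2.chart w = c1.chart z" using c2.chart_coord[OF z(2)] unfolding w_def by auto
  have fst_chart: "c1.pt t = c2.pt s" "c1.height t = c2.height s" if "c2.chart s = c1.chart t" for s t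
  proof -
    have "fst (c2.chart s) = fst (c1.chart t)" using that by simp
    then have "complexify (c2.pt s) = complexify (c1.pt t)"
      "c1.\<kappa>0 * of_real (c2.height s) = c1.\<kappa>0 * of_real (c1.height t)"
      unfolding c1.chart_def c2.chart_def kap by simp_all
    then show "c1.pt t = c2.pt s" "c1.height t = c2.height s" using c1.kappa0_nonzero by auto
  qed
  have wi: "Im w = v z" "Re w = Re z * R z" unfolding w_def T[OF zX] by simp_all
  have signs: "0 < c1.\<sigma> * c2.\<sigma> * R z"
  proof -
    have "c1.\<sigma> * c2.\<sigma> * R z = (c1.\<sigma> * c1.\<sigma>) * (c2.\<sigma> * c2.\<sigma>)
        * ((Im z * sqrt (c1.h (c1.pt z))) * inverse (v z * sqrt (c2.h (c1.pt z))))"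
      unfolding R_def by (simp add: mult_ac)
    moreover have "0 < c1.h (c1.pt z)" "0 < c2.h (c1.pt z)"
      using X0(1)[OF zX] c1.h_pos c2.h_pos X0(5)[OF zX] unfolding c1.dom_def by blast+
    ultimately show ?thesis using z(3) X0(4)[OF zX] by (simp add: c1.sigma_sq c2.sigma_sq)
  qed
  have "0 < cdet A"
  proof (cases "Re z = 0")
    case False
    \<comment> \<open>Both charts are positive for the same area form.\<close>
    have "((\<lambda>t. c2.pt (c2.coord (c1.chart t))) has_derivative (\<lambda>\<xi>. c2.dpt w (A \<xi>))) (at z within X0)"
      unfolding w_def by (rule has_derivative_in_compose[OF A c2.pt_has_derivative])
    then have "(c1.pt has_derivative (\<lambda>\<xi>. c2.dpt w (A \<xi>))) (at z within X0)"
    proof (rule has_derivative_transform[OF zX, rotated])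
      fix t assume "t \<in> X0"
      then have "c2.chart (c2.coord (c1.chart t)) = c1.chart t"
        using c2.chart_coord[of "c1.chart t"] unfolding X0_def by simp
      then show "c1.pt t = c2.pt (c2.coord (c1.chart t))" by (rule fst_chart(1))
    qed
    from uniq[OF c1.pt_has_derivative this]
    have d: "c1.dpt z = (\<lambda>\<xi>. c2.dpt w (A \<xi>))" .
    have "det2 (c1.dpt z 1) (c1.dpt z \<i>) = det2 (c2.dpt w 1) (c2.dpt w \<i>) * cdet A"
      unfolding d by (rule det2_linear_image[OF c2.linear_dpt])
    moreover have "0 < det2 (c1.dpt z 1) (c1.dpt z \<i>) * c1.height z"
      using c1.chart_orientation z False by blast
    moreover have "0 < det2 (c2.dpt w 1) (c2.dpt w \<i>) * c1.height z"
    proof -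
      have "Re w \<noteq> 0" unfolding wi using False signs by auto
      then show ?thesis
        unfolding fst_chart(2)[OF w(2)] using X0(4)[OF zX] by (intro c2.chart_orientation w(1)) (simp_all add: wi)
    qed
    ultimately have "0 < det2 (c2.dpt w 1) (c2.dpt w \<i>) * c1.height z * cdet A"
      by (simp add: mult_ac)
    then show ?thesis using \<open>0 < det2 (c2.dpt w 1) (c2.dpt w \<i>) * c1.height z\<close>
      by (simp add: zero_less_mult_iff)
  next
    case True
    \<comment> \<open>On the ramification curve \<open>u = 0\<close> both charts belong to the same line.\<close>
    have "c1.a \<bullet> (c1.pt z - P) = 0" unfolding c1.ab_pt True by simp
    then have "c1.rv l (c1.pt z) = 0" using c1.rv_l[of "c1.pt z"] c1.eps_nonzero by simp
    then have zl: "c1.pt z \<in> l" using c1.mem_line_iff c1.corner_lines(1) by blast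
    have "c2.a \<bullet> (c1.pt z - P') = 0" unfolding fst_chart(1)[OF w(2)] c2.ab_pt wi True by simp
    then have "c1.rv l' (c1.pt z) = 0" using c2.rv_l[of "c1.pt z"] c2.eps_nonzero by simp
    then have zl': "c1.pt z \<in> l'" using c1.mem_line_iff c2.corner_lines(1) by blast
    \<comment> \<open>A point of the ramification curve that is not a node lies on one line only.\<close>
    have ll: "l' = l"
      using c1.pt_off_nodes[OF z(1,3)] zl zl' c1.corner_lines(1) c2.corner_lines(1)
      unfolding c1.complexify_mem_nodes_iff by metis
    have aa: "c2.a = c1.a" unfolding c1.a_def c2.a_def ll same by simp
    have d1: "c1.dpt z 1 = 0" "c1.dpt z \<i> = c1.ev" unfolding c1.dpt_def True by simp_all
    have "cdet A = R z * (c2.b \<bullet> c1.ev)"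
      unfolding cdet_def A_def d1 True by simp
    also have "c2.b \<bullet> c1.ev = det2 c2.a c2.b / det2 c1.a c1.b"
      unfolding c1.ev_def aa by (simp add: inner_perp)
    also have "R z * (det2 c2.a c2.b / det2 c1.a c1.b)
        = (c1.\<sigma> * c2.\<sigma> * R z) * (c2.\<sigma> * det2 c2.a c2.b) / (c1.\<sigma> * det2 c1.a c1.b)"
    proof -
      have "c1.\<sigma> * c2.\<sigma> * R z * (c2.\<sigma> * det2 c2.a c2.b) / (c1.\<sigma> * det2 c1.a c1.b)
         = R z * (c2.\<sigma> * c2.\<sigma>) * det2 c2.a c2.b / det2 c1.a c1.b"
        using c1.sigma_cases by auto
      then show ?thesis by (simp add: c2.sigma_sq)
    qed
    also have "0 < \<dots>"
      by (rule divide_pos_pos[OF mult_pos_pos[OF signs c2.sigma_det] c1.sigma_det])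
    finally show ?thesis .
  qed
  then show ?thesis using A unfolding at by blast
qed

text \<open>Both charts belong to the same node, hence to the same pair of lines in the same or in the opposite
  order.\<close>

lemma transition_boundary:
  assumes same: "eps' = eps" "C' = C"
    and z: "z \<in> c1.dom" "c1.chart z \<in> c2.rng" "Im z = 0"
  shows "\<exists>A. ((\<lambda>t. c2.coord (c1.chart t)) has_derivative A) (at z within c1.dom \<inter> c1.chart -` c2.rng)
    \<and> 0 < cdet A"
proof -
  let ?X = "c1.dom \<inter> c1.chart -` c2.rng"
  have zX: "z \<in> ?X" using z by simp
  have "c1.pt z = P" using z(3) by (simp add: c1.pt_def)
  then have "c2.others_pos P"
    using z(2) unfolding c2.rng_def by (simp add: c1.chart_def)
  then have PP: "P' = P" using c2.node_others_pos[OF c1.P_node] by simp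
  have through: "k = l' \<or> k = m'" if "k \<in> \<A>" "P \<in> k" for k
    using c1.no_three_concurrent[OF c2.corner_lines(1,2) that(1) c2.corner_lines(3)] c2.corner_lines(4,5) that(2)
    unfolding PP by blast
  have "l = l' \<and> m = m' \<or> l = m' \<and> m = l'"
    using through[OF c1.corner_lines(1,4)] through[OF c1.corner_lines(2,5)] c1.corner_lines(3) by metis
  then show ?thesis
  proof
    assume e: "l = l' \<and> m = m'"
    then have lm: "l' = l" "m' = m" by simp_all
    have "c2.coord (c1.chart t) = t" if "t \<in> ?X" for t
      using c1.coord_chart[of t] that unfolding same PP lm by simp
    then have "((\<lambda>t. c2.coord (c1.chart t)) has_derivative (\<lambda>\<xi>. \<xi>)) (at z within ?X)"
      by (intro has_derivative_transform[OF zX _ has_derivative_ident])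
    then show ?thesis by (intro exI[of _ "\<lambda>\<xi>. \<xi>"]) (simp add: cdet_def)
  next
    assume e: "l = m' \<and> m = l'"
    then have sw: "l' = m" "m' = l" "P' = P" "eps' = eps" using PP same by simp_all
    have nz: "Re t \<noteq> 0" if "t \<in> ?X" for t
    proof -
      have "c2.V (plane_part (crep (snd (c1.chart t) c1.cP))) \<noteq> 0"
        using that PP unfolding c2.rng_def by simp
      then have "c1.U (complexify ((Re t)\<^sup>2 *\<^sub>R c1.eu + c1.ev)) \<noteq> 0"
        using c2.ratio_cpoint(2)[OF c1.join_chart_nonzero, of "c1.\<kappa>0 * of_real (c1.slope t)" t]
        unfolding c1.chart_coordinate swapped_ab[OF sw] by simp
      then show ?thesis
        by (auto simp: complex_linear_part_complexify inner_add_right c1.dual_basis)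
    qed
    have T: "c2.coord (c1.chart t) = Complex (- (1 / Re t)) (Im t * (Re t)\<^sup>2)" if "t \<in> ?X" for t
      using swapped_chart[OF sw _ nz[OF that]] c2.coord_chart that by (metis IntD1)
    let ?A = "\<lambda>\<xi>. Complex (Re \<xi> / (Re z)\<^sup>2) (Im z * (2 * Re z * Re \<xi>) + Im \<xi> * (Re z)\<^sup>2)"
    have "((\<lambda>t. Complex (- (1 / Re t)) (Im t * (Re t)\<^sup>2)) has_derivative ?A) (at z within ?X)"
    proof (rule has_derivative_Complex)
      show "((\<lambda>t. - (1 / Re t)) has_derivative (\<lambda>\<xi>. Re \<xi> / (Re z)\<^sup>2)) (at z within ?X)"
        using nz[OF zX] by (auto intro!: derivative_eq_intros simp: power2_eq_square field_simps)
      show "((\<lambda>t. Im t * (Re t)\<^sup>2) has_derivative (\<lambda>\<xi>. Im z * (2 * Re z * Re \<xi>) + Im \<xi> * (Re z)\<^sup>2)) (at z within ?X)"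
        by (auto intro!: derivative_eq_intros simp: algebra_simps)
    qed
    then have "((\<lambda>t. c2.coord (c1.chart t)) has_derivative ?A) (at z within ?X)"
      by (rule has_derivative_transform[OF zX, rotated]) (rule T)
    moreover have "cdet ?A = 1" using nz[OF zX] by (simp add: cdet_def)
    ultimately show ?thesis by (intro exI[of _ ?A]) simp
  qed
qed

lemma charts_compatible:
  assumes same: "eps' = eps" "C' = C"
  shows "orientation_compatible (c1.dom, c1.chart) (c2.dom, c2.chart)"
  unfolding orientation_compatible_iff
proof (intro ballI impI)
  fix z assume z: "z \<in> c1.dom" "c1.chart z \<in> c2.chart ` c2.dom"
  let ?X = "c1.dom \<inter> c1.chart -` (c2.chart ` c2.dom)"
  have "\<exists>A. ((\<lambda>t. c2.coord (c1.chart t)) has_derivative A) (at z within ?X) \<and> 0 < cdet A"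
  proof (cases "Im z = 0")
    case True
    then show ?thesis using transition_boundary[OF same z(1)] z(2) unfolding c2.chart_image by blast
  next
    case False
    then have "0 < Im z" using z(1) by (simp add: c1.dom_def)
    then show ?thesis using transition_interior[OF same z(1)] z(2) unfolding c2.chart_image by blast
  qed
  then obtain A where A: "((\<lambda>t. c2.coord (c1.chart t)) has_derivative A) (at z within ?X)" "0 < cdet A"
    by blast
  have zX: "z \<in> ?X" using z by simp
  have "((\<lambda>t. inv_into c2.dom c2.chart (c1.chart t)) has_derivative A) (at z within ?X)"
    by (rule has_derivative_transform[OF zX _ A(1)]) (use c2.inv_chart in auto)
  then show "\<exists>A. ((\<lambda>t. inv_into c2.dom c2.chart (c1.chart t)) has_derivative A) (at z within ?X) \<and> 0 < cdet A"
    using A(2) by blast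
qed

end

context nodal_lines
begin

definition corner_atlas :: "(real ^ 2) set \<Rightarrow> ((real ^ 2) set \<Rightarrow> real) \<Rightarrow> surface_chart set" where
  "corner_atlas C eps = {(nodal_corner.dom \<A> lam eps l m P, nodal_corner.chart \<A> lam eps l m P) | l m P.
     corner C l m P}"

lemma nodal_cornerI: "has_signs C eps \<Longrightarrow> corner C l m P \<Longrightarrow> nodal_corner \<A> lam C eps l m P"
  by unfold_locales

text \<open>Every point of the lifted chamber lies in a corner chart, because a bounded chamber has a
  corner on each of its edges.\<close>

lemma corner_atlas_covers:
  assumes s: "has_signs C eps"
  shows "lifted_chamber \<A> lam C \<subseteq> (\<Union>(U, g)\<in>corner_atlas C eps. g ` U)"
proof
  fix x assume x: "x \<in> lifted_chamber \<A> lam C"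
  have C: "C = {x. \<forall>l\<in>\<A>. 0 \<le> eps l * rv l x}" using s unfolding has_signs_def by (elim conjE)
  have xX: "x \<in> resolution \<A> lam" using x unfolding lifted_chamber_def by blast
  obtain r where r: "r \<in> C" "snd (fst x) = complexify r" using lifted_chamber_fst[OF s x] by blast
  have "\<exists>l m P. corner C l m P \<and> x \<in> nodal_corner.chart \<A> lam eps l m P ` nodal_corner.dom \<A> lam eps l m P"
  proof (cases "complexify r \<in> N")
    case True
    then obtain l m where "l \<in> \<A>" "m \<in> \<A>" "l \<noteq> m" "r \<in> l" "r \<in> m"
      unfolding complexify_mem_nodes_iff by blast
    then have c: "corner C l m r" "corner C m l r" using r unfolding corner_def by blast+
    interpret corner_pair \<A> lam C eps l m r C eps m l r
      unfolding corner_pair_def using nodal_cornerI[OF s] c by blast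
    obtain u v where uv: "(u, v) \<noteq> (0, 0)" "x = c1.E u v"
      using c1.resolution_over_P[OF xX r(2)] by blast
    show ?thesis
    proof (cases "v = 0")
      case False
      then have "x \<in> c1.rng" using c1.E_in_rng_iff[OF uv(1)] x uv(2) by simp
      then show ?thesis using c(1) unfolding c1.chart_image[symmetric] by blast
    next
      case True
      have e: "c2.E v u = x" using swapped_E[OF refl refl refl refl] uv(2) by simp
      then have "x \<in> c2.rng" using c2.E_in_rng_iff[of v u] x uv(1) True by auto
      then show ?thesis using c(2) unfolding c2.chart_image[symmetric] by blast
    qed
  next
    case False
    obtain l m P where c: "corner C l m P" and off: "\<And>k. k \<in> \<A> \<Longrightarrow> k \<noteq> l \<Longrightarrow> r \<notin> k"
    proof (cases "\<exists>l\<in>\<A>. r \<in> l")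
      case True
      then obtain l where l: "l \<in> \<A>" "r \<in> l" by blast
      obtain m P where c: "corner C l m P" by (rule corner_on_edge[OF s r(1) l(2,1)])
      have "r \<notin> k" if "k \<in> \<A>" "k \<noteq> l" for k
        using False l that unfolding complexify_mem_nodes_iff by blast
      then show ?thesis using that[OF c] by blast
    next
      case False
      obtain l m P where c: "corner C l m P" by (rule corner_exists[OF s])
      then show ?thesis using that[OF c] False by blast
    qed
    interpret nodal_corner \<A> lam C eps l m P by (rule nodal_cornerI[OF s c])
    have pos: "0 < eps k * rv k r" if "k \<in> \<A>" "k \<noteq> l" for k
    proof -
      have "rv k r \<noteq> 0" using off[OF that] mem_line_iff that(1) by blast
      moreover have "0 \<le> eps k * rv k r" using r(1) that(1) unfolding C by blast
      ultimately show ?thesis using eps_nonzero[of k] by (simp add: order_less_le)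
    qed
    have "b \<bullet> (r - P) \<noteq> 0" using pos[OF corner_lines(2)] corner_lines(3) unfolding rv_m by simp
    moreover have "others_pos r" unfolding others_pos_def using pos by blast
    moreover have "x = xgraph (fst (fst x)) (complexify r)"
      using resolution_off_nodes[OF xX] False r(2) by simp
    ultimately have "x \<in> rng" using xgraph_in_rng_iff[OF False] x by metis
    then show ?thesis using c unfolding chart_image[symmetric] by blast
  qed
  then show "x \<in> (\<Union>(U, g)\<in>corner_atlas C eps. g ` U)" unfolding corner_atlas_def by blast
qed

lemma corner_atlas_charts:
  assumes s: "has_signs C eps"
  shows "corner_atlas C eps \<subseteq> surface_charts N (lifted_chamber \<A> lam C)"
  unfolding corner_atlas_def using nodal_corner.corner_chart[OF nodal_cornerI[OF s]] by blast

lemma corner_atlas_compatible: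
  assumes s: "has_signs C eps" and pq: "p \<in> corner_atlas C eps" "q \<in> corner_atlas C eps"
  shows "orientation_compatible p q"
proof -
  obtain l m P l' m' P' where c: "corner C l m P" "corner C l' m' P'"
    and e: "p = (nodal_corner.dom \<A> lam eps l m P, nodal_corner.chart \<A> lam eps l m P)"
      "q = (nodal_corner.dom \<A> lam eps l' m' P', nodal_corner.chart \<A> lam eps l' m' P')"
    using pq unfolding corner_atlas_def by blast
  interpret corner_pair \<A> lam C eps l m P C eps l' m' P'
    unfolding corner_pair_def using nodal_cornerI[OF s] c by blast
  show ?thesis unfolding e by (rule charts_compatible[OF refl refl])
qed

definition chamber_orientation :: "(real ^ 2) set \<Rightarrow> ((real ^ 2) set \<Rightarrow> real) \<Rightarrow> surface_chart set" where
  "chamber_orientation C eps = generated_orientation N (lifted_chamber \<A> lam C) (corner_atlas C eps)"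

lemma is_orientation_chamber:
  assumes "has_signs C eps"
  shows "is_orientation N (lifted_chamber \<A> lam C) (chamber_orientation C eps)"
    "corner_atlas C eps \<subseteq> chamber_orientation C eps"
  unfolding chamber_orientation_def
  by (rule is_orientation_generated[OF corner_atlas_charts[OF assms] corner_atlas_covers[OF assms]
        corner_atlas_compatible[OF assms]]; assumption)+

end

section \<open>The affine coordinate of the exceptional sphere\<close>

context nodal_corner
begin

text \<open>The affine coordinate \<open>s / t\<close> on the exceptional sphere, defined where \<open>t \<noteq> 0\<close>.\<close>

definition finite_part :: "xpoint \<Rightarrow> bool" where
  "finite_part x \<longleftrightarrow> V (plane_part (crep (snd x cP))) \<noteq> 0"

definition zc :: "xpoint \<Rightarrow> complex" where
  "zc x = ratio (snd x cP) / \<kappa>"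

text \<open>A positive multiple of \<open>Im (s * cnj t)\<close>, hence of \<open>Im (s / t)\<close> where \<open>t \<noteq> 0\<close>.\<close>

definition side :: "xpoint \<Rightarrow> real" where
  "side x = Im (crep (snd x cP) $ 1 / \<kappa> * cnj (V (plane_part (crep (snd x cP)))))"

definition hemisphere :: "real \<Rightarrow> xpoint set" where
  "hemisphere \<tau> = {x \<in> D. 0 \<le> \<tau> * side x}"

definition open_hemisphere :: "real \<Rightarrow> xpoint set" where
  "open_hemisphere \<tau> = {x \<in> D. 0 < \<tau> * side x}"

lemma E_vector_nonzero: "(s, t) \<noteq> (0, 0) \<Longrightarrow> join (\<kappa> * s * t) (dir s t) \<noteq> 0"
  by (auto simp: join_eq_0_iff dir_eq_0_iff)

lemma finite_part_E: "(s, t) \<noteq> (0, 0) \<Longrightarrow> finite_part (E s t) \<longleftrightarrow> t \<noteq> 0"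
  unfolding finite_part_def E_coordinate using ratio_cpoint(2)[OF E_vector_nonzero] by simp

lemma zc_E: "t \<noteq> 0 \<Longrightarrow> zc (E s t) = s / t"
  unfolding zc_def E_coordinate using kappa_nonzero
  by (subst ratio_cpoint(1)[OF E_vector_nonzero]) (auto simp: power2_eq_square)

text \<open>Rescaling a representative by \<open>c\<close> multiplies \<open>w * cnj V\<close> by the positive number \<open>c * cnj c\<close>.\<close>

lemma sgn_side_E:
  assumes "(s, t) \<noteq> (0, 0)"
  shows "sgn (side (E s t)) = sgn (Im (s * cnj t))"
proof -
  let ?v = "join (\<kappa> * s * t) (dir s t)"
  obtain c where c: "c \<noteq> 0" "crep (cpoint ?v) = c *s ?v" by (rule crep_cpoint[OF E_vector_nonzero[OF assms]])
  have "crep (cpoint ?v) $ 1 / \<kappa> * cnj (V (plane_part (crep (cpoint ?v))))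
      = of_real ((norm c)\<^sup>2 * (norm t)\<^sup>2) * (s * cnj t)"
    unfolding c(2) of_real_mult complex_norm_square plane_part_scale complex_linear_part_scale
    using kappa_nonzero by (simp add: power2_eq_square mult_ac)
  then have "side (E s t) = (norm c)\<^sup>2 * (norm t)\<^sup>2 * Im (s * cnj t)"
    unfolding side_def E_coordinate by (simp only: Im_complex_of_real Re_complex_of_real times_complex.sel)
  then show ?thesis using c(1) by (cases "t = 0") (simp_all add: sgn_mult)
qed

lemma signed_side_E:
  assumes "(s, t) \<noteq> (0, 0)"
  shows "0 < \<tau> * side (E s t) \<longleftrightarrow> 0 < \<tau> * Im (s * cnj t)" "0 \<le> \<tau> * side (E s t) \<longleftrightarrow> 0 \<le> \<tau> * Im (s * cnj t)"
proof -
  have "sgn (\<tau> * side (E s t)) = sgn (\<tau> * Im (s * cnj t))"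
    by (simp only: sgn_mult sgn_side_E[OF assms])
  then show "0 < \<tau> * side (E s t) \<longleftrightarrow> 0 < \<tau> * Im (s * cnj t)"
    "0 \<le> \<tau> * side (E s t) \<longleftrightarrow> 0 \<le> \<tau> * Im (s * cnj t)"
    by (metis sgn_greater) (metis sgn_less linorder_not_less \<open>sgn (\<tau> * side (E s t)) = _\<close>)
qed

lemma D_cases:
  assumes "x \<in> D"
  obtains s t where "(s, t) \<noteq> (0, 0)" "x = E s t"
  using assms unfolding exceptional_sphere_eq by blast

lemma E_in_D: "(s, t) \<noteq> (0, 0) \<Longrightarrow> E s t \<in> D"
  unfolding exceptional_sphere_eq by blast

lemma E_in_S_iff: "(s, t) \<noteq> (0, 0) \<Longrightarrow> E s t \<in> S \<longleftrightarrow> Im (s * cnj t) = 0"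
  unfolding boundary_circle_def using E_in_D E_in_lifted_chamber_iff by simp

lemma finite_part_eq_E:
  assumes "x \<in> D" "finite_part x"
  shows "x = E (zc x) 1"
proof -
  obtain s t where st: "(s, t) \<noteq> (0, 0)" "x = E s t" by (rule D_cases[OF assms(1)])
  then have t: "t \<noteq> 0" using assms(2) finite_part_E by blast
  then show ?thesis using E_scale[of "1 / t" s t] st zc_E[OF t, of s] by simp
qed

lemma S_side: "S = {x \<in> D. side x = 0}"
proof (intro equalityI subsetI)
  fix x assume "x \<in> S"
  then have x: "x \<in> D" unfolding boundary_circle_def by blast
  obtain s t where st: "(s, t) \<noteq> (0, 0)" "x = E s t" by (rule D_cases[OF x])
  then show "x \<in> {x \<in> D. side x = 0}"
    using \<open>x \<in> S\<close> x E_in_S_iff[OF st(1)] sgn_side_E[OF st(1)] by (simp add: sgn_zero_iff)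
next
  fix x assume "x \<in> {x \<in> D. side x = 0}"
  then have x: "x \<in> D" "side x = 0" by simp_all
  obtain s t where st: "(s, t) \<noteq> (0, 0)" "x = E s t" by (rule D_cases[OF x(1)])
  then have "sgn (Im (s * cnj t)) = 0" using sgn_side_E[OF st(1)] x(2) by simp
  then show "x \<in> S" using E_in_S_iff[OF st(1)] st(2) by (simp add: sgn_zero_iff)
qed

lemma open_finite_part: "open {x. finite_part x}"
  unfolding finite_part_def by (rule open_V_coordinate)

lemma continuous_on_zc: "continuous_on {x. finite_part x} zc"
proof -
  have "continuous_on {x. finite_part x} (\<lambda>x :: xpoint. ratio (snd x cP))"
    by (rule continuous_on_compose2[OF continuous_on_ratio continuous_on_coordinate])
      (auto simp: finite_part_def)
  then show ?thesis unfolding zc_def[abs_def] using kappa_nonzero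
    by (intro continuous_on_divide continuous_on_const) simp_all
qed

lemma open_side: "open {x. 0 < \<tau> * side x}"
proof -
  have c: "continuous_on UNIV (\<lambda>p :: complex ^ 3. V (plane_part p))"
    by (rule bounded_linear.continuous_on[OF bounded_linear_compose[OF
          bounded_linear_complex_linear_part bounded_linear_plane_part] continuous_on_id])
  have opn: "open {p :: 3 cproj. 0 < \<tau> * Im (crep p $ 1 / \<kappa> * cnj (V (plane_part (crep p))))}"
  proof (rule open_Collect_crep_pos)
    show "continuous_on UNIV (\<lambda>p :: complex ^ 3. \<tau> * Im (p $ 1 / \<kappa> * cnj (V (plane_part p))))"
      using kappa_nonzero by (intro continuous_intros c) simp_all
    fix v :: "complex ^ 3" and c :: complex assume c: "c \<noteq> 0"
    have "(c *s v) $ 1 / \<kappa> * cnj (V (plane_part (c *s v))) = of_real ((norm c)\<^sup>2) * (v $ 1 / \<kappa> * cnj (V (plane_part v)))"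
      unfolding complex_norm_square plane_part_scale complex_linear_part_scale by simp
    then have "\<tau> * Im ((c *s v) $ 1 / \<kappa> * cnj (V (plane_part (c *s v))))
        = (norm c)\<^sup>2 * (\<tau> * Im (v $ 1 / \<kappa> * cnj (V (plane_part v))))"
      by (simp only: Im_complex_of_real Re_complex_of_real times_complex.sel) simp
    then show "0 < \<tau> * Im ((c *s v) $ 1 / \<kappa> * cnj (V (plane_part (c *s v))))
        \<longleftrightarrow> 0 < \<tau> * Im (v $ 1 / \<kappa> * cnj (V (plane_part v)))"
      using c by (simp only: zero_less_mult_iff) simp
  qed
  have "open ((\<lambda>x :: xpoint. snd x cP) -` {p. 0 < \<tau> * Im (crep p $ 1 / \<kappa> * cnj (V (plane_part (crep p))))})"
    by (rule open_vimage[OF opn continuous_on_coordinate])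
  then show ?thesis unfolding side_def vimage_def mem_Collect_eq .
qed

section \<open>Affine parametrizations of the sphere, the hemispheres and the circle\<close>

definition liftE :: "complex ^ 2 \<Rightarrow> complex \<Rightarrow> complex ^ 3" where
  "liftE P' z = (if P' = cP then join (\<kappa> * z) (dir z 1) else join 0 (cP - P'))"

lemma liftE_nonzero: "liftE P' z \<noteq> 0"
  using E_vector_nonzero[of z 1] unfolding liftE_def by (simp add: join_eq_0_iff)

lemma snd_E_affine: "P' \<in> N \<Longrightarrow> snd (E z 1) P' = cpoint (liftE P' z)"
  unfolding E_def xexc_def liftE_def by simp

lemma C1_on_liftE: "C1_on W f \<Longrightarrow> C1_on W (\<lambda>t. liftE P' (f t))"
proof (cases "P' = cP")
  case True
  assume f: "C1_on W f"
  have "C1_on W (\<lambda>t. (f t)\<^sup>2 *s Eu)"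
    using C1_on_bilinear[OF bounded_bilinear_scale C1_on_power2[OF f] C1_on_const] .
  then have "C1_on W (\<lambda>t. join (\<kappa> * f t) ((f t)\<^sup>2 *s Eu + 1\<^sup>2 *s Ev))"
    by (intro C1_on_join C1_on_mult C1_on_const C1_on_add f)
  then show ?thesis unfolding liftE_def dir_def using True by simp
qed (simp add: liftE_def C1_on_const)

lemma continuous_on_E_affine: "continuous_on W (\<lambda>z. E z 1)"
proof -
  have "continuous_on W (\<lambda>z. (fst (E z 1), snd (E z 1)))"
  proof (intro continuous_on_Pair continuous_on_coordinatewise_then_product)
    show "continuous_on W (\<lambda>z. fst (E z 1))" by (simp add: E_fst continuous_on_const)
    fix P'
    show "continuous_on W (\<lambda>z. snd (E z 1) P')"
    proof (cases "P' \<in> N")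
      case True
      then show ?thesis unfolding snd_E_affine[OF True]
        using liftE_nonzero by (intro continuous_on_cpoint C1_on_continuous_on C1_on_liftE C1_on_id)
    next
      case False
      then show ?thesis by (simp add: E_def xexc_def continuous_on_const)
    qed
  qed
  then show ?thesis by simp
qed

text \<open>The affine coordinate \<open>s / t\<close> parametrizes the sphere, a hemisphere and the circle alike. The map
  \<open>\<iota>\<close> embeds the parameter domain into the complex plane, and \<open>\<mu>\<close> is its inverse.\<close>

lemma E_affine_local_param:
  fixes W :: "'a::euclidean_space set" and \<iota> :: "'a \<Rightarrow> complex"
  assumes \<iota>: "bounded_linear \<iota>" and inv: "\<And>z. z \<in> W \<Longrightarrow> \<mu> (\<iota> z) = z" "continuous_on UNIV \<mu>"
    and inj: "\<And>\<xi>. \<iota> \<xi> = 0 \<Longrightarrow> \<xi> = 0" and reach: "\<And>z. z \<in> W \<Longrightarrow> reachable_along_axes W z"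
    and K: "K \<subseteq> D" and img: "\<And>x. x \<in> K \<Longrightarrow> finite_part x \<Longrightarrow> \<mu> (zc x) \<in> W \<and> \<iota> (\<mu> (zc x)) = zc x"
    and WK: "\<And>z. z \<in> W \<Longrightarrow> E (\<iota> z) 1 \<in> K"
  shows "local_param N K W (\<lambda>z. E (\<iota> z) 1)"
    "(\<lambda>z. E (\<iota> z) 1) ` W = K \<inter> {x. finite_part x}"
    "\<And>x. x \<in> K \<Longrightarrow> finite_part x \<Longrightarrow> inv_into W (\<lambda>z. E (\<iota> z) 1) x = \<mu> (zc x)"
proof -
  let ?g = "\<lambda>z. E (\<iota> z) 1"
  have left: "\<mu> (zc (?g z)) = z" if "z \<in> W" for z using inv(1)[OF that] by (simp add: zc_E)
  have right: "?g (\<mu> (zc x)) = x" if "x \<in> K" "finite_part x" for x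
    using img[OF that] finite_part_eq_E[of x] that K by auto
  show image: "?g ` W = K \<inter> {x. finite_part x}"
  proof (intro equalityI subsetI)
    fix x assume "x \<in> ?g ` W"
    then show "x \<in> K \<inter> {x. finite_part x}" using WK finite_part_E by auto
  next
    fix x assume "x \<in> K \<inter> {x. finite_part x}"
    then have x: "x \<in> K" "finite_part x" by simp_all
    show "x \<in> ?g ` W" using right[OF x] img[OF x] by (intro image_eqI[where x = "\<mu> (zc x)"]) simp_all
  qed
  have "openin (top_of_set K) (?g ` W)" unfolding image using open_finite_part openin_open by blast
  moreover have "homeomorphism W (?g ` W) ?g (\<lambda>x. \<mu> (zc x))"
    unfolding homeomorphism_def
  proof (intro conjI ballI)
    show "continuous_on W ?g"
      by (rule continuous_on_compose2[OF continuous_on_E_affine[of UNIV] bounded_linear.continuous_on[OF \<iota> continuous_on_id]]) simp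
    have "continuous_on (?g ` W) zc" using continuous_on_zc unfolding image by (rule continuous_on_subset) simp
    then show "continuous_on (?g ` W) (\<lambda>x. \<mu> (zc x))"
      by (rule continuous_on_compose2[OF inv(2)]) simp
    show "(\<lambda>x. \<mu> (zc x)) ` ?g ` W = W" unfolding image_image using left by simp
    show "\<mu> (zc (?g z)) = z" if "z \<in> W" for z by (rule left[OF that])
    show "?g (\<mu> (zc x)) = x" if "x \<in> ?g ` W" for x using that right unfolding image by simp
  qed simp
  moreover have "C1_immersion N W ?g"
  proof (rule C1_immersionI)
    show "lifts_to N W ?g (\<lambda>P' z. liftE P' (\<iota> z))"
      unfolding lifts_to_def using liftE_nonzero snd_E_affine by blast
    show "C1_on W (\<lambda>z. fst (?g z))" by (simp add: E_fst C1_on_const)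
    show "C1_on W (\<lambda>z. liftE P' (\<iota> z))" for P' by (intro C1_on_liftE C1_on_linear \<iota>)
    fix z q' h' \<xi>
    assume z: "z \<in> W" and h': "\<And>P'. P' \<in> N \<Longrightarrow> ((\<lambda>z. liftE P' (\<iota> z)) has_derivative h' P') (at z within W)"
      and c: "\<And>P'. P' \<in> N \<Longrightarrow> \<exists>c. h' P' \<xi> = c *s liftE P' (\<iota> z)"
    note uniq = derivative_unique_reachable[OF reach[OF z]]
    have lE: "liftE cP (\<iota> t) = join (\<kappa> * \<iota> t) (dir (\<iota> t) 1)" for t by (simp add: liftE_def)
    note g = h'[OF P_node, unfolded lE]
    obtain c where c: "h' cP \<xi> = c *s join (\<kappa> * \<iota> z) (dir (\<iota> z) 1)" using c[OF P_node] lE by metis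
    have "((\<lambda>t. V (plane_part (join (\<kappa> * \<iota> t) (dir (\<iota> t) 1)))) has_derivative (\<lambda>\<xi>. V (plane_part (h' cP \<xi>)))) (at z within W)"
      by (rule bounded_linear.has_derivative[OF bounded_linear_compose[OF
            bounded_linear_complex_linear_part bounded_linear_plane_part] g])
    then have "((\<lambda>t. 1) has_derivative (\<lambda>\<xi>. V (plane_part (h' cP \<xi>)))) (at z within W)" by simp
    from uniq[OF this has_derivative_const] have "V (plane_part (h' cP \<xi>)) = 0" by (rule fun_cong)
    then have "c = 0" unfolding c plane_part_scale complex_linear_part_scale by simp
    then have g0: "h' cP \<xi> = 0" using c by simp
    have "((\<lambda>t. join (\<kappa> * \<iota> t) (dir (\<iota> t) 1) $ 1) has_derivative (\<lambda>\<xi>. h' cP \<xi> $ 1)) (at z within W)"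
      by (rule bounded_linear.has_derivative[OF bounded_linear_vec_nth g])
    then have "((\<lambda>t. \<kappa> * \<iota> t) has_derivative (\<lambda>\<xi>. h' cP \<xi> $ 1)) (at z within W)" by simp
    moreover have "((\<lambda>t. \<kappa> * \<iota> t) has_derivative (\<lambda>\<xi>. \<kappa> * \<iota> \<xi>)) (at z within W)"
      by (intro has_derivative_mult_right bounded_linear_imp_has_derivative \<iota>)
    ultimately have "(\<lambda>\<xi>. h' cP \<xi> $ 1) = (\<lambda>\<xi>. \<kappa> * \<iota> \<xi>)" by (rule uniq)
    then have "h' cP \<xi> $ 1 = \<kappa> * \<iota> \<xi>" by (rule fun_cong)
    then have "\<iota> \<xi> = 0" using g0 kappa_nonzero by simp
    then show "\<xi> = 0" by (rule inj)
  qed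
  ultimately show lp: "local_param N K W ?g" unfolding local_param_def by blast
  show "inv_into W ?g x = \<mu> (zc x)" if x: "x \<in> K" "finite_part x" for x
  proof -
    have "inv_into W ?g (?g (\<mu> (zc x))) = \<mu> (zc x)"
      using local_paramD(3)[OF lp] img[OF x] by (intro inv_into_f_f) simp_all
    then show ?thesis by (simp add: right[OF x])
  qed
qed

abbreviation half_plane :: "complex set" where "half_plane \<equiv> {z. 0 \<le> Im z}"

definition Echart :: "real \<Rightarrow> complex \<Rightarrow> xpoint" where
  "Echart \<tau> z = E (of_real \<tau> * z) 1"

context
  fixes \<tau> :: real assumes tau: "\<tau> = 1 \<or> \<tau> = -1"
begin

lemma tau_sq: "complex_of_real \<tau> * (of_real \<tau> * z) = z"
  using tau by auto

lemma sphere_param: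
  "local_param N D UNIV (Echart \<tau>)" "Echart \<tau> ` UNIV = D \<inter> {x. finite_part x}"
  "\<And>x. x \<in> D \<Longrightarrow> finite_part x \<Longrightarrow> inv_into UNIV (Echart \<tau>) x = of_real \<tau> * zc x"
proof -
  have 1: "bounded_linear (\<lambda>z. complex_of_real \<tau> * z)" by (rule bounded_linear_mult_right)
  have 2: "continuous_on UNIV (\<lambda>z. complex_of_real \<tau> * z)" by (intro continuous_intros)
  have e: "Echart \<tau> = (\<lambda>z. E (of_real \<tau> * z) 1)" by (rule ext) (simp add: Echart_def)
  note * = E_affine_local_param[of "\<lambda>z. complex_of_real \<tau> * z" UNIV "\<lambda>z. complex_of_real \<tau> * z" D, OF 1 tau_sq 2]
  show "local_param N D UNIV (Echart \<tau>)" unfolding e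
    by (rule *(1)) (use tau E_in_D in \<open>auto intro: reachable_open\<close>)
  show "Echart \<tau> ` UNIV = D \<inter> {x. finite_part x}" unfolding e
    by (rule *(2)) (use tau E_in_D in \<open>auto intro: reachable_open\<close>)
  show "inv_into UNIV (Echart \<tau>) x = of_real \<tau> * zc x" if "x \<in> D" "finite_part x" for x unfolding e
    by (rule *(3)[OF _ _ _ _ _ that]) (use tau E_in_D in \<open>auto intro: reachable_open\<close>)
qed

lemma hemisphere_param:
  "(half_plane, Echart \<tau>) \<in> surface_charts N (hemisphere \<tau>)"
  "Echart \<tau> ` half_plane = hemisphere \<tau> \<inter> {x. finite_part x}"
  "\<And>x. x \<in> hemisphere \<tau> \<Longrightarrow> finite_part x \<Longrightarrow> inv_into half_plane (Echart \<tau>) x = of_real \<tau> * zc x"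
proof -
  have 1: "bounded_linear (\<lambda>z. complex_of_real \<tau> * z)" by (rule bounded_linear_mult_right)
  have 2: "continuous_on UNIV (\<lambda>z. complex_of_real \<tau> * z)" by (intro continuous_intros)
  have e: "Echart \<tau> = (\<lambda>z. E (of_real \<tau> * z) 1)" by (rule ext) (simp add: Echart_def)
  have r: "reachable_along_axes half_plane z" if "z \<in> half_plane" for z
    by (rule reachable_half_plane[OF _ that]) (rule openin_subtopology_self)
  have inj: "\<xi> = 0" if "complex_of_real \<tau> * \<xi> = 0" for \<xi> using that tau by auto
  have sub: "hemisphere \<tau> \<subseteq> D" unfolding hemisphere_def by blast
  have img: "of_real \<tau> * zc x \<in> half_plane \<and> of_real \<tau> * (of_real \<tau> * zc x) = zc x"
    if "x \<in> hemisphere \<tau>" "finite_part x" for x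
  proof -
    have x: "x \<in> D" "0 \<le> \<tau> * side x" using that unfolding hemisphere_def by simp_all
    have "0 \<le> \<tau> * side (E (zc x) 1)" using x finite_part_eq_E[OF x(1) that(2)] by simp
    then have "0 \<le> \<tau> * Im (zc x)" using signed_side_E(2)[of "zc x" 1 \<tau>] by simp
    then show ?thesis using tau_sq by simp
  qed
  have WK: "E (of_real \<tau> * z) 1 \<in> hemisphere \<tau>" if "z \<in> half_plane" for z
  proof -
    have "\<tau> * (\<tau> * Im z) = Im z" using tau by auto
    then have "0 \<le> \<tau> * Im (of_real \<tau> * z * cnj 1)" using that tau by auto
    then have "0 \<le> \<tau> * side (E (of_real \<tau> * z) 1)"
      by (subst signed_side_E(2)) simp_all
    then show ?thesis unfolding hemisphere_def using E_in_D by simp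
  qed
  note * = E_affine_local_param[of "\<lambda>z. complex_of_real \<tau> * z" half_plane "\<lambda>z. complex_of_real \<tau> * z" "hemisphere \<tau>",
      OF 1 tau_sq 2 inj r sub img WK]
  show "(half_plane, Echart \<tau>) \<in> surface_charts N (hemisphere \<tau>)"
    unfolding surface_charts_def e using *(1) openin_subtopology_self by simp
  show "Echart \<tau> ` half_plane = hemisphere \<tau> \<inter> {x. finite_part x}" unfolding e by (rule *(2))
  show "inv_into half_plane (Echart \<tau>) x = of_real \<tau> * zc x" if "x \<in> hemisphere \<tau>" "finite_part x" for x
    unfolding e by (rule *(3)) (use that in simp_all)
qed

lemma Echart_holomorphic: "(UNIV, Echart \<tau>) \<in> holomorphic_charts N D"
proof -
  have "lifts_to N UNIV (Echart \<tau>) (\<lambda>P' z. liftE P' (of_real \<tau> * z))"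
    unfolding lifts_to_def Echart_def using liftE_nonzero snd_E_affine by blast
  moreover have "(\<lambda>t. liftE P' (of_real \<tau> * t) $ i) holomorphic_on UNIV" for P' i
  proof (cases "P' = cP")
    case True
    have "(\<lambda>t. join (\<kappa> * (of_real \<tau> * t)) (dir (of_real \<tau> * t) 1) $ i) holomorphic_on UNIV"
      using exhaust_3[of i]
    proof (elim disjE)
    qed (auto simp: dir_def intro!: holomorphic_intros)
    then show ?thesis using True by (simp add: liftE_def)
  qed (simp add: liftE_def)
  moreover have "(\<lambda>t. fst (fst (Echart \<tau> t))) holomorphic_on UNIV"
    "(\<lambda>t. snd (fst (Echart \<tau> t)) $ i) holomorphic_on UNIV" for i
    by (simp_all add: Echart_def E_fst)
  ultimately have "\<forall>z\<in>UNIV. \<exists>V h. open V \<and> z \<in> V \<and> V \<subseteq> UNIV \<and> lifts_to N V (Echart \<tau>) h \<and>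
        (\<lambda>t. fst (fst (Echart \<tau> t))) holomorphic_on V \<and>
        (\<forall>i. (\<lambda>t. snd (fst (Echart \<tau> t)) $ i) holomorphic_on V) \<and>
        (\<forall>P\<in>N. \<forall>i. (\<lambda>t. h P t $ i) holomorphic_on V)"
    by (intro ballI exI[of _ UNIV] exI[of _ "\<lambda>P' z. liftE P' (of_real \<tau> * z)"]) simp
  then show ?thesis unfolding holomorphic_charts_def using sphere_param(1) by simp
qed

text \<open>In an arbitrary holomorphic chart the affine coordinate is an injective holomorphic function,
  so the inverse transition map is holomorphic as well and preserves the orientation.\<close>

lemma Echart_compatible_holomorphic:
  assumes q: "q \<in> holomorphic_charts N D"
  shows "orientation_compatible (half_plane, Echart \<tau>) q"
proof -
  obtain W g where qe: "q = (W, g)" by (cases q)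
  have W: "open W" "local_param N D W g" using q unfolding qe holomorphic_charts_def by auto
  have injg: "inj_on g W" by (rule local_paramD(3)[OF W(2)])
  have gD: "g t \<in> D" if "t \<in> W" for t
    using openin_imp_subset[OF local_paramD(1)[OF W(2)]] that by blast
  show ?thesis unfolding qe orientation_compatible_iff
  proof (intro ballI impI)
    fix z assume z: "z \<in> half_plane" "Echart \<tau> z \<in> g ` W"
    let ?X = "half_plane \<inter> Echart \<tau> -` (g ` W)"
    obtain b where b: "b \<in> W" "g b = Echart \<tau> z" using z(2) by force
    obtain V0 hh where V0: "open V0" "b \<in> V0" "V0 \<subseteq> W" "lifts_to N V0 g hh"
      "\<And>P' i. P' \<in> N \<Longrightarrow> (\<lambda>t. hh P' t $ i) holomorphic_on V0"
    proof -
      have "\<exists>V h. open V \<and> b \<in> V \<and> V \<subseteq> W \<and> lifts_to N V g h \<and>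
        (\<lambda>t. fst (fst (g t))) holomorphic_on V \<and>
        (\<forall>i. (\<lambda>t. snd (fst (g t)) $ i) holomorphic_on V) \<and>
        (\<forall>P\<in>N. \<forall>i. (\<lambda>t. h P t $ i) holomorphic_on V)"
        using q b(1) unfolding qe holomorphic_charts_def by simp
      then show ?thesis using that by auto
    qed
    define vv where "vv t = V (plane_part (hh cP t))" for t
    have hhn: "hh cP t \<noteq> 0" "snd (g t) cP = cpoint (hh cP t)" if "t \<in> V0" for t
      using V0(4) that P_node unfolding lifts_to_def by simp_all
    have holv: "vv holomorphic_on V0"
      unfolding vv_def[abs_def] complex_linear_part_def plane_part_nth
      by (intro holomorphic_intros V0(5) P_node)
    define V1 where "V1 = V0 \<inter> vv -` (- {0})"
    have V1: "open V1" "V1 \<subseteq> V0"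
      unfolding V1_def using continuous_open_preimage[OF holomorphic_on_imp_continuous_on[OF holv] V0(1)]
      by auto
    have fin: "finite_part (g t) \<longleftrightarrow> t \<in> V1" if "t \<in> V0" for t
      using ratio_cpoint(2)[OF hhn(1)[OF that]] that hhn(2)[OF that]
      unfolding finite_part_def V1_def vv_def by simp
    \<comment> \<open>The affine coordinate of \<open>g t\<close>, computed from a holomorphic lift.\<close>
    define \<psi> where "\<psi> t = of_real \<tau> * (hh cP t $ 1 / vv t / \<kappa>)" for t
    have \<psi>: "\<psi> t = of_real \<tau> * zc (g t)" "Echart \<tau> (\<psi> t) = g t" if "t \<in> V1" for t
    proof -
      have t: "t \<in> V0" "t \<in> W" using that V1(2) V0(3) by auto
      show e: "\<psi> t = of_real \<tau> * zc (g t)"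
        unfolding \<psi>_def zc_def vv_def hhn(2)[OF t(1)] ratio_cpoint(1)[OF hhn(1)[OF t(1)]] ..
      show "Echart \<tau> (\<psi> t) = g t"
        unfolding e Echart_def tau_sq using finite_part_eq_E[OF gD[OF t(2)]] fin[OF t(1)] that by simp
    qed
    have hol\<psi>: "\<psi> holomorphic_on V1"
      unfolding \<psi>_def[abs_def] using V1(2) kappa_nonzero
      by (intro holomorphic_intros holomorphic_on_subset[OF holv] holomorphic_on_subset[OF V0(5)[OF P_node]])
        (auto simp: V1_def)
    have inj\<psi>: "inj_on \<psi> V1"
    proof (rule inj_onI)
      fix t t' assume t: "t \<in> V1" "t' \<in> V1" "\<psi> t = \<psi> t'"
      then have "g t = g t'" using \<psi>(2) by metis
      then show "t = t'" using inj_onD[OF injg] t V1(2) V0(3) by blast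
    qed
    have "finite_part (g b)" unfolding b(2) Echart_def using finite_part_E[of "of_real \<tau> * z" 1] by simp
    then have bV: "b \<in> V1" using fin V0(2) by blast
    have \<psi>b: "\<psi> b = z" unfolding \<psi>(1)[OF bV] b(2) Echart_def by (simp add: zc_E tau_sq)
    obtain k where k: "k holomorphic_on (\<psi> ` V1)"
      "\<And>t. t \<in> V1 \<Longrightarrow> deriv \<psi> t * deriv k (\<psi> t) = 1" "\<And>t. t \<in> V1 \<Longrightarrow> k (\<psi> t) = t"
      using holomorphic_has_inverse[OF hol\<psi> V1(1) inj\<psi>] by blast
    have op: "open (\<psi> ` V1)" by (rule open_mapping_thm3[OF hol\<psi> V1(1) inj\<psi>])
    have z1: "z \<in> \<psi> ` V1" using bV \<psi>b by blast
    define d where "d = deriv k z"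
    have d: "(k has_field_derivative d) (at z)"
      unfolding d_def by (rule holomorphic_derivI[OF k(1) op z1])
    have d0: "d \<noteq> 0" using k(2)[OF bV] unfolding \<psi>b d_def by auto
    have kk: "inv_into W g (Echart \<tau> z') = k z'" if z': "z' \<in> \<psi> ` V1" for z'
    proof -
      obtain t where t: "t \<in> V1" "z' = \<psi> t" using z' by blast
      show ?thesis unfolding t(2) \<psi>(2)[OF t(1)] k(3)[OF t(1)]
        using injg t(1) V1(2) V0(3) by (intro inv_into_f_f) auto
    qed
    obtain e where e: "0 < e" "ball z e \<subseteq> \<psi> ` V1" using op z1 open_contains_ball by blast
    have "(k has_derivative (\<lambda>\<xi>. d * \<xi>)) (at z within ?X)"
      using d unfolding has_field_derivative_def by (rule has_derivative_at_withinI)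
    then have "((\<lambda>t. inv_into W g (Echart \<tau> t)) has_derivative (\<lambda>\<xi>. d * \<xi>)) (at z within ?X)"
    proof (rule has_derivative_transform_within[OF _ e(1)])
      show "z \<in> ?X" using z by simp
      fix z' assume "dist z' z < e"
      then have "z' \<in> \<psi> ` V1" using e(2) by (auto simp: dist_commute)
      then show "k z' = inv_into W g (Echart \<tau> z')" by (rule kk[symmetric])
    qed
    moreover have "0 < cdet (\<lambda>\<xi>. d * \<xi>)"
    proof -
      have "cdet (\<lambda>\<xi>. d * \<xi>) = Re d * Re d + Im d * Im d" by (simp add: cdet_def)
      then show ?thesis using d0 by (simp add: complex_eq_iff sum_squares_gt_zero_iff)
    qed
    ultimately show "\<exists>A. ((\<lambda>t. inv_into W g (Echart \<tau> t)) has_derivative A) (at z within ?X) \<and> 0 < cdet A"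
      by blast
  qed
qed

lemma Echart_in_complex_orientation: "(half_plane, Echart \<tau>) \<in> complex_orientation N D (hemisphere \<tau>)"
  unfolding complex_orientation_def using hemisphere_param(1) Echart_compatible_holomorphic by blast

text \<open>A chart of the hemisphere is compared with the holomorphic chart of the whole sphere; on the
  hemisphere the latter restricts to the chart on the half plane.\<close>

lemma complex_orientation_compatible:
  assumes p: "p \<in> complex_orientation N D (hemisphere \<tau>)"
  shows "orientation_compatible p (half_plane, Echart \<tau>)"
proof -
  obtain U1 g where pe: "p = (U1, g)" by (cases p)
  have s: "(U1, g) \<in> surface_charts N (hemisphere \<tau>)"
    and c: "orientation_compatible (U1, g) (UNIV, Echart \<tau>)"
    using p Echart_holomorphic unfolding pe complex_orientation_def by auto
  have gH: "g t \<in> hemisphere \<tau>" if "t \<in> U1" for t using surface_chartD(7)[OF s] that by blast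
  have HD: "hemisphere \<tau> \<subseteq> D" unfolding hemisphere_def by blast
  have dom: "U1 \<inter> g -` (Echart \<tau> ` half_plane) = U1 \<inter> g -` (Echart \<tau> ` UNIV)"
    unfolding hemisphere_param(2) sphere_param(2) using gH HD by blast
  show ?thesis unfolding pe orientation_compatible_iff
  proof (intro ballI impI)
    fix z assume z: "z \<in> U1" "g z \<in> Echart \<tau> ` half_plane"
    then have "g z \<in> Echart \<tau> ` UNIV" by blast
    then obtain A where A: "((\<lambda>t. inv_into UNIV (Echart \<tau>) (g t)) has_derivative A)
        (at z within U1 \<inter> g -` (Echart \<tau> ` half_plane))" "0 < cdet A"
      using c z(1) unfolding orientation_compatible_iff dom by blast
    have zX: "z \<in> U1 \<inter> g -` (Echart \<tau> ` half_plane)" using z by simp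
    have "((\<lambda>t. inv_into half_plane (Echart \<tau>) (g t)) has_derivative A) (at z within U1 \<inter> g -` (Echart \<tau> ` half_plane))"
    proof (rule has_derivative_transform[OF zX _ A(1)])
      fix t assume "t \<in> U1 \<inter> g -` (Echart \<tau> ` half_plane)"
      then have t: "g t \<in> hemisphere \<tau>" "finite_part (g t)" unfolding hemisphere_param(2) by simp_all
      then have tD: "g t \<in> D" using HD by blast
      show "inv_into half_plane (Echart \<tau>) (g t) = inv_into UNIV (Echart \<tau>) (g t)"
        unfolding hemisphere_param(3)[OF t] sphere_param(3)[OF tD t(2)] ..
    qed
    then show "\<exists>A. ((\<lambda>t. inv_into half_plane (Echart \<tau>) (g t)) has_derivative A)
        (at z within U1 \<inter> g -` (Echart \<tau> ` half_plane)) \<and> 0 < cdet A" using A(2) by blast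
  qed
qed

lemma open_hemisphere_eq: "open_hemisphere \<tau> = Echart \<tau> ` {z. 0 < Im z}"
proof (intro equalityI subsetI)
  fix x assume x: "x \<in> open_hemisphere \<tau>"
  then have xD: "x \<in> D" "0 < \<tau> * side x" unfolding open_hemisphere_def by simp_all
  have f: "finite_part x" using xD(2) unfolding finite_part_def side_def by auto
  have "0 < \<tau> * side (E (zc x) 1)" using xD finite_part_eq_E[OF xD(1) f] by simp
  then have "0 < Im (of_real \<tau> * zc x)" using signed_side_E(1)[of "zc x" 1 \<tau>] by simp
  moreover have "x = Echart \<tau> (of_real \<tau> * zc x)"
    unfolding Echart_def tau_sq by (rule finite_part_eq_E[OF xD(1) f])
  ultimately show "x \<in> Echart \<tau> ` {z. 0 < Im z}" by blast
next
  fix x assume "x \<in> Echart \<tau> ` {z. 0 < Im z}"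
  then obtain z where z: "0 < Im z" "x = E (of_real \<tau> * z) 1" unfolding Echart_def by blast
  have "\<tau> * (\<tau> * Im z) = Im z" using tau by auto
  then have "0 < \<tau> * Im (of_real \<tau> * z * cnj 1)" using z(1) tau by auto
  then have "0 < \<tau> * side x" unfolding z(2) by (subst signed_side_E(1)) simp_all
  then show "x \<in> open_hemisphere \<tau>" unfolding open_hemisphere_def z(2) using E_in_D by simp
qed

lemma continuous_on_Echart: "continuous_on W (Echart \<tau>)"
  unfolding Echart_def[abs_def]
  by (rule continuous_on_compose2[OF continuous_on_E_affine[of UNIV]]) (intro continuous_intros, simp)

lemma connected_open_hemisphere: "connected (open_hemisphere \<tau>)" "open_hemisphere \<tau> \<noteq> {}"
proof -
  show "connected (open_hemisphere \<tau>)"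
    unfolding open_hemisphere_eq
    by (intro connected_continuous_image continuous_on_Echart convex_connected convex_halfspace_Im_gt)
  have "\<i> \<in> {z. 0 < Im z}" by simp
  then show "open_hemisphere \<tau> \<noteq> {}" unfolding open_hemisphere_eq by blast
qed

lemma finite_hemisphere_in_closure:
  assumes "x \<in> hemisphere \<tau>" "finite_part x"
  shows "x \<in> closure (open_hemisphere \<tau>)"
proof -
  have "x \<in> Echart \<tau> ` half_plane" using assms unfolding hemisphere_param(2) by blast
  then obtain z where z: "0 \<le> Im z" "x = Echart \<tau> z" by blast
  define \<phi> where "\<phi> r = Echart \<tau> (z + of_real r * \<i>)" for r :: real
  have "\<phi> 0 \<in> closure (open_hemisphere \<tau>)"
  proof (rule curve_end_in_closure)
    show "(0 :: real) < 1" by simp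
    show "continuous_on {0..1} \<phi>" unfolding \<phi>_def[abs_def]
      by (rule continuous_on_compose2[OF continuous_on_Echart[of UNIV]]) (intro continuous_intros, simp)
    fix r :: real assume "0 < r"
    then have "z + of_real r * \<i> \<in> {z. 0 < Im z}" using z(1) by simp
    then show "\<phi> r \<in> open_hemisphere \<tau>" unfolding \<phi>_def open_hemisphere_eq by blast
  qed
  then show ?thesis unfolding z(2) \<phi>_def by simp
qed

lemma closure_open_hemisphere_side:
  assumes "x \<in> closure (open_hemisphere \<tau>)" "x \<in> D"
  shows "x \<in> hemisphere \<tau>"
proof -
  have "open_hemisphere \<tau> \<subseteq> - {x. 0 < (- \<tau>) * side x}" unfolding open_hemisphere_def by auto
  then have "closure (open_hemisphere \<tau>) \<subseteq> - {x. 0 < (- \<tau>) * side x}"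
    by (rule closure_minimal) (rule closed_Compl[OF open_side])
  then show ?thesis using assms unfolding hemisphere_def by auto
qed

end

definition increasing :: "real \<Rightarrow> curve_chart \<Rightarrow> bool" where
  "increasing \<tau> = (\<lambda>(I, c). \<forall>s\<in>I. finite_part (c s) \<longrightarrow>
     (\<exists>d>0. ((\<lambda>t. of_real \<tau> * zc (c t)) has_vector_derivative complex_of_real d)
        (at s within {t \<in> I. finite_part (c t)})))"

text \<open>Applies to charts that agree with \<open>\<tau> s / t\<close> on the circle, both of the lifted chamber and of a
  hemisphere.\<close>

lemma boundary_orientation_single:
  assumes img: "\<And>x. x \<in> S \<Longrightarrow> x \<in> g ` U1 \<longleftrightarrow> finite_part x"
    and inv: "\<And>x. x \<in> S \<Longrightarrow> finite_part x \<Longrightarrow> inv_into U1 g x = of_real \<tau> * zc x"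
  shows "boundary_orientation N {(U1, g)} S = {p \<in> curve_charts N S. increasing \<tau> p}"
proof -
  have "(\<forall>s\<in>I. c s \<in> g ` U1 \<longrightarrow> (\<exists>d>0. ((\<lambda>t. inv_into U1 g (c t)) has_vector_derivative complex_of_real d)
      (at s within I \<inter> c -` (g ` U1)))) \<longleftrightarrow> increasing \<tau> (I, c)" if Ic: "(I, c) \<in> curve_charts N S" for I c
  proof -
    have cS: "c t \<in> S" if "t \<in> I" for t
      using Ic openin_imp_subset[OF local_paramD(1)[of N S I c]] that unfolding curve_charts_def by blast
    have dom: "I \<inter> c -` (g ` U1) = {t \<in> I. finite_part (c t)}"
    proof (rule set_eqI)
      fix t show "t \<in> I \<inter> c -` (g ` U1) \<longleftrightarrow> t \<in> {t \<in> I. finite_part (c t)}"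
        using img[OF cS[of t]] by (cases "t \<in> I") simp_all
    qed
    have eq: "((\<lambda>t. inv_into U1 g (c t)) has_vector_derivative d) (at s within {t \<in> I. finite_part (c t)})
      \<longleftrightarrow> ((\<lambda>t. of_real \<tau> * zc (c t)) has_vector_derivative d) (at s within {t \<in> I. finite_part (c t)})"
      if s: "s \<in> I" "finite_part (c s)" for s d
    proof -
      have "inv_into U1 g (c t) = of_real \<tau> * zc (c t)" if "t \<in> {t \<in> I. finite_part (c t)}" for t
        using inv[OF cS[of t]] that by simp
      moreover have "s \<in> {t \<in> I. finite_part (c t)}" using s by simp
      ultimately show ?thesis
        unfolding has_vector_derivative_def
        by (intro iffI; elim has_derivative_transform[rotated 2]) simp_all
    qed
    have "c s \<in> g ` U1 \<longleftrightarrow> finite_part (c s)" if "s \<in> I" for s using img[OF cS[OF that]] .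
    then show ?thesis unfolding increasing_def prod.case dom using eq by (simp cong: ball_cong)
  qed
  then have "(I, c) \<in> boundary_orientation N {(U1, g)} S
      \<longleftrightarrow> (I, c) \<in> {p \<in> curve_charts N S. increasing \<tau> p}" for I c
    unfolding boundary_orientation_def by (cases "(I, c) \<in> curve_charts N S") simp_all
  then show ?thesis by (intro set_eqI) (simp only: split_paired_all)
qed

end

section \<open>Reversing curves\<close>

lemma C1_derivative_reverse:
  fixes f :: "real \<Rightarrow> 'b::real_normed_vector"
  assumes "C1_derivative W f f'"
  shows "C1_derivative (uminus ` W) (\<lambda>t. f (- t)) (\<lambda>t. - f' (- t))"
  unfolding C1_derivative_def
proof (intro conjI ballI)
  have img: "uminus ` uminus ` W = W" by (simp add: image_image)
  fix t assume t: "t \<in> uminus ` W"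
  have "((\<lambda>t :: real. - t) has_derivative (\<lambda>\<xi>. - \<xi>)) (at t within uminus ` W)"
    by (intro has_derivative_minus has_derivative_ident)
  moreover have "(f has_derivative blinfun_apply (f' (- t))) (at (- t) within uminus ` uminus ` W)"
    using assms t unfolding img C1_derivative_def by auto
  ultimately have "((\<lambda>t. f (- t)) has_derivative (\<lambda>\<xi>. blinfun_apply (f' (- t)) (- \<xi>))) (at t within uminus ` W)"
    by (rule has_derivative_in_compose)
  then show "((\<lambda>t. f (- t)) has_derivative blinfun_apply (- f' (- t))) (at t within uminus ` W)"
    by (simp add: blinfun.minus_left[abs_def] blinfun.minus_right)
next
  have "continuous_on (uminus ` W) (\<lambda>t. f' (- t))"
    by (rule continuous_on_compose2[of W f']) (use assms in \<open>auto simp: C1_derivative_def intro!: continuous_intros\<close>)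
  then show "continuous_on (uminus ` W) (\<lambda>t. - f' (- t))" by (rule continuous_on_minus)
qed

lemma openin_reverse:
  fixes I V :: "real set"
  assumes "openin (top_of_set I) V"
  shows "openin (top_of_set (uminus ` I)) (uminus ` V)"
proof -
  obtain T where T: "open T" "V = I \<inter> T" using assms unfolding openin_open by blast
  have "uminus ` V = uminus ` I \<inter> uminus ` T" unfolding T(2) by auto
  then show ?thesis using open_negations[OF T(1)] unfolding openin_open by blast
qed

lemma C1_immersion_reverse:
  fixes c :: "real \<Rightarrow> xpoint"
  assumes "C1_immersion N I c"
  shows "C1_immersion N (uminus ` I) (\<lambda>t. c (- t))"
  unfolding C1_immersion_def
proof
  fix z assume "z \<in> uminus ` I"
  then have z: "- z \<in> I" by auto
  from bspec[OF assms[unfolded C1_immersion_def] z]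
  obtain V h q' h' where V: "openin (top_of_set I) V" "- z \<in> V" "lifts_to N V c h"
    "C1_derivative V (\<lambda>t. fst (c t)) q'" "\<forall>P\<in>N. C1_derivative V (h P) (h' P)"
    and inj: "\<forall>\<xi>. blinfun_apply (q' (- z)) \<xi> = 0 \<and>
      (\<forall>P\<in>N. \<exists>d. blinfun_apply (h' P (- z)) \<xi> = d *s h P (- z)) \<longrightarrow> \<xi> = 0"
    by (elim exE conjE) (rule that; assumption)
  have 1: "openin (top_of_set (uminus ` I)) (uminus ` V)" by (rule openin_reverse[OF V(1)])
  have 2: "z \<in> uminus ` V" using image_eqI[OF _ V(2), of z uminus] by simp
  have 3: "lifts_to N (uminus ` V) (\<lambda>t. c (- t)) (\<lambda>P t. h P (- t))"
    using V(3) unfolding lifts_to_def by simp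
  have 4: "C1_derivative (uminus ` V) (\<lambda>t. fst (c (- t))) (\<lambda>t. - q' (- t))"
    by (rule C1_derivative_reverse[OF V(4)])
  have 5: "\<forall>P\<in>N. C1_derivative (uminus ` V) (\<lambda>t. h P (- t)) (\<lambda>t. - h' P (- t))"
    using V(5) C1_derivative_reverse by blast
  have 6: "\<xi> = 0" if q: "blinfun_apply (- q' (- z)) \<xi> = 0"
    and hd: "\<forall>P\<in>N. \<exists>d. blinfun_apply (- h' P (- z)) \<xi> = d *s h P (- z)" for \<xi>
  proof (rule inj[rule_format, OF conjI])
    show "blinfun_apply (q' (- z)) \<xi> = 0" using q by (simp add: blinfun.minus_left)
    show "\<forall>P\<in>N. \<exists>d. blinfun_apply (h' P (- z)) \<xi> = d *s h P (- z)"
    proof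
      fix P assume "P \<in> N"
      then obtain d where "blinfun_apply (- h' P (- z)) \<xi> = d *s h P (- z)" using hd by blast
      then have "- blinfun_apply (h' P (- z)) \<xi> = d *s h P (- z)" by (simp only: blinfun.minus_left)
      then have "blinfun_apply (h' P (- z)) \<xi> = - (d *s h P (- z))" by (simp only: minus_equation_iff[of _ "d *s h P (- z)"])
      also have "\<dots> = (- d) *s h P (- z)" by (simp add: vec_eq_iff)
      finally have "blinfun_apply (h' P (- z)) \<xi> = (- d) *s h P (- z)" .
      then show "\<exists>d. blinfun_apply (h' P (- z)) \<xi> = d *s h P (- z)" by blast
    qed
  qed
  show "\<exists>V h q' h'. openin (top_of_set (uminus ` I)) V \<and> z \<in> V \<and> lifts_to N V (\<lambda>t. c (- t)) h \<and>
      C1_derivative V (\<lambda>t. fst (c (- t))) q' \<and> (\<forall>P\<in>N. C1_derivative V (h P) (h' P)) \<and>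
      (\<forall>\<xi>. blinfun_apply (q' z) \<xi> = 0 \<and> (\<forall>P\<in>N. \<exists>c. blinfun_apply (h' P z) \<xi> = c *s h P z) \<longrightarrow> \<xi> = 0)"
    by (rule exI[of _ "uminus ` V"], rule exI[of _ "\<lambda>P t. h P (- t)"], rule exI[of _ "\<lambda>t. - q' (- t)"],
        rule exI[of _ "\<lambda>P t. - h' P (- t)"], intro conjI allI impI 1 2 3 4 5, elim conjE, rule 6)
qed

definition reverse_curve :: "curve_chart \<Rightarrow> curve_chart" where
  "reverse_curve = (\<lambda>(I, c). (uminus ` I, \<lambda>t. c (- t)))"

lemma reverse_reverse: "reverse_curve (reverse_curve p) = p"
  by (cases p) (simp add: reverse_curve_def image_image)

lemma opposite_orientation_eq: "opposite_orientation \<sigma> = reverse_curve ` \<sigma>"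
  unfolding opposite_orientation_def reverse_curve_def ..

lemma reverse_curve_chart:
  assumes "p \<in> curve_charts N S"
  shows "reverse_curve p \<in> curve_charts N S"
proof -
  obtain I c where p: "p = (I, c)" by (cases p)
  have I: "open I" "local_param N S I c" using assms unfolding p curve_charts_def by auto
  obtain g' where g': "homeomorphism I (c ` I) c g'" using I(2) unfolding local_param_def by blast
  have img: "(\<lambda>t. c (- t)) ` uminus ` I = c ` I" by (simp add: image_image)
  have "homeomorphism (uminus ` I) (c ` I) (\<lambda>t. c (- t)) (\<lambda>x. - g' x)"
    unfolding homeomorphism_def
  proof (intro conjI ballI)
    show "continuous_on (uminus ` I) (\<lambda>t. c (- t))"
      by (rule continuous_on_compose2[of I c]) (use g' in \<open>auto simp: homeomorphism_def intro!: continuous_intros\<close>)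
    show "continuous_on (c ` I) (\<lambda>x. - g' x)"
      using g' by (intro continuous_on_minus) (simp add: homeomorphism_def)
    show "(\<lambda>x. - g' x) ` c ` I = uminus ` I"
      using g' unfolding homeomorphism_def image_image by (intro image_cong) auto
  qed (use g' img in \<open>auto simp: homeomorphism_def\<close>)
  then have "local_param N S (uminus ` I) (\<lambda>t. c (- t))"
    using I(2) C1_immersion_reverse[of N I c] unfolding local_param_def img by blast
  then show ?thesis
    unfolding p reverse_curve_def curve_charts_def using open_negations[OF I(1)] by simp
qed

lemma (in nodal_corner) increasing_reverse:
  assumes "increasing \<tau> p"
  shows "increasing (- \<tau>) (reverse_curve p)"
proof -
  obtain I c where p: "p = (I, c)" by (cases p)
  have "\<exists>d>0. ((\<lambda>t. of_real (- \<tau>) * zc (c (- t))) has_vector_derivative complex_of_real d)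
      (at s within {t \<in> uminus ` I. finite_part (c (- t))})"
    if s: "s \<in> uminus ` I" "finite_part (c (- s))" for s
  proof -
    let ?F = "\<lambda>t. of_real \<tau> * zc (c t)"
    let ?X = "{t \<in> uminus ` I. finite_part (c (- t))}"
    have X: "uminus ` ?X = {t \<in> I. finite_part (c t)}" by force
    obtain d where d: "0 < d" "(?F has_vector_derivative complex_of_real d) (at (- s) within {t \<in> I. finite_part (c t)})"
      using assms s unfolding p increasing_def by auto
    have "((\<lambda>t :: real. - t) has_vector_derivative - 1) (at s within ?X)"
      by (auto intro!: derivative_eq_intros)
    then have "(?F \<circ> uminus has_vector_derivative - 1 *\<^sub>R complex_of_real d) (at s within ?X)"
      by (rule vector_diff_chain_within) (simp add: X d(2))
    then have "((\<lambda>t. - (?F \<circ> uminus) t) has_vector_derivative - (- 1 *\<^sub>R complex_of_real d)) (at s within ?X)"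
      by (rule has_vector_derivative_minus)
    then show ?thesis using d(1) by (intro exI[of _ d]) simp
  qed
  then show ?thesis unfolding p reverse_curve_def increasing_def by auto
qed

section \<open>The capping hemispheres\<close>

lemma components_two_open:
  fixes X :: "'a::topological_space set"
  assumes X: "A \<union> B = X" "A = X \<inter> O1" "B = X \<inter> O2" "A \<inter> B = {}" and op: "open O1" "open O2"
    and con: "connected A" "connected B" and ne: "A \<noteq> {}" "B \<noteq> {}"
  shows "components X = {A, B}"
proof -
  have "d = A'" if "A' \<union> B' = X" "A' = X \<inter> O1'" "B' = X \<inter> O2'" "A' \<inter> B' = {}" "open O1'" "open O2'"
    "A' \<noteq> {}" "A' \<subseteq> d" "d \<subseteq> X" "connected d" for A' B' O1' O2' d
  proof (rule ccontr)
    assume "d \<noteq> A'"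
    then have "O2' \<inter> d \<noteq> {}" "O1' \<inter> d \<noteq> {}" using that by auto
    moreover have "O1' \<inter> O2' \<inter> d = {}" "d \<subseteq> O1' \<union> O2'" using that by auto
    ultimately show False using that(5,6,10) unfolding connected_def by blast
  qed
  note max = this
  have A: "A \<in> components X"
    unfolding in_components_maximal using X(1) ne con max[OF X op ne(1)] by blast
  have B: "B \<in> components X"
    unfolding in_components_maximal
    using X(1) ne con max[of B A O2 O1] X op by (metis Int_commute Un_commute Un_upper2)
  have "K = A \<or> K = B" if K: "K \<in> components X" for K
  proof -
    have "K \<noteq> {}" "K \<subseteq> X" using in_components_nonempty[OF K] in_components_subset[OF K] by blast+
    then have "K \<inter> A \<noteq> {} \<or> K \<inter> B \<noteq> {}" using X(1) by blast
    then show ?thesis using components_eq[OF K A] components_eq[OF K B] by blast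
  qed
  then show ?thesis using A B by blast
qed

context nodal_corner
begin

lemma chart_in_S_real: "chart z \<in> S \<Longrightarrow> Im z = 0"
proof -
  assume "chart z \<in> S"
  then have x: "chart z \<in> D" unfolding boundary_circle_def by blast
  obtain s t where "chart z = E s t" by (rule D_cases[OF x])
  then have "snd (fst (chart z)) = cP" by (simp add: E_fst)
  then have "pt z = P" by (simp add: chart_def)
  then show "Im z = 0" using ab_pt(2)[of z] by simp
qed

lemma S_subset: "S \<subseteq> M" "S \<subseteq> D" "S \<subseteq> hemisphere \<tau>"
  using S_side unfolding boundary_circle_def hemisphere_def by auto

text \<open>On the boundary line \<open>\<rho> = 0\<close> the coordinate \<open>\<zeta>\<close> of the corner chart is \<open>\<sigma> s / t\<close>.\<close>

lemma chart_on_S: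
  assumes x: "x \<in> S"
  shows "x \<in> chart ` dom \<longleftrightarrow> finite_part x"
    "finite_part x \<Longrightarrow> inv_into dom chart x = of_real \<sigma> * zc x"
proof -
  have xD: "x \<in> D" using x S_subset by blast
  obtain s t where "x = E s t" by (rule D_cases[OF xD])
  then have f: "fst x = (0, cP)" by (simp add: E_fst)
  show r: "x \<in> chart ` dom \<longleftrightarrow> finite_part x"
    unfolding chart_image rng_def finite_part_def using x S_subset others_pos_P by (auto simp: f)
  assume fin: "finite_part x"
  have "x = E (zc x) 1" by (rule finite_part_eq_E[OF xD fin])
  then have "Im (zc x) = 0" using E_in_S_iff[of "zc x" 1] x by simp
  moreover have "ratio (snd x cP) / (\<kappa>0 * of_real (\<sigma> * sqrt (h P))) = of_real \<sigma> * zc x"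
    unfolding zc_def \<kappa>_def using sigma_cases by auto
  ultimately have "coord x = of_real \<sigma> * zc x"
    unfolding coord_def Let_def f by (simp add: complex_eq_iff)
  then show "inv_into dom chart x = of_real \<sigma> * zc x" using inv_chart r fin by simp
qed

lemma Echart_on_S:
  assumes tau: "\<tau> = 1 \<or> \<tau> = -1" and x: "x \<in> S"
  shows "x \<in> Echart \<tau> ` half_plane \<longleftrightarrow> finite_part x"
    "finite_part x \<Longrightarrow> inv_into half_plane (Echart \<tau>) x = of_real \<tau> * zc x"
proof -
  have xh: "x \<in> hemisphere \<tau>" using x S_subset by blast
  show "x \<in> Echart \<tau> ` half_plane \<longleftrightarrow> finite_part x"
    unfolding hemisphere_param(2)[OF tau] using xh by blast
  show "finite_part x \<Longrightarrow> inv_into half_plane (Echart \<tau>) x = of_real \<tau> * zc x"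
    by (rule hemisphere_param(3)[OF tau xh])
qed

lemma Echart_in_S_real:
  assumes tau: "\<tau> = 1 \<or> \<tau> = -1" and z: "Echart \<tau> z \<in> S"
  shows "Im z = 0"
  using E_in_S_iff[of "of_real \<tau> * z" 1] z tau unfolding Echart_def by auto

lemma real_circle_chart: "(UNIV, \<lambda>r :: real. E (of_real r) 1) \<in> curve_charts N S"
proof -
  have "local_param N S UNIV (\<lambda>r :: real. E (of_real r) 1)"
  proof (rule E_affine_local_param(1)[where \<mu> = Re])
    show "Re (zc x) \<in> UNIV \<and> complex_of_real (Re (zc x)) = zc x" if "x \<in> S" "finite_part x" for x
    proof -
      have "x \<in> D" using that S_subset by blast
      then have "x = E (zc x) 1" by (rule finite_part_eq_E[OF _ that(2)])
      then have "Im (zc x) = 0" using E_in_S_iff[of "zc x" 1] that by simp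
      then show ?thesis by (simp add: complex_eq_iff)
    qed
  qed (use S_subset in \<open>auto simp: E_in_S_iff intro: reachable_open continuous_intros bounded_linear_of_real\<close>)
  then show ?thesis unfolding curve_charts_def by simp
qed

end

lemma boundary_orientation_insert:
  "boundary_orientation N {p, q} S = boundary_orientation N {p} S \<inter> boundary_orientation N {q} S"
  unfolding boundary_orientation_def by auto

lemma sgn_eq_nonneg_iff:
  fixes a b :: real
  assumes "sgn a = sgn b"
  shows "0 < a \<longleftrightarrow> 0 < b" "0 \<le> a \<longleftrightarrow> 0 \<le> b"
  using assms by (auto simp: sgn_real_def split: if_splits)

locale swapped_corners = corner_pair \<A> lam C eps l m P C eps m l P for \<A> lam C eps l m P
begin

abbreviation D :: "xpoint set" where "D \<equiv> c1.D"
abbreviation S :: "xpoint set" where "S \<equiv> c1.S"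
abbreviation \<gamma> :: "surface_chart set" where "\<gamma> \<equiv> c1.chamber_orientation C eps"

lemmas E_swap = swapped_E[OF refl refl refl refl]

lemma sigma_swap: "c2.\<sigma> = - c1.\<sigma>"
  by (rule swapped_basis(3)[OF refl refl refl refl])

text \<open>Exchanging the lines replaces \<open>s / t\<close> by its inverse, whose imaginary part has the opposite sign.\<close>

lemma side_swap:
  assumes "x \<in> D"
  shows "sgn (- \<tau> * c2.side x) = sgn (\<tau> * c1.side x)"
proof -
  obtain s t where st: "(s, t) \<noteq> (0, 0)" "x = c1.E s t" by (rule c1.D_cases[OF assms])
  have ts: "(t, s) \<noteq> (0, 0)" using st(1) by auto
  have "sgn (c2.side x) = sgn (Im (t * cnj s))"
    unfolding st(2) E_swap[symmetric] by (rule c2.sgn_side_E[OF ts])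
  also have "Im (t * cnj s) = - Im (s * cnj t)" by simp
  finally have e2: "sgn (c2.side x) = - sgn (Im (s * cnj t))" by (simp only: sgn_minus)
  have e1: "sgn (c1.side x) = sgn (Im (s * cnj t))" unfolding st(2) by (rule c1.sgn_side_E[OF st(1)])
  show ?thesis unfolding sgn_mult e1 e2 sgn_minus by (rule minus_mult_minus)
qed

lemma hemisphere_swap:
  "c2.hemisphere (- \<tau>) = c1.hemisphere \<tau>" "c2.open_hemisphere (- \<tau>) = c1.open_hemisphere \<tau>"
  unfolding c1.hemisphere_def c2.hemisphere_def c1.open_hemisphere_def c2.open_hemisphere_def
  using sgn_eq_nonneg_iff[OF side_swap] by blast+

lemma finite_part_cover: "x \<in> D \<Longrightarrow> c1.finite_part x \<or> c2.finite_part x"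
proof -
  assume "x \<in> D"
  then obtain s t where st: "(s, t) \<noteq> (0, 0)" "x = c1.E s t" by (rule c1.D_cases)
  then have ts: "(t, s) \<noteq> (0, 0)" by auto
  show ?thesis
    using c1.finite_part_E[OF st(1)] c2.finite_part_E[OF ts] st unfolding E_swap by auto
qed

text \<open>The point with \<open>t = 0\<close> is reached in the affine coordinate of the other order of the lines.\<close>

lemma closure_open_hemisphere:
  assumes tau: "\<tau> = 1 \<or> \<tau> = -1"
  shows "D \<inter> closure (c1.open_hemisphere \<tau>) = c1.hemisphere \<tau>"
proof (intro equalityI subsetI)
  fix x assume "x \<in> D \<inter> closure (c1.open_hemisphere \<tau>)"
  then show "x \<in> c1.hemisphere \<tau>" using c1.closure_open_hemisphere_side[OF tau] by blast
next
  fix x assume x: "x \<in> c1.hemisphere \<tau>"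
  then have xD: "x \<in> D" unfolding c1.hemisphere_def by blast
  have tau': "- \<tau> = 1 \<or> - \<tau> = -1" using tau by auto
  have "x \<in> closure (c1.open_hemisphere \<tau>)"
    using finite_part_cover[OF xD] c1.finite_hemisphere_in_closure[OF tau x]
      c2.finite_hemisphere_in_closure[OF tau', of x] x unfolding hemisphere_swap by blast
  then show "x \<in> D \<inter> closure (c1.open_hemisphere \<tau>)" using xD by blast
qed

lemma components_sphere: "components (D - S) = {c1.open_hemisphere 1, c1.open_hemisphere (- 1)}"
proof (rule components_two_open)
  show "open {x. 0 < 1 * c1.side x}" "open {x. 0 < (- 1) * c1.side x}" by (rule c1.open_side)+
  show "connected (c1.open_hemisphere 1)" "connected (c1.open_hemisphere (- 1))"
    "c1.open_hemisphere 1 \<noteq> {}" "c1.open_hemisphere (- 1) \<noteq> {}"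
    using c1.connected_open_hemisphere[of 1] c1.connected_open_hemisphere[of "- 1"] by simp_all
  show "c1.open_hemisphere 1 \<union> c1.open_hemisphere (- 1) = D - S"
    "c1.open_hemisphere 1 = (D - S) \<inter> {x. 0 < 1 * c1.side x}"
    "c1.open_hemisphere (- 1) = (D - S) \<inter> {x. 0 < (- 1) * c1.side x}"
    "c1.open_hemisphere 1 \<inter> c1.open_hemisphere (- 1) = {}"
    unfolding c1.S_side c1.open_hemisphere_def by auto
qed

lemma hemispheres_eq: "hemispheres D S = {c1.hemisphere 1, c1.hemisphere (- 1)}"
  unfolding hemispheres_def components_sphere by (simp add: closure_open_hemisphere)

text \<open>The direction in which \<open>\<tau> s / t\<close> increases. At \<open>s / t = \<infinity>\<close> this is expressed by the coordinate
  \<open>- \<tau> t / s\<close>.\<close>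

definition circle_orientation :: "real \<Rightarrow> curve_chart set" where
  "circle_orientation \<tau> = {p \<in> curve_charts c1.N S. c1.increasing \<tau> p \<and> c2.increasing (- \<tau>) p}"

lemma opposite_circle_orientation: "opposite_orientation (circle_orientation \<tau>) = circle_orientation (- \<tau>)"
proof -
  have rev: "reverse_curve p \<in> circle_orientation (- t)" if "p \<in> circle_orientation t" for p t
    using that reverse_curve_chart c1.increasing_reverse[of t p] c2.increasing_reverse[of "- t" p]
    unfolding circle_orientation_def by simp
  show ?thesis unfolding opposite_orientation_eq
  proof (intro equalityI subsetI)
    fix p assume "p \<in> reverse_curve ` circle_orientation \<tau>"
    then show "p \<in> circle_orientation (- \<tau>)" using rev by blast
  next
    fix p assume "p \<in> circle_orientation (- \<tau>)"
    then have "reverse_curve p \<in> circle_orientation \<tau>" using rev[of p "- \<tau>"] by simp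
    then show "p \<in> reverse_curve ` circle_orientation \<tau>"
      by (intro image_eqI[of _ _ "reverse_curve p"]) (simp_all add: reverse_reverse)
  qed
qed

text \<open>The parametrization by \<open>s / t\<close> itself belongs to only one of them; where \<open>s / t\<close> is nonzero, the
  other coordinate \<open>- t / s\<close> increases with it.\<close>

lemma circle_orientations_differ: "circle_orientation 1 \<noteq> circle_orientation (- 1)"
proof -
  define c where "c = (\<lambda>r :: real. c1.E (of_real r) 1)"
  have zc1: "c1.zc (c r) = of_real r" "c1.finite_part (c r)" for r
    unfolding c_def by (simp_all add: c1.zc_E c1.finite_part_E)
  have c2: "c r = c2.E 1 (of_real r)" for r unfolding c_def E_swap ..
  have f2: "c2.finite_part (c r) \<longleftrightarrow> r \<noteq> 0" for r unfolding c2 by (simp add: c2.finite_part_E)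
  have zc2: "c2.zc (c r) = of_real (1 / r)" if "r \<noteq> 0" for r
    unfolding c2 using that by (subst c2.zc_E) simp_all
  have "c1.increasing 1 (UNIV, c)"
    unfolding c1.increasing_def prod.case zc1(1)
    using zc1(2) by (auto intro!: exI[of _ 1] derivative_eq_intros)
  moreover have "c2.increasing (- 1) (UNIV, c)"
    unfolding c2.increasing_def prod.case
  proof (intro ballI impI)
    fix s :: real assume "c2.finite_part (c s)"
    then have s: "s \<noteq> 0" using f2 by blast
    have X: "{t \<in> UNIV. c2.finite_part (c t)} = - {0}" using f2 by auto
    have "((\<lambda>t :: real. - (1 / t)) has_real_derivative 1 / s\<^sup>2) (at s within - {0})"
      using s by (auto intro!: derivative_eq_intros simp: power2_eq_square)
    then have "((\<lambda>t. complex_of_real (- (1 / t))) has_vector_derivative of_real (1 / s\<^sup>2)) (at s within - {0})"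
      by (intro has_vector_derivative_of_real) (simp add: has_real_derivative_iff_has_vector_derivative)
    then have "((\<lambda>t. of_real (- 1) * c2.zc (c t)) has_vector_derivative of_real (1 / s\<^sup>2)) (at s within - {0})"
      using s unfolding has_vector_derivative_def
      by (elim has_derivative_transform[rotated 2]) (simp_all add: zc2)
    then show "\<exists>d>0. ((\<lambda>t. of_real (- 1) * c2.zc (c t)) has_vector_derivative complex_of_real d)
        (at s within {t \<in> UNIV. c2.finite_part (c t)})"
      unfolding X using s by (intro exI[of _ "1 / s\<^sup>2"]) simp
  qed
  ultimately have "(UNIV, c) \<in> circle_orientation 1"
    using c1.real_circle_chart unfolding circle_orientation_def c_def by simp
  moreover have "\<not> c1.increasing (- 1) (UNIV, c)"
  proof
    assume "c1.increasing (- 1) (UNIV, c)"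
    then obtain d :: real where d: "0 < d"
      "((\<lambda>t. of_real (- 1) * complex_of_real t) has_vector_derivative complex_of_real d) (at 0)"
      unfolding c1.increasing_def prod.case zc1(1) using zc1(2) by auto
    have "((\<lambda>t. of_real (- 1) * complex_of_real t) has_vector_derivative - 1) (at 0)"
      by (auto intro!: derivative_eq_intros)
    then have "complex_of_real d = - 1" using d(2) vector_derivative_unique_at by blast
    then have "d = - 1" by (simp add: complex_eq_iff)
    then show False using d(1) by simp
  qed
  ultimately show ?thesis unfolding circle_orientation_def by blast
qed

lemma circle_orientation_inj:
  assumes "\<tau> = 1 \<or> \<tau> = - 1" "\<tau>' = 1 \<or> \<tau>' = - 1" "circle_orientation \<tau> = circle_orientation \<tau>'"
  shows "\<tau> = \<tau>'"
  using assms circle_orientations_differ by metis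

text \<open>The two corner charts at \<open>P\<close>, one for each order of the lines, cover the circle.\<close>

lemma boundary_chamber_orientation: "boundary_orientation c1.N \<gamma> S = circle_orientation c1.\<sigma>"
proof -
  let ?A = "{(c1.dom, c1.chart), (c2.dom, c2.chart)}"
  have atlas: "?A \<subseteq> c1.corner_atlas C eps"
    unfolding c1.corner_atlas_def using c1.corner c2.corner by blast
  have "boundary_orientation c1.N \<gamma> S = boundary_orientation c1.N ?A S"
  proof (rule boundary_orientation_atlas)
    show "\<gamma> \<subseteq> surface_charts c1.N c1.M"
      using c1.is_orientation_chamber(1)[OF c1.signs] unfolding is_orientation_def by blast
    show "?A \<subseteq> \<gamma>" using atlas c1.is_orientation_chamber(2)[OF c1.signs] by blast
    show "orientation_compatible p q" if "p \<in> \<gamma>" "q \<in> ?A" for p q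
      using that atlas unfolding c1.chamber_orientation_def generated_orientation_def by blast
    show "S \<subseteq> c1.M" by (rule c1.S_subset)
    show "S \<subseteq> (\<Union>(U, g)\<in>?A. g ` U)"
    proof
      fix x assume x: "x \<in> S"
      then have "c1.finite_part x \<or> c2.finite_part x" using finite_part_cover c1.S_subset by blast
      then have "x \<in> c1.chart ` c1.dom \<or> x \<in> c2.chart ` c2.dom"
        using c1.chart_on_S(1)[OF x] c2.chart_on_S(1)[OF x] by blast
      then show "x \<in> (\<Union>(U, g)\<in>?A. g ` U)" by simp
    qed
    show "Im z = 0" if "(U, g) \<in> ?A" "z \<in> U" "g z \<in> S" for U g z
      using that c1.chart_in_S_real c2.chart_in_S_real by blast
  qed
  also have "\<dots> = circle_orientation c1.\<sigma>"
  proof -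
    have "boundary_orientation c1.N {(c1.dom, c1.chart)} S = {p \<in> curve_charts c1.N S. c1.increasing c1.\<sigma> p}"
      by (rule c1.boundary_orientation_single[OF c1.chart_on_S])
    moreover have "boundary_orientation c1.N {(c2.dom, c2.chart)} S = {p \<in> curve_charts c1.N S. c2.increasing (- c1.\<sigma>) p}"
      unfolding sigma_swap[symmetric] by (rule c2.boundary_orientation_single[OF c2.chart_on_S])
    ultimately show ?thesis unfolding boundary_orientation_insert[of _ "(c1.dom, c1.chart)"] circle_orientation_def by blast
  qed
  finally show ?thesis .
qed

text \<open>The hemisphere on which \<open>\<tau> s / t\<close> lies in the upper half plane induces on the circle the direction in
  which \<open>\<tau> s / t\<close> increases. Near \<open>t = 0\<close> the coordinate \<open>- \<tau> t / s\<close> takes over.\<close>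

lemma boundary_complex_orientation:
  assumes tau: "\<tau> = 1 \<or> \<tau> = -1"
  shows "boundary_orientation c1.N (complex_orientation c1.N D (c1.hemisphere \<tau>)) S = circle_orientation \<tau>"
proof -
  have tau': "- \<tau> = 1 \<or> - \<tau> = -1" using tau by auto
  let ?B = "complex_orientation c1.N D (c1.hemisphere \<tau>)"
  let ?A = "{(c1.half_plane, c1.Echart \<tau>), (c1.half_plane, c2.Echart (- \<tau>))}"
  have "boundary_orientation c1.N ?B S = boundary_orientation c1.N ?A S"
  proof (rule boundary_orientation_atlas)
    show "?B \<subseteq> surface_charts c1.N (c1.hemisphere \<tau>)" unfolding complex_orientation_def by blast
    show "?A \<subseteq> ?B"
      using c1.Echart_in_complex_orientation[OF tau] c2.Echart_in_complex_orientation[OF tau']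
      unfolding hemisphere_swap by blast
    show "orientation_compatible p q" if "p \<in> ?B" "q \<in> ?A" for p q
      using that c1.complex_orientation_compatible[OF tau] c2.complex_orientation_compatible[OF tau']
      unfolding hemisphere_swap by blast
    show "S \<subseteq> c1.hemisphere \<tau>" by (rule c1.S_subset)
    show "S \<subseteq> (\<Union>(U, g)\<in>?A. g ` U)"
    proof
      fix x assume x: "x \<in> S"
      then have "c1.finite_part x \<or> c2.finite_part x" using finite_part_cover c1.S_subset by blast
      then have "x \<in> c1.Echart \<tau> ` c1.half_plane \<or> x \<in> c2.Echart (- \<tau>) ` c1.half_plane"
        using c1.Echart_on_S(1)[OF tau x] c2.Echart_on_S(1)[OF tau' x] by blast
      then show "x \<in> (\<Union>(U, g)\<in>?A. g ` U)" by simp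
    qed
    show "Im z = 0" if "(U, g) \<in> ?A" "z \<in> U" "g z \<in> S" for U g z
      using that c1.Echart_in_S_real[OF tau] c2.Echart_in_S_real[OF tau'] by blast
  qed
  also have "\<dots> = circle_orientation \<tau>"
  proof -
    have "boundary_orientation c1.N {(c1.half_plane, c1.Echart \<tau>)} S = {p \<in> curve_charts c1.N S. c1.increasing \<tau> p}"
      by (rule c1.boundary_orientation_single[OF c1.Echart_on_S[OF tau]])
    moreover have "boundary_orientation c1.N {(c1.half_plane, c2.Echart (- \<tau>))} S = {p \<in> curve_charts c1.N S. c2.increasing (- \<tau>) p}"
      by (rule c2.boundary_orientation_single[OF c2.Echart_on_S[OF tau']])
    ultimately show ?thesis
      unfolding boundary_orientation_insert[of _ "(c1.half_plane, c1.Echart \<tau>)"] circle_orientation_def by blast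
  qed
  finally show ?thesis .
qed

text \<open>The lifted chamber makes \<open>\<sigma> s / t\<close> increase, the capping hemisphere must do the opposite.\<close>

lemma capping_hemisphere_eq: "capping_hemisphere \<A> lam C \<gamma> (complexify P) = c1.hemisphere (- c1.\<sigma>)"
proof -
  have opp: "opposite_orientation (boundary_orientation c1.N \<gamma> S) = circle_orientation (- c1.\<sigma>)"
    unfolding boundary_chamber_orientation by (rule opposite_circle_orientation)
  have s: "- c1.\<sigma> = 1 \<or> - c1.\<sigma> = -1" using c1.sigma_cases by auto
  show ?thesis
    unfolding capping_hemisphere_def Let_def opp
  proof (rule the_equality)
    show "c1.hemisphere (- c1.\<sigma>) \<in> hemispheres D S \<and>
      boundary_orientation c1.N (complex_orientation c1.N D (c1.hemisphere (- c1.\<sigma>))) S = circle_orientation (- c1.\<sigma>)"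
      using s boundary_complex_orientation[OF s] unfolding hemispheres_eq by auto
    fix H assume H: "H \<in> hemispheres D S \<and>
      boundary_orientation c1.N (complex_orientation c1.N D H) S = circle_orientation (- c1.\<sigma>)"
    then obtain \<tau> where \<tau>: "\<tau> = 1 \<or> \<tau> = -1" "H = c1.hemisphere \<tau>" unfolding hemispheres_eq by auto
    have "circle_orientation \<tau> = circle_orientation (- c1.\<sigma>)"
      using H boundary_complex_orientation[OF \<tau>(1)] unfolding \<tau>(2) by simp
    then have "\<tau> = - c1.\<sigma>" by (rule circle_orientation_inj[OF \<tau>(1) s])
    then show "H = c1.hemisphere (- c1.\<sigma>)" using \<tau>(2) by simp
  qed
qed

end

lemma (in nodal_corner) capping_hemisphere_chamber:
  "capping_hemisphere \<A> lam C (chamber_orientation C eps) cP = hemisphere (- \<sigma>)"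
proof -
  have "nodal_corner \<A> lam C eps m l P" by (rule nodal_cornerI[OF signs]) (simp add: corner corner_swap)
  then interpret sw: swapped_corners \<A> lam C eps l m P
    unfolding swapped_corners_def corner_pair_def using nodal_corner_axioms by blast
  show ?thesis by (rule sw.capping_hemisphere_eq)
qed

section \<open>Opposite chambers at a node\<close>

context corner_pair
begin

context
  assumes opp: "l' = l" "m' = m" "P' = P" "eps' l = - eps l" "eps' m = - eps m"
    and others: "\<And>k. k \<in> \<A> \<Longrightarrow> k \<noteq> l \<Longrightarrow> k \<noteq> m \<Longrightarrow> eps' k = eps k"
begin

lemma opposite_ab: "c2.a = - c1.a" "c2.b = - c1.b"
  unfolding c1.a_def c1.b_def c2.a_def c2.b_def
  unfolding opp by simp_all

lemma opposite_basis: "c2.eu = - c1.eu" "c2.ev = - c1.ev" "c2.\<sigma> = c1.\<sigma>"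
proof -
  have d: "det2 (- c1.a) (- c1.b) = det2 c1.a c1.b" by (simp add: det2_def)
  have p: "perp (- x) = - perp x" for x by (simp add: vec_eq_iff forall_2)
  show "c2.eu = - c1.eu" "c2.ev = - c1.ev"
    unfolding c2.eu_def c1.eu_def c2.ev_def c1.ev_def opposite_ab d p by simp_all
  show "c2.\<sigma> = c1.\<sigma>" unfolding c1.\<sigma>_def c2.\<sigma>_def opposite_ab d ..
qed

lemma opposite_kappa: "c2.\<kappa> = c1.\<kappa>"
proof -
  have "c2.\<eta> = eps' l * (eps' m * (\<Prod>k\<in>\<A> - {l, m}. eps' k))"
    unfolding c2.\<eta>_def by (rule c1.prod_lines)
  also have "(\<Prod>k\<in>\<A> - {l, m}. eps' k) = (\<Prod>k\<in>\<A> - {l, m}. eps k)"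
    using others by (intro prod.cong) auto
  finally have "c2.\<eta> = eps l * (eps m * (\<Prod>k\<in>\<A> - {l, m}. eps k))" unfolding opp by simp
  also have "\<dots> = c1.\<eta>" unfolding c1.\<eta>_def by (rule c1.prod_lines[symmetric])
  finally have e: "c2.\<eta> = c1.\<eta>" .
  have "c2.h P = (\<Prod>k\<in>\<A> - {l, m}. eps' k * c1.rv k P)"
    unfolding c2.h_def unfolding opp ..
  also have "\<dots> = c1.h P" unfolding c1.h_def using others by (intro prod.cong) auto
  finally show ?thesis
    unfolding c1.\<kappa>_def c2.\<kappa>_def c1.\<kappa>0_def c2.\<kappa>0_def e unfolding opp(3) by simp
qed

text \<open>In the affine coordinates of the two chambers the sphere is turned by \<open>s / t \<mapsto> - s / t\<close>.\<close>

lemma opposite_E: "c2.E s t = c1.E (- s) t" if "(s, t) \<noteq> (0, 0)"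
proof -
  have "join (c1.\<kappa> * s * t) (c2.dir s t) = (- 1) *s join (c1.\<kappa> * - s * t) (c1.dir (- s) t)"
  proof -
    have "complexify (- x) = (- 1) *s complexify x" for x by (simp add: vec_eq_iff)
    then have "c2.dir s t = (- 1) *s c1.dir (- s) t"
      unfolding c1.dir_def c2.dir_def opposite_basis by (simp add: vec_eq_iff algebra_simps)
    then show ?thesis unfolding join_scale[symmetric] by simp
  qed
  moreover have "join (c1.\<kappa> * - s * t) (c1.dir (- s) t) \<noteq> 0"
    using that by (intro c1.E_vector_nonzero) auto
  ultimately have "cpoint (join (c1.\<kappa> * s * t) (c2.dir s t)) = cpoint (join (c1.\<kappa> * - s * t) (c1.dir (- s) t))"
    using cpoint_scale[of "join (c1.\<kappa> * - s * t) (c1.dir (- s) t)" "- 1"] by simp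
  then show ?thesis
    unfolding c1.E_def c2.E_def c1.xexc_def opposite_kappa
    unfolding opp(3) by (simp only:)
qed

text \<open>The point with \<open>s / t = \<i>\<close> for the first chamber has \<open>s / t = - \<i>\<close> for the second.\<close>

lemma opposite_hemispheres: "c1.hemisphere (- c1.\<sigma>) \<noteq> c2.hemisphere (- c2.\<sigma>)"
proof -
  have 1: "c1.E \<i> 1 \<in> c1.hemisphere \<tau> \<longleftrightarrow> 0 \<le> \<tau>" for \<tau>
    unfolding c1.hemisphere_def using c1.E_in_D[of \<i> 1] c1.signed_side_E(2)[of \<i> 1 \<tau>] by simp
  have 2: "c1.E \<i> 1 \<in> c2.hemisphere \<tau> \<longleftrightarrow> 0 \<le> - \<tau>" for \<tau>
  proof -
    have e: "c1.E \<i> 1 = c2.E (- \<i>) 1" using opposite_E[of "- \<i>" 1] by simp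
    show ?thesis unfolding e c2.hemisphere_def
      using c2.E_in_D[of "- \<i>" 1] c2.signed_side_E(2)[of "- \<i>" 1 \<tau>] by simp
  qed
  show ?thesis
  proof
    assume "c1.hemisphere (- c1.\<sigma>) = c2.hemisphere (- c2.\<sigma>)"
    then have "c1.E \<i> 1 \<in> c1.hemisphere (- c1.\<sigma>) \<longleftrightarrow> c1.E \<i> 1 \<in> c2.hemisphere (- c1.\<sigma>)"
      unfolding opposite_basis(3) by (simp only:)
    then have "0 \<le> - c1.\<sigma> \<longleftrightarrow> 0 \<le> - (- c1.\<sigma>)" unfolding 1 2 .
    then show False using c1.sigma_cases by auto
  qed
qed

end

end

theorem proposition1p5:
  fixes \<A> :: "(real ^ 2) set set" and lam :: "(real ^ 2) set \<Rightarrow> affine_fun"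
  assumes "nodal_arrangement \<A>" and "defines_lines \<A> lam"
  shows "\<exists>\<gamma> :: (real ^ 2) set \<Rightarrow> surface_chart set.
    (\<forall>C\<in>bounded_chambers \<A>. is_orientation (nodes \<A> lam) (lifted_chamber \<A> lam C) (\<gamma> C)) \<and>
    (\<forall>C\<in>bounded_chambers \<A>. \<forall>C'\<in>bounded_chambers \<A>. \<forall>P.
       C \<inter> C' = {P} \<longrightarrow> coherent \<A> lam P C (\<gamma> C) C' (\<gamma> C'))"
proof -
  interpret nodal_lines \<A> lam by unfold_locales (fact assms)+
  have "\<forall>C\<in>bounded_chambers \<A>. \<exists>eps. has_signs C eps"
    using bounded_chamber_signs by metis
  then obtain eps where eps: "\<And>C. C \<in> bounded_chambers \<A> \<Longrightarrow> has_signs C (eps C)"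
    by (auto dest!: bchoice)
  have "coherent \<A> lam P C (chamber_orientation C (eps C)) C' (chamber_orientation C' (eps C'))"
    if C: "C \<in> bounded_chambers \<A>" "C' \<in> bounded_chambers \<A>" and P: "C \<inter> C' = {P}" for C C' P
  proof -
    note s = eps[OF C(1)] eps[OF C(2)]
    obtain l m where lm: "corner C l m P" "corner C' l m P" "eps C' l = - eps C l" "eps C' m = - eps C m"
      "\<And>k. k \<in> \<A> \<Longrightarrow> k \<noteq> l \<Longrightarrow> k \<noteq> m \<Longrightarrow> eps C' k = eps C k"
      using opposite_corner[OF s P] by metis
    interpret pair: corner_pair \<A> lam C "eps C" l m P C' "eps C'" l m P
      unfolding corner_pair_def using nodal_cornerI[OF s(1) lm(1)] nodal_cornerI[OF s(2) lm(2)] by blast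
    show ?thesis
      unfolding coherent_def pair.c1.capping_hemisphere_chamber pair.c2.capping_hemisphere_chamber
      by (rule pair.opposite_hemispheres[OF refl refl refl lm(3,4,5)])
  qed
  then show ?thesis
    using is_orientation_chamber(1)[OF eps]
    by (intro exI[of _ "\<lambda>C. chamber_orientation C (eps C)"]) blast
qed

end
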